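(* Let $\mathcal{L}=\bigoplus_{i\in\mathbb{Z}^+}\mathbb{C}[\partial]L_i$ be a $\mathbb{Z}^+$-graded Lie conformal algebra, where each $\mathbb{C}[\partial]L_i$ is a free $\mathbb{C}[\partial]$-module of rank one and $[{L_i}_\lambda L_j]=p_{i,j}(\partial,\lambda)L_{i+j}$ with $p_{i,j}(\partial,\lambda)\in\mathbb{C}[\partial,\lambda]$. Assume that $[{L_0}_\lambda L_0]=(\partial+2\lambda)L_0$ and that $[{L_1}_\lambda L_i]\neq 0$ for all $i\in\mathbb{Z}^+$. Let $a_i,b_i\in\mathbb{C}$ be the numbers with $[{L_0}_\lambda L_i]=(\partial+a_i\lambda+b_i)L_i$ for all $i\in\mathbb{Z}^+$. Then any non-trivial finite irreducible $\mathcal{L}$-module must be free of rank one as a $\mathbb{C}[\partial]$-module. Moreover, suppose that $V=\mathbb{C}[\partial]v$ is a rank one non-trivial irreducible $\mathcal{L}$-module. Then: (1) if $a_1\neq 2$, then $$ {L_0}_\lambda v=(\partial+\Delta\lambda+c)v,\qquad {L_1}_\lambda v=\gamma v,\qquad {L_i}_\lambda v=0\ \text{ for all } i>1,$$ for some $\Delta,c,\gamma\in\mathbb{C}$; in addition, $\gamma\neq 0$ only if $a_1=1$, and $\Delta\neq 0$ when $\gamma=0$; (2) if $a_1=2$, then $$ {L_0}_\lambda v=(\partial+\Delta\lambda+c)v,\qquad {L_i}_\lambda v=c_i(\partial+\Delta\lambda+c)v\ \text{ for all } i\geq 1,$$ for some $\Delta, c, c_i\in\mathbb{C}$ with $\Delta\neq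 0$.
   Context: $\mathbb{Z}^+$ is the set of nonnegative integers; everything is over $\mathbb{C}$. A Lie conformal algebra $\mathcal{A}$ is a $\mathbb{C}[\partial]$-module with a $\mathbb{C}$-bilinear $\lambda$-bracket $[\cdot_\lambda\cdot]:\mathcal{A}\otimes\mathcal{A}\to\mathcal{A}[\lambda]$ such that $[\partial a_\lambda b]=-\lambda[a_\lambda b]$, $[a_\lambda\partial b]=(\partial+\lambda)[a_\lambda b]$, $[a_\lambda b]=-[b_{-\lambda-\partial}a]$, and $[a_\lambda[b_\mu c]]=[[a_\lambda b]_{\lambda+\mu}c]+[b_\mu[a_\lambda c]]$. An $\mathcal{A}$-module is a $\mathbb{C}[\partial]$-module $M$ with a $\mathbb{C}$-linear map $\mathcal{A}\otimes M\to M[\lambda]$, $a\otimes m\mapsto a_\lambda m$, such that $(\partial a)_\lambda m=-\lambda a_\lambda m$, $a_\lambda(\partial m)=(\partial+\lambda)a_\lambda m$, $a_\lambda(b_\mu m)=[a_\lambda b]_{\lambda+\mu}m+b_\mu(a_\lambda m)$. A submodule is a $\mathbb{C}[\partial]$-submodule $N$ with $a_\lambda N\subseteq N[\lambda]$ for all $a\in\mathcal{A}$; irreducible means having no submodules other than $0$ and itself. A module is finite if finitely generated over $\mathbb{C}[\partial]$, and trivial if $a_\lambda m=0$ for all $a,m$. Under the stated hypotheses on $\mathcal{L}$, for every $i\in\mathbb{Z}^+$ one has $[{L_0}_\lambda L_i]=(\partial+a_i\lambda+b_i)L_i$ for unique $a_i,b_i\in\mathbb{C}$. *)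

theory Defs
  imports "HOL-Computational_Algebra.Polynomial"
begin

text \<open>
  A \<open>\<complex>[\<partial>]\<close>-module is a \<^locale>\<open>module\<close> over the ring \<^typ>\<open>complex poly\<close>; the indeterminate
  of that ring is \<open>\<partial>\<close>. For an abelian group \<open>A\<close>, the group \<open>A[\<lambda>]\<close> is \<open>A poly\<close>, and
  \<open>A[\<lambda>,\<mu>]\<close> is \<open>A poly poly\<close> with \<open>\<mu>\<close> the outer and \<open>\<lambda>\<close> the inner variable.
\<close>

abbreviation del :: "(complex poly \<Rightarrow> 'a::ab_group_add \<Rightarrow> 'a) \<Rightarrow> 'a \<Rightarrow> 'a" where
  "del scale x \<equiv> scale [:0, 1:] x"

text \<open>
  Substitution of an operator for the variable: \<open>\<Sum>\<^sub>n \<lambda>\<^sup>n x\<^sub>n\<close> is sent to \<open>\<Sum>\<^sub>n T\<^sup>n (e x\<^sub>n)\<close>.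
\<close>

definition subst_op :: "('a::zero \<Rightarrow> 'b::comm_monoid_add) \<Rightarrow> ('b \<Rightarrow> 'b) \<Rightarrow> 'a poly \<Rightarrow> 'b" where
  "subst_op e T q = (\<Sum>n\<le>degree q. (T ^^ n) (e (coeff q n)))"

definition mult_lam :: "'a::ab_group_add poly poly \<Rightarrow> 'a poly poly" where
  "mult_lam = map_poly (pCons 0)"

definition mult_mu :: "'a::ab_group_add poly poly \<Rightarrow> 'a poly poly" where
  "mult_mu = pCons 0"

definition mult_lam_plus_mu :: "'a::ab_group_add poly poly \<Rightarrow> 'a poly poly" where
  "mult_lam_plus_mu Q = mult_lam Q + mult_mu Q"

definition at_op :: "('a::ab_group_add poly poly \<Rightarrow> 'a poly poly) \<Rightarrow> 'a poly \<Rightarrow> 'a poly poly" where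
  "at_op T = subst_op (\<lambda>x. [:[:x:]:]) T"

text \<open>
  \<open>P(\<partial>,\<lambda>) x\<close> for \<open>P\<close> in \<open>\<complex>[\<partial>,\<lambda>] = \<complex>[\<partial>][\<lambda>]\<close>: the outer variable of \<open>P\<close> is \<open>\<lambda>\<close>, the inner one
  is \<open>\<partial>\<close>.
\<close>

definition bipoly_act ::
  "(complex poly \<Rightarrow> 'a::ab_group_add \<Rightarrow> 'a) \<Rightarrow> complex poly poly \<Rightarrow> 'a \<Rightarrow> 'a poly" where
  "bipoly_act scale P x = map_poly (\<lambda>q. scale q x) P"

definition lin_poly :: "complex \<Rightarrow> complex \<Rightarrow> complex poly poly"  \<comment> \<open>\<open>\<partial> + \<Delta>\<lambda> + c\<close>\<close> where
  "lin_poly \<Delta> c = [:[:c, 1:], [:\<Delta>:]:]"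

text \<open>
  In the Jacobi identity \<open>[a\<^sub>\<lambda> -]\<close> is extended coefficientwise, so that for instance
  \<open>[a\<^sub>\<lambda> [b\<^sub>\<mu> c]]\<close> is \<open>\<Sum>\<^sub>n \<mu>\<^sup>n [a\<^sub>\<lambda> x\<^sub>n]\<close> and \<open>[[a\<^sub>\<lambda> b]\<^bsub>\<lambda>+\<mu>\<^esub> c]\<close> is \<open>\<Sum>\<^sub>n \<lambda>\<^sup>n [y\<^sub>n \<^bsub>\<lambda>+\<mu>\<^esub> c]\<close>, where
  \<open>[b\<^sub>\<mu> c] = \<Sum>\<^sub>n \<mu>\<^sup>n x\<^sub>n\<close> and \<open>[a\<^sub>\<lambda> b] = \<Sum>\<^sub>n \<lambda>\<^sup>n y\<^sub>n\<close>.
\<close>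

locale lie_conformal_algebra = module scale
  for scale :: "complex poly \<Rightarrow> 'a::ab_group_add \<Rightarrow> 'a" +
  fixes bracket :: "'a \<Rightarrow> 'a \<Rightarrow> 'a poly"
  assumes bracket_add_left: "bracket (a + a') b = bracket a b + bracket a' b"
    and bracket_add_right: "bracket a (b + b') = bracket a b + bracket a b'"
    and bracket_scale_left: "bracket (scale [:k:] a) b = map_poly (scale [:k:]) (bracket a b)"
    and bracket_scale_right: "bracket a (scale [:k:] b) = map_poly (scale [:k:]) (bracket a b)"
    and bracket_del_left: "bracket (del scale a) b = - pCons 0 (bracket a b)"
    and bracket_del_right:
      "bracket a (del scale b) = map_poly (del scale) (bracket a b) + pCons 0 (bracket a b)"
    and skew_symmetry:
      "bracket a b =
        - subst_op (\<lambda>x. [:x:]) (\<lambda>q. - pCons 0 q - map_poly (del scale) q) (bracket b a)"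
    and jacobi:
      "subst_op (\<lambda>x. at_op mult_lam (bracket a x)) mult_mu (bracket b c) =
        subst_op (\<lambda>y. at_op mult_lam_plus_mu (bracket y c)) mult_lam (bracket a b)
        + subst_op (\<lambda>z. at_op mult_mu (bracket b z)) mult_lam (bracket a c)"

locale conformal_module =
  A: lie_conformal_algebra scaleA bracket + M: module scaleM
  for scaleA :: "complex poly \<Rightarrow> 'a::ab_group_add \<Rightarrow> 'a"
    and bracket :: "'a \<Rightarrow> 'a \<Rightarrow> 'a poly"
    and scaleM :: "complex poly \<Rightarrow> 'm::ab_group_add \<Rightarrow> 'm" +
  fixes act :: "'a \<Rightarrow> 'm \<Rightarrow> 'm poly"
  assumes act_add_left: "act (a + a') m = act a m + act a' m"
    and act_add_right: "act a (m + m') = act a m + act a m'"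
    and act_scale_left: "act (scaleA [:k:] a) m = map_poly (scaleM [:k:]) (act a m)"
    and act_scale_right: "act a (scaleM [:k:] m) = map_poly (scaleM [:k:]) (act a m)"
    and act_del_left: "act (del scaleA a) m = - pCons 0 (act a m)"
    and act_del_right:
      "act a (del scaleM m) = map_poly (del scaleM) (act a m) + pCons 0 (act a m)"
    and act_act:
      "subst_op (\<lambda>x. at_op mult_lam (act a x)) mult_mu (act b m) =
        subst_op (\<lambda>y. at_op mult_lam_plus_mu (act y m)) mult_lam (bracket a b)
        + subst_op (\<lambda>z. at_op mult_mu (act b z)) mult_lam (act a m)"
begin

definition submodule :: "'m set \<Rightarrow> bool" where
  "submodule N \<longleftrightarrow> M.subspace N \<and> (\<forall>a. \<forall>m\<in>N. \<forall>n. coeff (act a m) n \<in> N)"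

definition irreducible_module :: bool where
  "irreducible_module \<longleftrightarrow> (\<forall>N. submodule N \<longrightarrow> N = {0} \<or> N = UNIV)"

definition trivial_module :: bool where
  "trivial_module \<longleftrightarrow> (\<forall>a m. act a m = 0)"

definition finite_module :: bool where
  "finite_module \<longleftrightarrow> (\<exists>S. finite S \<and> M.span S = UNIV)"

end

definition free_generator :: "(complex poly \<Rightarrow> 'a::ab_group_add \<Rightarrow> 'a) \<Rightarrow> 'a \<Rightarrow> bool" where
  "free_generator scale v \<longleftrightarrow>
    \<not> module.dependent scale {v} \<and> module.span scale {v} = UNIV"

text \<open>
  \<open>\<Oplus>\<^sub>i \<complex>[\<partial>] L\<^sub>i\<close> with every summand free of rank one on \<open>L\<^sub>i\<close>: the \<open>L\<^sub>i\<close> are distinct and form a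
  \<open>\<complex>[\<partial>]\<close>-basis.
\<close>

locale graded_lie_conformal_algebra = lie_conformal_algebra scale bracket
  for scale :: "complex poly \<Rightarrow> 'a::ab_group_add \<Rightarrow> 'a"
    and bracket :: "'a \<Rightarrow> 'a \<Rightarrow> 'a poly" +
  fixes L :: "nat \<Rightarrow> 'a"
  assumes inj_L: "inj L"
    and independent_L: "independent (range L)"
    and span_L: "span (range L) = UNIV"
    and bracket_graded: "\<exists>p. bracket (L i) (L j) = bipoly_act scale p (L (i + j))"

end

theory Submission
  imports Defs "HOL-Complex_Analysis.Laurent_Convergence"
    "HOL-Computational_Algebra.Fundamental_Theorem_Algebra"
begin

text \<open>
  Evaluating \<open>\<lambda>\<close> at complex numbers turns the action of \<open>L\<^sub>i\<close> into a family of operators \<open>L\<^sub>i(\<lambda>)\<close>. On an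
  irreducible module, which is torsion free, \<open>L\<^sub>0(0) = \<partial> + c\<close> for a constant \<open>c\<close>, and a shift of \<open>\<partial>\<close>
  makes \<open>c = 0\<close>. The module is then spanned by eigenvectors of the linear coefficient \<open>E\<close> of \<open>L\<^sub>0(\<lambda>)\<close>;
  the weight spaces are finite dimensional and the real parts of the weights are bounded below. A lowest
  weight vector that is stable under \<open>L\<^sub>1\<close> up to \<open>\<complex>[\<partial>]\<close>-multiples generates the module. If \<open>L\<^sub>1\<close> acts as
  zero, or if \<open>a\<^sub>1 = 1\<close>, so that \<open>N = L\<^sub>1(0)\<close> preserves weights, such a vector exists.

  In the remaining case \<open>(ad N)\<^sup>j L\<^sub>0(\<lambda>)\<close> is a nonzero multiple of \<open>(-\<lambda>)\<^bsup>S j\<^esup> L\<^sub>j(\<lambda>)\<close>. If \<open>N\<close> were nilpotent,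
  only finitely many \<open>L\<^sub>j\<close> would be nonzero, and by Jacobson's lemma the last one would have a kernel,
  which is a submodule. Hence \<open>N\<close> has a nonzero eigenvalue on the fibre at \<open>\<partial> = 1\<close>. With
  \<open>1 + \<lambda> = e\<^sup>u\<close> the matrix coefficients of \<open>(ad N)\<^sup>j L\<^sub>0(\<lambda>)\<close> become exponential sums, and comparing their
  orders of vanishing at \<open>0\<close> and at \<open>2\<pi>i/(a\<^sub>1 - 1)\<close> for large \<open>j\<close> gives \<open>a\<^sub>1 = 2\<close>. Now \<open>N - c\<partial>\<close> is
  nilpotent for some \<open>c\<close>, which yields for every large \<open>M\<close> a linear relation between
  \<open>L\<^sub>0(\<lambda>), \<dots>, L\<^sub>M(\<lambda>)\<close>. Binomial inversion shows \<open>a\<^sub>j = 2\<close> for all \<open>j\<close>, and the kernel argument,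
  applied to iterated brackets with \<open>L\<^sub>1 - c L\<^sub>0\<close>, reduces the relation to \<open>L\<^sub>1 = c L\<^sub>0\<close>.
\<close>

text \<open>The structure polynomials are not classified beforehand. For
  \<open>a_1 \<noteq> 1\<close> and \<open>b_1 = 0\<close> the hypotheses only give
  \<open>p_1j(\<partial>, 0) = e_j \<partial>^(d_j)\<close> with unknown exponents, and then
  \<open>a_j = j (a_1 - 1) + 2 - S_j\<close> with \<open>S_j = d_0 + ... + d_(j-1)\<close>. So the
  \<open>a_j\<close> have to be extracted from the existence of the representation. The substitution
  1 + \<lambda> = e^u comes from the fibres: \<open>L_i(\<lambda>) \<partial> = (\<partial> +
  \<lambda>) L_i(\<lambda>)\<close> means that \<open>L_i(\<lambda>)\<close> leads from the fibre at
  1 + \<lambda> to the fibre at 1, while e^(-uE) rescales \<partial> and leads from the fibre at 1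
  to the fibre at e^u. The composite acts on one finite dimensional space. Moving N past e^(-uE)
  costs a factor e^((a_1 - 1)u); so the zeros of 1 - e^((a_1 - 1)u) meet those of 1 - e^u, which
  stem from the powers of \<lambda>.\<close>

section \<open>The ring of additive operators, commutators and nilpotency\<close>

typedef (overloaded) 'a endo = "{f :: 'a::ab_group_add \<Rightarrow> 'a. \<forall>x y. f (x + y) = f x + f y}"
  morphisms app Endo
  by (rule exI[of _ "\<lambda>x. x"]) simp

setup_lifting type_definition_endo

lemma app_add_right [simp]: "app f (x + y) = app f x + app f y"
  using app[of f] by simp

instantiation endo :: (ab_group_add) ring
begin
lift_definition zero_endo :: "'a endo" is "\<lambda>x. 0" by simp
lift_definition plus_endo :: "'a endo \<Rightarrow> 'a endo \<Rightarrow> 'a endo" is "\<lambda>f g x. f x + g x"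
  by (simp add: algebra_simps)
lift_definition minus_endo :: "'a endo \<Rightarrow> 'a endo \<Rightarrow> 'a endo" is "\<lambda>f g x. f x - g x"
  by (simp add: algebra_simps)
lift_definition uminus_endo :: "'a endo \<Rightarrow> 'a endo" is "\<lambda>f x. - f x"
  by (simp add: algebra_simps)
lift_definition times_endo :: "'a endo \<Rightarrow> 'a endo \<Rightarrow> 'a endo" is "\<lambda>f g x. f (g x)"
  by simp
instance
  by standard (transfer; auto simp: fun_eq_iff algebra_simps)+
end

text \<open>On the zero group 0 = 1, so the instances are \<open>ring\<close> and
  \<open>monoid_mult\<close> separately instead of \<open>ring_1\<close>.\<close>

instantiation endo :: (ab_group_add) monoid_mult
begin
lift_definition one_endo :: "'a endo" is "\<lambda>x. x" by simp
instance
  by standard (transfer; auto)+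
end

lemma app_zero_right [simp]: "app f 0 = 0"
  using app_add_right[of f 0 0] by simp

lemma app_uminus_right [simp]: "app f (- x) = - app f x"
  using app_add_right[of f x "- x"] by (simp add: eq_neg_iff_add_eq_0 add.commute)

lemma app_diff_right [simp]: "app f (x - y) = app f x - app f y"
  using app_add_right[of f x "- y"] by simp

lemma app_sum_right: "app f (\<Sum>i\<in>I. g i) = (\<Sum>i\<in>I. app f (g i))"
  by (induction I rule: infinite_finite_induct) auto

lemma app_ring [simp]:
  "app (0 :: 'a::ab_group_add endo) x = 0" "app (1 :: 'a endo) x = x"
  "app (f + g) x = app f x + app g x" "app (f - g) x = app f x - app g x"
  "app (- f) x = - app f x" "app (f * g) x = app f (app g x)"
  by (transfer; simp)+

lemma app_sum_left: "app (\<Sum>i\<in>I. f i) x = (\<Sum>i\<in>I. app (f i) x)"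
  by (induction I rule: infinite_finite_induct) auto

lemma endo_eqI: "(\<And>x. app f x = app g x) \<Longrightarrow> f = g"
  by (simp add: app_inject[symmetric] fun_eq_iff)

definition ad :: "'r::ring \<Rightarrow> 'r \<Rightarrow> 'r" where
  "ad x y = x * y - y * x"

lemma ad_add: "ad x (y + z) = ad x y + ad x z"
  and ad_diff: "ad x (y - z) = ad x y - ad x z"
  and ad_diff_left: "ad (w - x) y = ad w y - ad x y"
  and ad_zero [simp]: "ad x 0 = 0"
  by (simp_all add: ad_def algebra_simps)

lemma ad_mult_central: "c * x = x * c \<Longrightarrow> ad x (c * y) = c * ad x y"
  by (simp add: ad_def algebra_simps flip: mult.assoc)

lemma ad_mult_central_left: "c * y = y * c \<Longrightarrow> ad (c * x) y = c * ad x y"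
  by (simp add: ad_def algebra_simps) (metis mult.assoc)

text \<open>The outer powers make the induction close: expanding one \<open>ad q\<close> moves a
  factor \<open>q\<close> to the left or to the right and keeps \<open>a + b + n\<close>. At
  \<open>n = 0\<close> one of the two exponents is at least \<open>K\<close>.\<close>

lemma ad_power_nilpotent:
  fixes q y :: "'r :: {ring, monoid_mult}"
  assumes "q ^ K = 0" "a + b + n \<ge> 2 * K"
  shows "q ^ a * (ad q ^^ n) y * q ^ b = 0"
  using assms(2)
proof (induction n arbitrary: a b)
  case 0
  then consider "K \<le> a" | "K \<le> b" by linarith
  then have "q ^ a = 0 \<or> q ^ b = 0"
    by (metis assms(1) le_add_diff_inverse mult_zero_left power_add)
  then show ?case by auto
next
  case (Suc n)
  have "q ^ a * (ad q ^^ Suc n) y * q ^ b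
      = q ^ Suc a * (ad q ^^ n) y * q ^ b - q ^ a * (ad q ^^ n) y * q ^ Suc b"
    by (simp add: ad_def algebra_simps power_commutes)
       (metis mult.assoc power_commutes)
  also have "\<dots> = 0" using Suc.IH[of "Suc a" b] Suc.IH[of a "Suc b"] Suc.prems by simp
  finally show ?case .
qed

lemma ad_power_nilpotent_0:
  fixes q y :: "'r :: {ring, monoid_mult}"
  assumes "q ^ K = 0" "n \<ge> 2 * K"
  shows "(ad q ^^ n) y = 0"
  using ad_power_nilpotent[OF assms(1), of 0 0 n y] assms(2) by simp

text \<open>
  Jacobson's lemma: if \<open>x\<^sup>s y\<^sup>t = 0\<close>, then \<open>0 = y\<^sup>t [x\<^sup>s, z] y\<^sup>t = s x\<^bsup>s-1\<^esup> y\<^bsup>2t+1\<^esup>\<close>.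
\<close>

lemma power_commutator:
  fixes x z :: "'r :: {ring, monoid_mult}"
  assumes "x * ad x z = ad x z * x"
  shows "ad (x ^ Suc s) z = (\<Sum>i<Suc s. x ^ s * ad x z)"
proof (induction s)
  case (Suc s)
  have "ad (x ^ Suc (Suc s)) z = x * ad (x ^ Suc s) z + ad x z * x ^ Suc s"
    by (simp add: ad_def algebra_simps)
  also have "ad x z * x ^ Suc s = x ^ Suc s * ad x z"
    by (rule power_commuting_commutes[symmetric]) (simp add: assms)
  finally show ?case
    by (simp add: Suc.IH sum_distrib_left algebra_simps del: power_Suc sum.lessThan_Suc)
       (simp add: algebra_simps)
qed (simp add: ad_def)

lemma commutator_nilpotent:
  fixes x z :: "'r :: {ring, monoid_mult}"
  assumes nil: "x ^ m = 0"
    and comm: "x * ad x z = ad x z * x"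
    and char0: "\<And>s (y :: 'r). (\<Sum>i<Suc s. y) = 0 \<Longrightarrow> y = 0"
  shows "\<exists>k. ad x z ^ k = 0"
proof -
  define y where "y = ad x z"
  have xy: "x ^ s * y ^ t = y ^ t * x ^ s" for s t
  proof -
    have "x ^ s * y = y * x ^ s"
      by (rule power_commuting_commutes) (simp add: y_def comm)
    then have "y ^ t * x ^ s = x ^ s * y ^ t"
      by (intro power_commuting_commutes) simp
    then show ?thesis by simp
  qed
  \<comment> \<open>Each step lowers the exponent of \<open>x\<close> by one at the price of a
    larger exponent of \<open>y\<close>; after \<open>m\<close> steps only a power of
    \<open>y\<close> is left.\<close>
  have "\<exists>t. x ^ (m - s) * y ^ t = 0" for s
  proof (induction s)
    case 0
    then show ?case by (intro exI[of _ 0]) (simp add: nil)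
  next
    case (Suc s)
    show ?case
    proof (cases "s < m")
      case True
      then obtain r where r: "m - s = Suc r" "m - Suc s = r"
        by (metis Suc_diff_Suc)
      obtain t where t: "x ^ Suc r * y ^ t = 0" using Suc r by auto
      have "y ^ t * (x ^ r * y) * y ^ t = x ^ r * y ^ (t + 1 + t)"
      proof -
        have "y ^ t * (x ^ r * y) * y ^ t = (y ^ t * x ^ r) * (y * y ^ t)"
          by (simp only: mult.assoc)
        also have "\<dots> = x ^ r * (y ^ t * (y * y ^ t))"
          by (simp only: xy[symmetric] mult.assoc)
        also have "y ^ t * (y * y ^ t) = y ^ (t + 1 + t)"
          by (simp only: power_add power_one_right mult.assoc)
        finally show ?thesis .
      qed
      then have "(\<Sum>i<Suc r. x ^ r * y ^ (t + 1 + t)) = y ^ t * ad (x ^ Suc r) z * y ^ t"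
        unfolding power_commutator[OF comm] sum_distrib_left sum_distrib_right y_def[symmetric]
        by simp
      also have "\<dots> = y ^ t * x ^ Suc r * z * y ^ t - y ^ t * z * (x ^ Suc r * y ^ t)"
        by (simp add: ad_def algebra_simps)
      also have "y ^ t * x ^ Suc r = 0"
        unfolding xy[symmetric] by (rule t)
      finally have "x ^ r * y ^ (t + 1 + t) = 0"
        by (rule char0[of _ r, OF trans]) (simp only: t mult_zero_left mult_zero_right diff_0_right)
      then show ?thesis unfolding r(2) by (rule exI)
    qed (use Suc in simp)
  qed
  from this[of m] show ?thesis by (simp add: y_def)
qed

section \<open>Evaluation of polynomials with coefficients in a module\<close>

locale cmodule = module sc for sc :: "complex poly \<Rightarrow> 'v::ab_group_add \<Rightarrow> 'v"
begin

definition Sc :: "complex poly \<Rightarrow> 'v endo" where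
  "Sc p = Endo (sc p)"

lemma app_Sc [simp]: "app (Sc p) v = sc p v"
  by (simp add: Sc_def Endo_inverse scale_right_distrib)

lemma Sc_ring [simp]:
  "Sc 0 = 0" "Sc 1 = 1" "Sc (p + q) = Sc p + Sc q" "Sc (p - q) = Sc p - Sc q"
  "Sc (- p) = - Sc p" "Sc (p * q) = Sc p * Sc q"
  by (rule endo_eqI; simp add: scale_left_distrib scale_left_diff_distrib)+

abbreviation K :: "complex \<Rightarrow> 'v endo" where "K z \<equiv> Sc [:z:]"
abbreviation Del :: "'v endo" where "Del \<equiv> Sc [:0, 1:]"

lemma K_simps [simp]:
  "K 0 = 0" "K 1 = 1"
  by (simp_all flip: one_pCons)

lemma K_add: "K (x + y) = K x + K y"
  and K_diff: "K (x - y) = K x - K y"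
  and K_minus: "K (- x) = - K x"
  and K_mult: "K (x * y) = K x * K y"
  by (simp_all add: mult.commute flip: Sc_ring)

lemma sc_const_const: "sc [:x:] (sc [:y:] v) = sc [:x * y:] v"
  by (simp add: mult.commute)

lemma sc_const_eq_0_iff [simp]: "sc [:x:] v = 0 \<longleftrightarrow> x = 0 \<or> v = 0"
proof
  assume "sc [:x:] v = 0"
  then have "sc [:inverse x * x:] v = 0" by (metis sc_const_const scale_zero_right)
  then show "x = 0 \<or> v = 0" by (cases "x = 0") (auto simp flip: one_pCons)
qed auto

text \<open>Two linear structures coexist: \<open>subspace\<close> and \<open>span\<close> refer to
  the polynomial ring in \<partial>, \<open>C.subspace\<close> and \<open>C.span\<close> to the
  complex numbers. Weight spaces and linear forms belong to the second.\<close>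

sublocale C: vector_space "\<lambda>z. sc [:z:]"
proof
  fix x y :: complex and v w
  show "sc [:x:] (v + w) = sc [:x:] v + sc [:x:] w" by (rule scale_right_distrib)
  show "sc [:x + y:] v = sc [:x:] v + sc [:y:] v" by (simp flip: scale_left_distrib)
  show "sc [:x:] (sc [:y:] v) = sc [:x * y:] v" by (rule sc_const_const)
  show "sc [:1:] v = v" by (simp flip: one_pCons)
qed

definition ev :: "complex \<Rightarrow> 'v poly \<Rightarrow> 'v" where
  "ev z q = (\<Sum>n\<le>degree q. sc [:z ^ n:] (coeff q n))"

lemma ev_bound: "degree q \<le> N \<Longrightarrow> ev z q = (\<Sum>n\<le>N. sc [:z ^ n:] (coeff q n))"
  unfolding ev_def by (rule sum.mono_neutral_left) (auto simp: coeff_eq_0)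

lemma ev_0 [simp]: "ev z 0 = 0"
  by (simp add: ev_def)

lemma ev_add [simp]: "ev z (p + q) = ev z p + ev z q"
proof -
  define N where "N = max (degree p) (degree q)"
  have "degree (p + q) \<le> N" "degree p \<le> N" "degree q \<le> N"
    by (auto simp: N_def degree_add_le)
  then show ?thesis by (simp add: ev_bound[of _ N] scale_right_distrib sum.distrib)
qed

lemma ev_minus [simp]: "ev z (- p) = - ev z p"
  using ev_add[of z p "- p"] by (simp add: eq_neg_iff_add_eq_0 add.commute del: ev_add)

lemma ev_diff [simp]: "ev z (p - q) = ev z p - ev z q"
  using ev_add[of z p "- q"] by simp

lemma ev_pCons [simp]: "ev z (pCons x q) = x + sc [:z:] (ev z q)"
proof -
  have "ev z (pCons x q) = (\<Sum>n\<le>Suc (degree q). sc [:z ^ n:] (coeff (pCons x q) n))"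
    by (rule ev_bound) (simp add: degree_pCons_le)
  also have "\<dots> = x + sc [:z:] (ev z q)"
    unfolding sum.atMost_Suc_shift
    by (simp add: ev_def scale_sum_right mult.commute flip: one_pCons)
  finally show ?thesis .
qed

lemma ev_sum: "ev z (\<Sum>i\<in>I. q i) = (\<Sum>i\<in>I. ev z (q i))"
  by (induction I rule: infinite_finite_induct) auto

lemma ev_zero: "ev 0 q = coeff q 0"
  by (cases q) auto

lemma ev_map_poly:
  assumes "f 0 = 0" "\<And>x y. f (x + y) = f x + f y" "\<And>z x. f (sc [:z:] x) = sc [:z:] (f x)"
  shows "ev z (map_poly f q) = f (ev z q)"
  by (induction q) (simp_all add: map_poly_pCons assms)

definition linear_form :: "('v \<Rightarrow> complex) \<Rightarrow> bool" where
  "linear_form l \<longleftrightarrow> (\<forall>x y. l (x + y) = l x + l y) \<and> (\<forall>z x. l (sc [:z:] x) = z * l x)"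

lemma linear_form_simps:
  assumes "linear_form l"
  shows "l 0 = 0" "l (x + y) = l x + l y" "l (x - y) = l x - l y" "l (- x) = - l x"
    "l (sc [:z:] x) = z * l x"
proof -
  have add: "l (x + y) = l x + l y" and sc: "l (sc [:z:] x) = z * l x" for x y z
    using assms by (auto simp: linear_form_def)
  show l0: "l 0 = 0" using sc[of 0 0] by simp
  have m: "l (- x) = - l x" for x using add[of x "- x"] l0 by (simp add: eq_neg_iff_add_eq_0 add.commute)
  show "l (x + y) = l x + l y" "l (- x) = - l x" "l (sc [:z:] x) = z * l x" by fact+
  show "l (x - y) = l x - l y" using add[of x "- y"] m by simp
qed

lemma linear_form_sum: "linear_form l \<Longrightarrow> l (\<Sum>i\<in>I. x i) = (\<Sum>i\<in>I. l (x i))"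
  by (induction I rule: infinite_finite_induct) (auto simp: linear_form_simps)

lemma linear_form_ev:
  assumes "linear_form l"
  shows "l (ev z q) = poly (map_poly l q) z"
  using linear_form_simps[OF assms] by (induction q) (simp_all add: map_poly_pCons)

lemma linear_form_comp:
  assumes "linear_form l" "\<And>z x. app f (sc [:z:] x) = sc [:z:] (app f x)"
  shows "linear_form (\<lambda>x. l (app f x))"
  using assms by (simp add: linear_form_def)

text \<open>Linear forms replace coordinates: through \<open>map_poly l\<close> an identity between
  vector valued polynomials becomes one between complex polynomials, where roots can be
  counted.\<close>

lemma separating_linear_form:
  assumes S: "C.subspace S" and v: "v \<notin> S"
  obtains l where "linear_form l" "\<And>x. x \<in> S \<Longrightarrow> l x = 0" "l v = 1"
proof -
  interpret V: vector_space_pair "\<lambda>z. sc [:z:]" "(*) :: complex \<Rightarrow> complex \<Rightarrow> complex"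
    by unfold_locales (auto simp: algebra_simps)
  obtain B where B: "B \<subseteq> S" "C.independent B" "S \<subseteq> C.span B"
    using C.maximal_independent_subset by blast
  have SB: "C.span B = S" using B S C.span_minimal by blast
  have ind: "C.independent (insert v B)"
    using B(2) v SB by (simp add: C.independent_insert)
  obtain l where l: "Vector_Spaces.linear (\<lambda>z. sc [:z:]) (*) l" "\<And>x. x \<in> insert v B \<Longrightarrow> l x = (if x = v then 1 else 0)"
    using V.linear_independent_extend[OF ind, of "\<lambda>x. if x = v then 1 else 0"] by blast
  have "v \<notin> B" using v B by auto
  then have lB: "x \<in> B \<Longrightarrow> l x = 0" for x using l(2)[of x] by auto
  show thesis
  proof
    show "linear_form l" using l(1) by (auto simp: linear_form_def Vector_Spaces.linear_iff)
    show "l v = 1" using l(2) by simp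
    fix x assume "x \<in> S"
    then have "x \<in> C.span B" using SB by simp
    then show "l x = 0" using l(1) lB by (metis V.linear_eq_0_on_span)
  qed
qed

lemma eq_by_linear_form:
  assumes "\<And>l. linear_form l \<Longrightarrow> l x = l y"
  shows "x = y"
proof (rule ccontr)
  assume "x \<noteq> y"
  then have "x - y \<notin> {0}" by simp
  from separating_linear_form[OF C.subspace_single_0 this] obtain l
    where "linear_form l" "l (x - y) = 1" by metis
  then show False using assms[of l] by (simp add: linear_form_simps)
qed

text \<open>A linear form that vanishes on \<open>S\<close> but not on the coefficient would give a
  nonzero complex polynomial with all of \<open>Z\<close> as roots. An arbitrary infinite
  \<open>Z\<close> is allowed because division by a structure polynomial is possible only away from
  its zeros.\<close>

lemma coeff_mem_of_ev:
  assumes S: "C.subspace S" and inf: "infinite Z" and ev: "\<And>z. z \<in> Z \<Longrightarrow> ev z q \<in> S"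
  shows "coeff q n \<in> S"
proof (rule ccontr)
  assume "coeff q n \<notin> S"
  from separating_linear_form[OF S this] obtain l
    where l: "linear_form l" "\<And>x. x \<in> S \<Longrightarrow> l x = 0" "l (coeff q n) = 1" by metis
  have "Z \<subseteq> {z. poly (map_poly l q) z = 0}"
    using l(2)[OF ev] linear_form_ev[OF l(1)] by auto
  then have "map_poly l q = 0"
    using inf poly_roots_finite infinite_super by blast
  then show False
    using l(3) linear_form_simps(1)[OF l(1)] by (metis coeff_0 coeff_map_poly zero_neq_one)
qed

lemma ev_eqD:
  assumes "\<And>z. ev z p = ev z q"
  shows "p = q"
proof -
  have "coeff (p - q) n \<in> {0}" for n
    by (rule coeff_mem_of_ev[OF C.subspace_single_0, of UNIV])
       (use assms infinite_UNIV_char_0 in auto)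
  then show ?thesis by (auto simp: poly_eq_iff)
qed

lemma subspace_imp_C: "subspace S \<Longrightarrow> C.subspace S"
  by (auto simp: subspace_def C.subspace_def)

definition ev2 :: "complex \<Rightarrow> complex \<Rightarrow> 'v poly poly \<Rightarrow> 'v" where
  "ev2 x y Q = ev y (map_poly (ev x) Q)"

lemma ev2_simps [simp]:
  "ev2 x y 0 = 0" "ev2 x y (pCons p Q) = ev x p + sc [:y:] (ev2 x y Q)"
  by (simp_all add: ev2_def map_poly_pCons)

lemma ev2_add [simp]: "ev2 x y (P + Q) = ev2 x y P + ev2 x y Q"
proof -
  have "map_poly (ev x) (P + Q) = map_poly (ev x) P + map_poly (ev x) Q"
    by (simp add: poly_eq_iff coeff_map_poly)
  then show ?thesis by (simp add: ev2_def)
qed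

lemma ev2_sum: "ev2 x y (\<Sum>i\<in>I. q i) = (\<Sum>i\<in>I. ev2 x y (q i))"
  by (induction I rule: infinite_finite_induct) auto

lemma ev2_mult [simp]:
  "ev2 x y (mult_lam Q) = sc [:x:] (ev2 x y Q)"
  "ev2 x y (mult_mu Q) = sc [:y:] (ev2 x y Q)"
  "ev2 x y (mult_lam_plus_mu Q) = sc [:x + y:] (ev2 x y Q)"
proof -
  show a: "ev2 x y (mult_lam Q) = sc [:x:] (ev2 x y Q)"
    by (induction Q)
       (simp_all add: mult_lam_def map_poly_pCons scale_right_distrib mult.commute)
  show b: "ev2 x y (mult_mu Q) = sc [:y:] (ev2 x y Q)"
    by (simp add: mult_mu_def)
  show "ev2 x y (mult_lam_plus_mu Q) = sc [:x + y:] (ev2 x y Q)"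
    by (simp add: mult_lam_plus_mu_def a b flip: scale_left_distrib)
qed

lemma ev2_subst_op:
  assumes T: "\<And>Q. ev2 x y (T Q) = sc [:t:] (ev2 x y Q)"
  shows "ev2 x y (subst_op e T q) = (\<Sum>n\<le>degree q. sc [:t ^ n:] (ev2 x y (e (coeff q n))))"
proof -
  have "ev2 x y ((T ^^ n) Q) = sc [:t ^ n:] (ev2 x y Q)" for n Q
    by (induction n) (simp_all add: T flip: one_pCons)
  then show ?thesis by (simp add: subst_op_def ev2_sum)
qed

lemma ev2_at_op:
  assumes T: "\<And>Q. ev2 x y (T Q) = sc [:t:] (ev2 x y Q)"
  shows "ev2 x y (at_op T q) = ev t q"
  by (simp add: at_op_def ev2_subst_op[OF T] ev_def)

lemma ev_bipoly_act: "ev z (bipoly_act sc P v) = sc (poly P [:z:]) v"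
  unfolding bipoly_act_def
  by (induction P) (simp_all add: map_poly_pCons scale_left_distrib)

end

section \<open>The module axioms at numerical values of the variables\<close>

sublocale conformal_module \<subseteq> CA: cmodule scaleA
  by unfold_locales

sublocale conformal_module \<subseteq> CM: cmodule scaleM
  by unfold_locales

text \<open>Makes the Jacobi identity an instance of \<open>actv_actv\<close>, so that the structure
  polynomials need no separate calculus.\<close>

lemma (in lie_conformal_algebra) adjoint_module: "conformal_module scale bracket scale bracket"
  by unfold_locales
     (fact bracket_add_left bracket_add_right bracket_scale_left bracket_scale_right
       bracket_del_left bracket_del_right jacobi)+

context conformal_module
begin

abbreviation actv :: "'a \<Rightarrow> complex \<Rightarrow> 'm \<Rightarrow> 'm" where
  "actv a z m \<equiv> CM.ev z (act a m)"

lemma act_zero [simp]: "act 0 m = 0" "act a 0 = 0"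
  using act_add_left[of 0 0 m] act_add_right[of a 0 0] by simp_all

lemma act_sum_left: "act (\<Sum>i\<in>I. f i) m = (\<Sum>i\<in>I. act (f i) m)"
  by (induction I rule: infinite_finite_induct) (simp_all add: act_add_left)

lemma act_sum_right: "act a (\<Sum>i\<in>I. f i) = (\<Sum>i\<in>I. act a (f i))"
  by (induction I rule: infinite_finite_induct) (simp_all add: act_add_right)

lemma ev_map_scaleM: "CM.ev z (map_poly (scaleM p) q) = scaleM p (CM.ev z q)"
  by (rule CM.ev_map_poly) (simp_all add: M.scale_right_distrib mult.commute)

lemma actv_const:
  "actv (scaleA [:k:] a) z m = scaleM [:k:] (actv a z m)"
  "actv a z (scaleM [:k:] m) = scaleM [:k:] (actv a z m)"
  by (simp_all add: act_scale_left act_scale_right ev_map_scaleM)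

lemma actv_scale_right:
  "actv a z (scaleM p m) = scaleM (pcompose p [:z, 1:]) (actv a z m)"
proof (induction p arbitrary: m)
  case (pCons k p)
  have "scaleM (pCons k p) m = scaleM [:k:] m + scaleM [:0, 1:] (scaleM p m)"
    by (simp flip: M.scale_left_distrib)
  then have "actv a z (scaleM (pCons k p) m)
      = scaleM [:k:] (actv a z m) + (scaleM [:0, 1:] (actv a z (scaleM p m))
         + scaleM [:z:] (actv a z (scaleM p m)))"
    by (simp add: act_add_right act_del_right actv_const ev_map_scaleM del: M.scale_scale)
  also have "\<dots> = scaleM (pcompose (pCons k p) [:z, 1:]) (actv a z m)"
    by (simp add: pCons.IH pcompose_pCons add.commute flip: M.scale_left_distrib distrib_right)
  finally show ?case .
qed simp

lemma actv_scale_left: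
  "actv (scaleA p a) z m = scaleM [:poly p (- z):] (actv a z m)"
proof (induction p arbitrary: a)
  case (pCons k p)
  have "scaleA (pCons k p) a = scaleA [:k:] a + scaleA [:0, 1:] (scaleA p a)"
    by (simp flip: A.scale_left_distrib)
  then have "actv (scaleA (pCons k p) a) z m
      = scaleM [:k:] (actv a z m) - scaleM [:z:] (actv (scaleA p a) z m)"
    by (simp add: act_add_left act_del_left actv_const del: A.scale_scale)
  also have "\<dots> = scaleM [:poly (pCons k p) (- z):] (actv a z m)"
    by (simp add: pCons.IH flip: M.scale_left_diff_distrib)
  finally show ?case .
qed simp

lemma actv_ev_left:
  "actv (CA.ev x q) z m = (\<Sum>n\<le>degree q. scaleM [:x ^ n:] (actv (coeff q n) z m))"
  by (simp add: CA.ev_def act_sum_left CM.ev_sum actv_const)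

lemma actv_ev_right:
  "actv a z (CM.ev x q) = (\<Sum>n\<le>degree q. scaleM [:x ^ n:] (actv a z (coeff q n)))"
  by (simp add: CM.ev_def[of x] act_sum_right CM.ev_sum actv_const)

text \<open>This is \<open>act_act\<close> evaluated at \<lambda> = \<open>x\<close>, \<mu> =
  \<open>y\<close>: the three substituted operators become multiplication by \<open>x\<close>,
  \<open>y\<close> and \<open>x + y\<close>.\<close>

lemma actv_actv:
  "actv a x (actv b y m) = actv (CA.ev x (bracket a b)) (x + y) m + actv b y (actv a x m)"
proof -
  note op = CM.ev2_subst_op[OF CM.ev2_mult(1)] CM.ev2_subst_op[OF CM.ev2_mult(2)]
    CM.ev2_at_op[OF CM.ev2_mult(1)] CM.ev2_at_op[OF CM.ev2_mult(2)]
    CM.ev2_at_op[OF CM.ev2_mult(3)]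
  show ?thesis
    using arg_cong[OF act_act[of a b m], of "CM.ev2 x y"]
    by (simp add: op actv_ev_left actv_ev_right)
qed

text \<open>Testing on generators suffices because \<partial> on the algebra side acts by the scalar
  \<open>- z\<close>; numerical values suffice by \<open>coeff_mem_of_ev\<close>.\<close>

lemma submoduleI:
  assumes "M.subspace N" "\<And>a. a \<in> G \<Longrightarrow> (\<And>m z. m \<in> N \<Longrightarrow> actv a z m \<in> N)"
    and "A.span G = UNIV"
  shows "submodule N"
  unfolding submodule_def
proof (intro conjI allI ballI)
  fix a m n assume m: "m \<in> N"
  have "a \<in> A.span G" using assms(3) by simp
  then have "actv a z m \<in> N" for z
  proof (induction rule: A.span_induct_alt)
    case base
    show ?case using assms(1) by (simp add: M.subspace_0)
  next
    case (step c x y)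
    then show ?case using assms(1) assms(2)[OF _ m]
      by (simp add: act_add_left actv_scale_left M.subspace_add M.subspace_scale)
  qed
  then show "coeff (act a m) n \<in> N"
    by (intro CM.coeff_mem_of_ev[OF CM.subspace_imp_C[OF assms(1)], of UNIV])
       (auto simp: infinite_UNIV_char_0)
qed (fact assms)

end

section \<open>Linear algebra over a domain\<close>

text \<open>Gaussian elimination without division: \<open>w i\<close> cross-multiplies
  \<open>u i\<close> with the pivot \<open>u j\<close> so that \<open>b\<close> cancels, and a
  domain keeps the resulting coefficients nonzero. A family is used since the vectors, powers of an
  operator on one vector, may coincide.\<close>

lemma module_dependent_family:
  fixes s :: "'a::idom \<Rightarrow> 'b::ab_group_add \<Rightarrow> 'b"
  assumes "module s" "finite B" "finite I" "card B < card I"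
    and "\<And>i. i \<in> I \<Longrightarrow> u i \<in> module.span s B"
  shows "\<exists>p. (\<exists>i\<in>I. p i \<noteq> 0) \<and> (\<Sum>i\<in>I. s (p i) (u i)) = 0"
proof -
  interpret module s by fact
  show ?thesis
    using assms(2-5)
  proof (induction B arbitrary: I u rule: finite_induct)
    case empty
    then show ?case by (intro exI[of _ "\<lambda>_. 1"]) (auto simp: card_gt_0_iff)
  next
    case (insert b B)
    have "\<exists>c. u i - s c b \<in> span B" if "i \<in> I" for i
      using insert.prems(3)[OF that] by (simp add: span_breakdown_eq)
    then obtain c where c: "\<And>i. i \<in> I \<Longrightarrow> u i - s (c i) b \<in> span B" by metis
    show ?case
    proof (cases "\<exists>j\<in>I. c j \<noteq> 0")
      case False
      then show ?thesis
        using insert.IH[of I u] insert.prems insert.hyps c by fastforce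
    next
      case True
      then obtain j where j: "j \<in> I" "c j \<noteq> 0" by blast
      define w where "w i = s (c j) (u i) - s (c i) (u j)" for i
      have w: "w i \<in> span B" if "i \<in> I - {j}" for i
      proof -
        have "w i = s (c j) (u i - s (c i) b) - s (c i) (u j - s (c j) b)"
          by (simp add: w_def scale_right_diff_distrib mult.commute)
        then show ?thesis using c that j by (simp add: span_diff span_scale)
      qed
      have "card B < card (I - {j})" using insert j by simp
      then obtain q where q: "\<exists>i\<in>I - {j}. q i \<noteq> 0" "(\<Sum>i\<in>I - {j}. s (q i) (w i)) = 0"
        using insert.IH[of "I - {j}" w] w insert.prems(1) by auto
      define p where "p i = (if i = j then - (\<Sum>i\<in>I - {j}. q i * c i) else q i * c j)" for i
      have "(\<Sum>i\<in>I. s (p i) (u i)) = s (p j) (u j) + (\<Sum>i\<in>I - {j}. s (p i) (u i))"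
        using insert.prems(1) j(1) by (simp add: sum.remove)
      also have "(\<Sum>i\<in>I - {j}. s (p i) (u i)) = (\<Sum>i\<in>I - {j}. s (q i) (s (c j) (u i)))"
        by (intro sum.cong) (auto simp: p_def)
      also have "s (p j) (u j) = - (\<Sum>i\<in>I - {j}. s (q i) (s (c i) (u j)))"
        by (simp add: p_def scale_sum_left)
      finally have "(\<Sum>i\<in>I. s (p i) (u i)) = (\<Sum>i\<in>I - {j}. s (q i) (w i))"
        by (simp add: w_def scale_right_diff_distrib sum_subtractf)
      then show ?thesis
        using q j by (intro exI[of _ p]) (auto simp: p_def)
    qed
  qed
qed

section \<open>Polynomials in an operator, and leading coefficients in the spectral variable\<close>

context cmodule
begin

definition PE :: "complex poly \<Rightarrow> 'v endo \<Rightarrow> 'v endo" where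
  "PE Q S = fold_coeffs (\<lambda>a f. K a + S * f) Q 0"

lemma PE_0 [simp]: "PE 0 S = 0"
  by (simp add: PE_def)

lemma PE_pCons [simp]: "PE (pCons a Q) S = K a + S * PE Q S"
  by (cases "a = 0 \<and> Q = 0") (auto simp: PE_def)

lemma PE_add [simp]: "PE (P + Q) S = PE P S + PE Q S"
proof (induction P arbitrary: Q)
  case (pCons a P)
  obtain b R where Q: "Q = pCons b R" by (cases Q)
  show ?case unfolding Q add_pCons PE_pCons pCons.IH[of R] by (simp add: K_add distrib_left)
qed simp

text \<open>Complex linearity, which the type \<open>endo\<close> does not contain; commutation with
  \<partial> is not demanded, as \<open>E\<close> and \<open>Lm i z\<close> do not commute with it
  in general.\<close>

definition Klin :: "'v endo \<Rightarrow> bool" where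
  "Klin S \<longleftrightarrow> (\<forall>z. S * K z = K z * S)"

lemma KlinD: "Klin S \<Longrightarrow> S * K z = K z * S"
  by (simp add: Klin_def)

lemma Klin_app: "Klin S \<Longrightarrow> app S (sc [:z:] v) = sc [:z:] (app S v)"
  by (metis KlinD app_Sc app_ring(6))

lemma KlinI: "(\<And>z v. app S (sc [:z:] v) = sc [:z:] (app S v)) \<Longrightarrow> Klin S"
  by (auto simp: Klin_def intro!: endo_eqI)

lemma Klin_intros [intro, simp]:
  "Klin 0" "Klin 1" "Klin (Sc p)" "Klin S \<Longrightarrow> Klin T \<Longrightarrow> Klin (S + T)"
  "Klin S \<Longrightarrow> Klin T \<Longrightarrow> Klin (S - T)" "Klin S \<Longrightarrow> Klin T \<Longrightarrow> Klin (S * T)" "Klin S \<Longrightarrow> Klin (S ^ n)"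
  "Klin S \<Longrightarrow> Klin (PE Q S)" "Klin S \<Longrightarrow> Klin (- S)"
proof -
  show sc: "Klin (Sc p)" for p by (rule KlinI) (simp add: mult.commute)
  show zero: "Klin 0" by (simp add: Klin_def)
  show one: "Klin 1" by (simp add: Klin_def)
  show "Klin (S - T)" if "Klin S" "Klin T" for S T
    using that by (simp add: Klin_def distrib_left distrib_right left_diff_distrib right_diff_distrib)
  show "Klin (- S)" if "Klin S" for S
    using that by (simp add: Klin_def distrib_left distrib_right left_diff_distrib right_diff_distrib)
  show add: "Klin (S + T)" if "Klin S" "Klin T" for S T
    using that by (simp add: Klin_def distrib_left distrib_right left_diff_distrib right_diff_distrib)
  show mult: "Klin (S * T)" if "Klin S" "Klin T" for S T
    using that by (auto intro!: KlinI simp: Klin_app)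
  show "Klin (S ^ n)" if "Klin S"
    by (induction n) (auto intro: one mult that)
  show "Klin (PE Q S)" if "Klin S"
    by (induction Q) (auto intro: zero mult add sc that)
qed

lemma Klin_left_commute: "Klin S \<Longrightarrow> S * (K a * T) = K a * (S * T)"
  by (simp only: KlinD mult.assoc[symmetric])

lemma PE_smult: "Klin S \<Longrightarrow> PE (smult a Q) S = K a * PE Q S"
  by (induction Q) (simp_all add: K_mult distrib_left mult.assoc Klin_left_commute del: Sc_ring(6))

lemma PE_mult: "Klin S \<Longrightarrow> PE (P * Q) S = PE P S * PE Q S"
  by (induction P) (simp_all add: PE_smult distrib_right mult.assoc)

lemma PE_commute:
  assumes "S * T = T * S" "Klin T"
  shows "PE Q S * T = T * PE Q S"
proof (induction Q)
  case (pCons a Q)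
  have "S * PE Q S * T = T * (S * PE Q S)"
    by (simp only: mult.assoc pCons.IH) (simp only: assms(1) mult.assoc[symmetric])
  then show ?case by (simp add: distrib_left distrib_right KlinD[OF assms(2)])
qed simp

lemma PE_monom: "Klin S \<Longrightarrow> PE (monom a n) S = K a * S ^ n"
  by (induction n) (simp_all add: monom_Suc monom_0 Klin_left_commute)

lemma PE_sum: "PE (\<Sum>i\<in>I. Q i) S = (\<Sum>i\<in>I. PE (Q i) S)"
  by (induction I rule: infinite_finite_induct) auto

text \<open>Splitting off linear factors of \<open>Q\<close> one at a time, the last nonzero vector
  is an eigenvector. It has the form \<open>PE R S v\<close>, so it stays in every complex subspace
  that contains \<open>v\<close> and is stable under \<open>S\<close>.\<close>

lemma PE_eigenvector:
  assumes "Klin S" "Q \<noteq> 0" "v \<noteq> 0" "app (PE Q S) v = 0"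
  shows "\<exists>z R. poly Q z = 0 \<and> app (PE R S) v \<noteq> 0 \<and> app S (app (PE R S) v) = sc [:z:] (app (PE R S) v)"
  using assms(2-4)
proof (induction "degree Q" arbitrary: Q v rule: less_induct)
  case less
  have "degree Q \<noteq> 0"
  proof
    assume "degree Q = 0"
    then obtain a where "Q = [:a:]" by (metis degree_eq_zeroE)
    with less.prems show False by simp
  qed
  then obtain z where z: "poly Q z = 0"
    using fundamental_theorem_of_algebra[of Q] by (auto simp: constant_degree)
  then obtain R where R: "Q = [:- z, 1:] * R" by (auto simp: poly_eq_0_iff_dvd elim: dvdE)
  with less.prems have "R \<noteq> 0" by auto
  have deg: "degree R < degree Q" unfolding R using \<open>R \<noteq> 0\<close> by (subst degree_mult_eq) auto
  have "app (PE [:- z, 1:] S) (app (PE R S) v) = 0"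
    using less.prems(3) unfolding R PE_mult[OF assms(1)] by simp
  then have *: "app S (app (PE R S) v) = sc [:z:] (app (PE R S) v)"
    by (simp add: K_minus)
  show ?case
  proof (cases "app (PE R S) v = 0")
    case True
    then obtain y R' where y: "poly R y = 0"
        and R': "app (PE R' S) v \<noteq> 0" "app S (app (PE R' S) v) = sc [:y:] (app (PE R' S) v)"
      using less.hyps[OF deg \<open>R \<noteq> 0\<close> less.prems(2)] by blast
    then show ?thesis unfolding R by (intro exI[of _ y] exI[of _ R']) simp
  qed (use * z in blast)
qed

lemma eigenvectors_independent:
  assumes "Klin S" "finite I" "inj_on z I"
    and "\<And>i. i \<in> I \<Longrightarrow> app S (u i) = sc [:z i:] (u i)" "(\<Sum>i\<in>I. u i) = 0"
  shows "\<forall>i\<in>I. u i = 0"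
  using assms(2-5)
proof (induction I arbitrary: u rule: finite_induct)
  case (insert j I)
  have "(\<Sum>i\<in>I. sc [:z i - z j:] (u i)) = (\<Sum>i\<in>insert j I. sc [:z i - z j:] (u i))"
    using insert.hyps by simp
  also have "\<dots> = (\<Sum>i\<in>insert j I. app S (u i) - sc [:z j:] (u i))"
    by (intro sum.cong refl) (use insert.prems in \<open>simp flip: scale_left_diff_distrib\<close>)
  also have "\<dots> = app S (\<Sum>i\<in>insert j I. u i) - sc [:z j:] (\<Sum>i\<in>insert j I. u i)"
    by (simp only: sum_subtractf app_sum_right scale_sum_right)
  also have "\<dots> = 0" by (simp only: insert.prems) simp
  finally have *: "\<forall>i\<in>I. sc [:z i - z j:] (u i) = 0"
    using insert.prems assms(1)
    by (intro insert.IH) (auto simp: Klin_app sc_const_const mult.commute)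
  have "u i = 0" if "i \<in> I" for i
  proof -
    have "z i \<noteq> z j" using insert that by (auto simp: inj_on_def)
    moreover have "sc [:z i - z j:] (u i) = 0" using * that by blast
    ultimately show ?thesis by (simp only: sc_const_eq_0_iff) auto
  qed
  then show ?case using insert by simp
qed simp

text \<open>In p(\<partial> + z) the powers of z from \<open>degree p\<close> on carry no
  \<partial>. Their coefficients therefore turn a relation over the polynomial ring into one over
  the complex numbers.\<close>

lemma pcompose_form_poly:
  assumes l: "linear_form l"
  shows "\<exists>r. (\<forall>z. l (sc (pcompose p [:z, 1:]) v) = poly r z) \<and>
    (\<forall>d\<ge>degree p. coeff r d = coeff p d * l v)"
proof (induction p arbitrary: v)
  case 0
  show ?case by (intro exI[of _ 0]) (simp add: linear_form_simps[OF l])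
next
  case (pCons a p)
  obtain r1 r2 where
    r1: "\<And>z. l (sc (pcompose p [:z, 1:]) v) = poly r1 z" "\<And>d. d \<ge> degree p \<Longrightarrow> coeff r1 d = coeff p d * l v"
    and r2: "\<And>z. l (sc (pcompose p [:z, 1:]) (sc [:0, 1:] v)) = poly r2 z"
      "\<And>d. d \<ge> degree p \<Longrightarrow> coeff r2 d = coeff p d * l (sc [:0, 1:] v)"
    using pCons.IH[of v] pCons.IH[of "sc [:0, 1:] v"] by metis
  have "pcompose (pCons a p) [:z, 1:] = [:a:] + [:z:] * pcompose p [:z, 1:] + pcompose p [:z, 1:] * [:0, 1:]" for z
    by (simp add: pcompose_pCons)
  then have split: "sc (pcompose (pCons a p) [:z, 1:]) v = sc [:a:] v + sc [:z:] (sc (pcompose p [:z, 1:]) v)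
      + sc (pcompose p [:z, 1:]) (sc [:0, 1:] v)" for z
    by (simp only: scale_left_distrib scale_scale)
  let ?r = "[:a * l v:] + pCons 0 r1 + r2"
  have "coeff ?r d = coeff (pCons a p) d * l v" if d: "d \<ge> degree (pCons a p)" for d
  proof (cases d)
    case 0
    then have "p = 0" using d by (metis degree_pCons_eq le_zero_eq nat.distinct(1))
    then show ?thesis using r2(2)[of 0] 0 by simp
  next
    case (Suc d')
    then have "degree p \<le> d'" using d by (cases "p = 0") auto
    then show ?thesis using r1(2)[of d'] r2(2)[of d] Suc by (simp add: coeff_eq_0)
  qed
  moreover have "l (sc (pcompose (pCons a p) [:z, 1:]) v) = poly ?r z" for z
    by (simp only: split linear_form_simps[OF l] r1(1) r2(1)) simp
  ultimately show ?case by blast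
qed

lemma pcompose_form_poly_ev:
  assumes l: "linear_form l" and d: "d \<ge> degree p" and N: "N \<ge> degree q"
  shows "\<exists>r. (\<forall>z. l (sc (pcompose p [:z, 1:]) (ev z q)) = poly r z) \<and>
    coeff r (d + N) = coeff p d * l (coeff q N)"
proof -
  have "\<forall>n. \<exists>r. (\<forall>z. l (sc (pcompose p [:z, 1:]) (coeff q n)) = poly r z) \<and>
      (\<forall>d\<ge>degree p. coeff r d = coeff p d * l (coeff q n))"
    using pcompose_form_poly[OF l] by blast
  from choice[OF this] obtain r where
    r: "\<And>n z. l (sc (pcompose p [:z, 1:]) (coeff q n)) = poly (r n) z"
      "\<And>n d. d \<ge> degree p \<Longrightarrow> coeff (r n) d = coeff p d * l (coeff q n)"
    by blast
  have c: "sc (pcompose p [:z, 1:]) (sc [:x:] w) = sc [:x:] (sc (pcompose p [:z, 1:]) w)" for z x w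
    by (simp add: mult.commute)
  have "l (sc (pcompose p [:z, 1:]) (ev z q)) = poly (\<Sum>n\<le>N. monom 1 n * r n) z" for z
    by (simp only: ev_bound[OF N] scale_sum_right linear_form_sum[OF l] c linear_form_simps[OF l]
        poly_sum poly_mult poly_monom r(1)) simp
  moreover have "coeff (\<Sum>n\<le>N. monom 1 n * r n) (d + N) = (\<Sum>n\<le>N. coeff (r n) (d + N - n))"
    by (simp add: coeff_sum coeff_monom_mult)
  moreover have "\<dots> = (\<Sum>n\<in>{N}. coeff (r n) (d + N - n))"
  proof (rule sum.mono_neutral_right)
    have "coeff (r n) (d + N - n) = 0" if "n < N" for n
      using that d by (subst r(2)) (auto simp: coeff_eq_0)
    then show "\<forall>n\<in>{..N} - {N}. coeff (r n) (d + N - n) = 0" by auto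
  qed auto
  ultimately show ?thesis using r(2)[OF d, of N] by (intro exI[of _ "\<Sum>n\<le>N. monom 1 n * r n"]) auto
qed

end

section \<open>Representations of the graded algebra by operators\<close>

text \<open>
  The action is written numerically: \<open>ev x (A i v)\<close> is \<open>L\<^sub>i\<close> acting with \<open>\<lambda>\<close> specialised to \<open>x\<close>,
  and \<open>\<alpha> i\<close>, \<open>\<beta> i\<close> stand for \<open>a\<^sub>i - 1\<close>, \<open>b\<^sub>i\<close>. The structure polynomials enter through
  \<open>P i j \<lambda> \<mu> = p\<^sub>i\<^sub>j(-\<lambda>-\<mu>, \<lambda>)\<close>, because \<open>\<partial>\<close> acts as \<open>-\<lambda>-\<mu>\<close> in \<open>[L\<^sub>i \<^sub>\<lambda> L\<^sub>j]\<^bsub>\<lambda>+\<mu>\<^esub>\<close>.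
\<close>

locale graded_rep = cmodule sc
  for sc :: "complex poly \<Rightarrow> 'v::ab_group_add \<Rightarrow> 'v" +
  fixes A :: "nat \<Rightarrow> 'v \<Rightarrow> 'v poly"
    and P :: "nat \<Rightarrow> nat \<Rightarrow> complex \<Rightarrow> complex \<Rightarrow> complex"
    and \<alpha> \<beta> :: "nat \<Rightarrow> complex"
  assumes A_add: "A i (v + w) = A i v + A i w"
    and A_scale: "ev z (A i (sc p v)) = sc (pcompose p [:z, 1:]) (ev z (A i v))"
    and A_comm: "ev x (A i (ev y (A j v))) - ev y (A j (ev x (A i v)))
        = sc [:P i j x y:] (ev (x + y) (A (i + j) v))"
    and P_0: "P 0 j x y = \<alpha> j * x - y + \<beta> j"
    and \<alpha>_0: "\<alpha> 0 = 1" and \<beta>_0: "\<beta> 0 = 0" and \<beta>_Suc: "\<beta> (Suc j) = \<beta> j + \<beta> 1"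
    and P_1: "infinite {r. \<exists>x. P 1 j x (r - x) \<noteq> 0}"
    and P_1_shape: "\<alpha> 1 \<noteq> 0 \<Longrightarrow> \<beta> 1 = 0 \<Longrightarrow>
      \<exists>e d. e \<noteq> 0 \<and> \<alpha> (Suc j) = \<alpha> 1 + \<alpha> j - of_nat d \<and> (\<forall>y. P 1 j 0 y = e * (- y) ^ d) \<and>
        (\<alpha> 1 = 1 \<and> \<alpha> j = 1 \<and> d = 1 \<longrightarrow> (\<forall>x y. P 1 j x y = e * (x - y)))"
    and irred: "subspace N \<Longrightarrow> (\<And>i x v. v \<in> N \<Longrightarrow> ev x (A i v) \<in> N) \<Longrightarrow> N = {0} \<or> N = UNIV"
    and nontriv: "\<exists>i v. A i v \<noteq> 0"
    and fin_gen: "\<exists>S. finite S \<and> span S = UNIV"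
begin

lemma A_zero [simp]: "A i 0 = 0"
  using A_add[of i 0 0] by simp

lemma A_const: "A i (sc [:z:] v) = map_poly (sc [:z:]) (A i v)"
  by (rule ev_eqD) (subst ev_map_poly, auto simp: A_scale scale_right_distrib mult.commute)

definition X :: "nat \<Rightarrow> nat \<Rightarrow> 'v endo" where
  "X i n = Endo (\<lambda>v. coeff (A i v) n)"

definition Lm :: "nat \<Rightarrow> complex \<Rightarrow> 'v endo" where
  "Lm i z = Endo (\<lambda>v. ev z (A i v))"

lemma app_X [simp]: "app (X i n) v = coeff (A i v) n"
  by (simp add: X_def Endo_inverse A_add)

lemma app_Lm [simp]: "app (Lm i z) v = ev z (A i v)"
  by (simp add: Lm_def Endo_inverse A_add)

lemma Klin_X [simp, intro]: "Klin (X i n)"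
  by (rule KlinI) (simp add: A_const coeff_map_poly)

lemma Klin_Lm [simp, intro]: "Klin (Lm i z)"
  by (rule KlinI) (simp add: A_scale)

lemma Lm_Sc: "Lm i z * Sc p = Sc (pcompose p [:z, 1:]) * Lm i z"
  by (rule endo_eqI) (simp add: A_scale)

lemma ad_Lm: "ad (Lm i x) (Lm j y) = K (P i j x y) * Lm (i + j) (x + y)"
  by (rule endo_eqI) (simp add: ad_def A_comm)

lemma Lm_0: "Lm i 0 = X i 0"
  by (rule endo_eqI) (simp add: ev_zero)

lemma Lm_eq_0_iff: "Lm i z = 0 \<longleftrightarrow> (\<forall>v. ev z (A i v) = 0)"
  by (metis app_Lm app_ring(1) endo_eqI)

lemma A_eq_0I: "infinite Z \<Longrightarrow> (\<And>z. z \<in> Z \<Longrightarrow> ev z (A i v) = 0) \<Longrightarrow> A i v = 0"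
  using coeff_mem_of_ev[OF C.subspace_single_0, of Z "A i v"] by (auto simp: poly_eq_iff)

lemma stable_UNIV:
  assumes "subspace N" "\<And>i x v. v \<in> N \<Longrightarrow> ev x (A i v) \<in> N" "v \<in> N" "v \<noteq> 0"
  shows "N = UNIV"
  using irred[OF assms(1,2)] assms(3,4) by auto

text \<open>Applying \<open>Lm i z\<close> to \<open>sc p v = 0\<close> gives p(\<partial> + z)
  \<open>ev z (A i v)\<close> = 0, whose top coefficient in z is \<open>lead_coeff p\<close> times
  the top coefficient of \<open>A i v\<close>.\<close>

lemma torsion_imp_trivial:
  assumes "sc p v = 0" "p \<noteq> 0"
  shows "A i v = 0"
proof (rule ccontr)
  define q where "q = A i v"
  assume "A i v \<noteq> 0"
  then have "coeff q (degree q) \<notin> {0}" by (simp add: q_def)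
  from separating_linear_form[OF C.subspace_single_0 this] obtain l
    where l: "linear_form l" "l (coeff q (degree q)) = 1" by metis
  obtain r where r: "\<And>z. l (sc (pcompose p [:z, 1:]) (ev z q)) = poly r z"
      "coeff r (degree p + degree q) = lead_coeff p * l (coeff q (degree q))"
    using pcompose_form_poly_ev[OF l(1), of p "degree p" q "degree q"] by auto
  have "poly r z = 0" for z
    unfolding r(1)[symmetric] q_def A_scale[symmetric] assms by (simp add: linear_form_simps[OF l(1)])
  then have "r = 0" using poly_all_0_iff_0 by blast
  then show False using r(2) l assms(2) by simp
qed

text \<open>The torsion elements form a submodule on which everything acts as zero; if it were
  nonzero it would be the whole module.\<close>

lemma torsion_free: "sc p v = 0 \<longleftrightarrow> p = 0 \<or> v = 0"
proof (rule ccontr)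
  assume *: "\<not> ?thesis"
  then have pv: "p \<noteq> 0" "v \<noteq> 0" "sc p v = 0" by auto
  define N where "N = {v. \<exists>p. p \<noteq> 0 \<and> sc p v = 0}"
  have "subspace N"
  proof (rule subspaceI)
    show "0 \<in> N" by (auto simp: N_def intro!: exI[of _ 1])
    fix x y c assume "x \<in> N"
    then obtain p where p: "p \<noteq> 0" "sc p x = 0" by (auto simp: N_def)
    have "sc p (sc c x) = sc c (sc p x)" by (simp add: mult.commute)
    then show "sc c x \<in> N" using p by (auto simp: N_def)
    assume "y \<in> N"
    then obtain q where q: "q \<noteq> 0" "sc q y = 0" by (auto simp: N_def)
    have "sc (p * q) (x + y) = sc q (sc p x) + sc p (sc q y)"
      by (simp add: scale_right_distrib mult.commute)
    then show "x + y \<in> N" using p q unfolding N_def by (intro CollectI exI[of _ "p * q"]) auto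
  qed
  moreover have "v \<in> N" using pv by (auto simp: N_def)
  moreover have triv: "A i w = 0" if "w \<in> N" for i w
    using that torsion_imp_trivial by (auto simp: N_def)
  ultimately have "N = UNIV" using pv by (intro stable_UNIV) (auto simp: subspace_0)
  then show False using nontriv triv by auto
qed

text \<open>\<open>ad (Lm 0 0) (Lm j r) = K (\<beta> j - r) * Lm j r\<close>, so
  \<open>Lm 0 = 0\<close> would force \<open>Lm j r = 0\<close> for all
  \<open>r \<noteq> \<beta> j\<close>.\<close>

lemma L0_nonzero: "\<exists>v. A 0 v \<noteq> 0"
proof (rule ccontr)
  assume "\<not> ?thesis"
  then have L0: "A 0 v = 0" for v by simp
  have "A j v = 0" for j v
  proof (rule A_eq_0I)
    show "infinite (- {\<beta> j})" by (simp add: infinite_UNIV_char_0)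
    fix r assume "r \<in> - {\<beta> j}"
    then show "ev r (A j v) = 0" using A_comm[of 0 0 r j v] by (simp add: L0 P_0)
  qed
  then show False using nontriv by simp
qed

text \<open>Finite generation relates the vectors \<open>S ^ k\<close> \<open>u\<close> only over
  the polynomial ring in \<partial>, with which \<open>S\<close> need not commute. Applying
  \<open>Lm 0 z\<close> and taking the top coefficient in z removes \<partial>: a complex polynomial
  in \<open>S + K (\<kappa> N)\<close> kills the leading coefficient \<open>w\<close> of
  \<open>A 0 u\<close>.\<close>

lemma eigenvector_exists:
  assumes S: "Klin S" and comm: "\<And>n. X 0 n * S = (S + K (\<kappa> n)) * X 0 n"
  shows "\<exists>z v. v \<noteq> 0 \<and> app S v = sc [:z:] v"
proof -
  obtain u where u: "A 0 u \<noteq> 0" using L0_nonzero by blast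
  define N where "N = degree (A 0 u)"
  define w where "w = app (X 0 N) u"
  have w: "w \<noteq> 0" using u by (simp add: w_def N_def)
  obtain B where B: "finite B" "span B = UNIV" using fin_gen by blast
  obtain p where p: "\<exists>k\<in>{..card B}. p k \<noteq> 0" "(\<Sum>k\<le>card B. sc (p k) (app (S ^ k) u)) = 0"
    using module_dependent_family[OF module_axioms B(1), of "{..card B}" "\<lambda>k. app (S ^ k) u"] B(2)
    by auto
  have pow: "X 0 n * S ^ k = (S + K (\<kappa> n)) ^ k * X 0 n" for n k
    by (induction k) (simp_all add: comm mult.assoc[symmetric], simp add: comm mult.assoc power_commutes)
  have coeff_S: "coeff (A 0 (app (S ^ k) u)) n = app ((S + K (\<kappa> n)) ^ k) (coeff (A 0 u) n)" for n k
    using arg_cong[OF pow, of "\<lambda>f. app f u" n k] by simp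
  have deg: "degree (A 0 (app (S ^ k) u)) \<le> N" for k
    by (rule degree_le) (auto simp: coeff_S N_def coeff_eq_0)
  \<comment> \<open>With \<open>d\<close> the largest degree among the \<open>p k\<close>, the top
    power of z in the transformed relation is \<open>d + N\<close>; only those \<open>p k\<close> of
    degree \<open>d\<close> contribute.\<close>
  define d where "d = Max ((\<lambda>k. degree (p k)) ` {k. k \<le> card B \<and> p k \<noteq> 0})"
  have dge: "degree (p k) \<le> d" if "k \<le> card B" for k
    by (cases "p k = 0") (use that in \<open>auto simp: d_def intro!: Max_ge\<close>)
  have "d \<in> (\<lambda>k. degree (p k)) ` {k. k \<le> card B \<and> p k \<noteq> 0}"
    unfolding d_def using p(1) by (intro Max_in) auto
  then obtain k0 where k0: "k0 \<le> card B" "coeff (p k0) d \<noteq> 0" by auto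
  define Q where "Q = (\<Sum>k\<le>card B. monom (coeff (p k) d) k)"
  have "coeff Q k0 = coeff (p k0) d" using k0 by (simp add: Q_def coeff_sum)
  then have "Q \<noteq> 0" using k0 by auto
  have "app (PE Q (S + K (\<kappa> N))) w = 0"
  proof (rule eq_by_linear_form)
    fix l assume l: "linear_form l"
    have "\<forall>k. \<exists>r. k \<le> card B \<longrightarrow>
        (\<forall>z. l (sc (pcompose (p k) [:z, 1:]) (ev z (A 0 (app (S ^ k) u)))) = poly r z) \<and>
        coeff r (d + N) = coeff (p k) d * l (coeff (A 0 (app (S ^ k) u)) N)"
      using pcompose_form_poly_ev[OF l dge deg] by blast
    from choice[OF this] obtain r where
      r: "\<And>k z. k \<le> card B \<Longrightarrow> l (sc (pcompose (p k) [:z, 1:]) (ev z (A 0 (app (S ^ k) u)))) = poly (r k) z"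
        "\<And>k. k \<le> card B \<Longrightarrow> coeff (r k) (d + N) = coeff (p k) d * l (coeff (A 0 (app (S ^ k) u)) N)"
      by blast
    have "poly (\<Sum>k\<le>card B. r k) z = l (ev z (A 0 (\<Sum>k\<le>card B. sc (p k) (app (S ^ k) u))))" for z
    proof -
      have "ev z (A 0 (\<Sum>k\<le>card B. sc (p k) (app (S ^ k) u))) = app (Lm 0 z) (\<Sum>k\<le>card B. sc (p k) (app (S ^ k) u))"
        by (simp only: app_Lm)
      also have "\<dots> = (\<Sum>k\<le>card B. sc (pcompose (p k) [:z, 1:]) (ev z (A 0 (app (S ^ k) u))))"
        unfolding app_sum_right by (simp add: A_scale)
      finally show ?thesis by (simp add: poly_sum linear_form_sum[OF l] r(1))
    qed
    then have "(\<Sum>k\<le>card B. r k) = 0"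
      unfolding p(2) using linear_form_simps(1)[OF l] poly_all_0_iff_0[of "\<Sum>k\<le>card B. r k"] by simp
    then have "coeff (\<Sum>k\<le>card B. r k) (d + N) = 0" by simp
    moreover have "app (PE Q (S + K (\<kappa> N))) w = (\<Sum>k\<le>card B. sc [:coeff (p k) d:] (coeff (A 0 (app (S ^ k) u)) N))"
      by (simp add: Q_def PE_sum PE_monom S app_sum_left coeff_S w_def)
    ultimately show "l (app (PE Q (S + K (\<kappa> N))) w) = l 0"
      by (simp add: coeff_sum r(2) linear_form_sum[OF l] linear_form_simps[OF l])
  qed
  then obtain z v where v: "v \<noteq> 0" "app (S + K (\<kappa> N)) v = sc [:z:] v"
    using PE_eigenvector[OF _ \<open>Q \<noteq> 0\<close> w] S by blast
  then have "app S v = sc [:z:] v - sc [:\<kappa> N:] v" by (simp add: eq_diff_eq)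
  then have "app S v = sc [:z - \<kappa> N:] v" by (simp flip: scale_left_diff_distrib)
  then show ?thesis using v by blast
qed

lemma X_commute:
  assumes "Klin S" "\<And>z. Lm i z * S = S * Lm i z"
  shows "X i n * S = S * X i n"
proof (rule endo_eqI)
  fix v
  have "A i (app S v) = map_poly (app S) (A i v)"
  proof (rule ev_eqD)
    fix z
    have "app (Lm i z * S) v = app (S * Lm i z) v" by (simp only: assms)
    then show "ev z (A i (app S v)) = ev z (map_poly (app S) (A i v))"
      by (subst ev_map_poly) (simp_all add: Klin_app[OF assms(1)])
  qed
  then show "app (X i n * S) v = app (S * X i n) v" by (simp add: coeff_map_poly)
qed

text \<open>\<open>T = X 0 0 - Del\<close> commutes with \<partial>, so its eigenspaces are
  submodules over the polynomial ring, and \<open>Lm i\<close> shifts the eigenvalue by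
  \<open>\<beta> i = i * \<beta> 1\<close>. Independence and freeness from torsion leave only
  finitely many eigenvalues; an extreme one in the direction of \<open>\<beta> 1\<close> has a
  stable eigenspace, which is everything.\<close>

lemma X00_scalar:
  "\<exists>c. X 0 0 = Del + K c \<and> (\<beta> 1 = 0 \<or> (\<forall>i\<ge>1. \<forall>v. A i v = 0))"
proof -
  define T where "T = X 0 0 - Del"
  have T: "Klin T" by (simp add: T_def)
  have TL: "T * Lm i y = Lm i y * T + K (\<beta> i) * Lm i y" for i y
  proof -
    have "ad (X 0 0) (Lm i y) = K (\<beta> i - y) * Lm i y"
      using ad_Lm[of 0 0 i y] by (simp add: Lm_0 P_0)
    moreover have "Lm i y * Del = (Del + K y) * Lm i y"
      using Lm_Sc[of i y "[:0, 1:]"] by (simp add: pcompose_pCons K_add flip: Sc_ring(3))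
    ultimately show ?thesis
      by (simp add: T_def ad_def algebra_simps K_diff)
  qed
  have TSc: "T * Sc p = Sc p * T" for p
  proof -
    have "X 0 0 * Sc p = Sc p * X 0 0"
      using Lm_Sc[of 0 0 p] by (simp add: Lm_0 pcompose_idR)
    then show ?thesis by (simp add: T_def algebra_simps mult.commute flip: Sc_ring)
  qed
  define V where "V z = {v. app T v = sc [:z:] v}" for z
  have sub: "subspace (V z)" for z
  proof (rule subspaceI)
    fix p x assume "x \<in> V z"
    moreover have "app T (sc p x) = sc p (app T x)" using arg_cong[OF TSc, of "\<lambda>f. app f x"] by simp
    ultimately show "sc p x \<in> V z" by (simp add: V_def mult.commute)
  qed (auto simp: V_def scale_right_distrib)
  have LV: "ev y (A i v) \<in> V (z + \<beta> i)" if "v \<in> V z" for z i y v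
  proof -
    have "app T (ev y (A i v)) = ev y (A i (app T v)) + sc [:\<beta> i:] (ev y (A i v))"
      using arg_cong[OF TL, of "\<lambda>f. app f v"] by simp
    also have "\<dots> = sc [:z + \<beta> i:] (ev y (A i v))"
      using that by (simp add: V_def A_scale flip: scale_left_distrib)
    finally show ?thesis by (simp add: V_def)
  qed
  have "\<exists>z v. v \<noteq> 0 \<and> app T v = sc [:z:] v"
    by (rule eigenvector_exists[OF T, of "\<lambda>_. 0"]) (use X_commute[OF T, of 0] TL[of 0] \<beta>_0 in auto)
  then obtain z0 v0 where z0: "v0 \<noteq> 0" "v0 \<in> V z0" by (auto simp: V_def)
  define E where "E = {z. V z \<noteq> {0}}"
  have E: "z0 \<in> E" using z0 by (auto simp: E_def)
  obtain B where B: "finite B" "span B = UNIV" using fin_gen by blast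
  have "finite E"
  proof (rule ccontr)
    assume "infinite E"
    then obtain I where I: "I \<subseteq> E" "finite I" "card I = Suc (card B)"
      using infinite_arbitrarily_large by blast
    have "\<exists>v. v \<in> V z \<and> v \<noteq> 0" if "z \<in> I" for z
      using that I(1) subspace_0[OF sub[of z]] by (auto simp: E_def)
    then obtain u where u: "\<And>z. z \<in> I \<Longrightarrow> u z \<in> V z \<and> u z \<noteq> 0" by metis
    obtain p where p: "\<exists>i\<in>I. p i \<noteq> 0" "(\<Sum>i\<in>I. sc (p i) (u i)) = 0"
      using module_dependent_family[OF module_axioms B(1) I(2), of u] B(2) I(3) by auto
    have "\<forall>i\<in>I. sc (p i) (u i) = 0"
    proof (rule eigenvectors_independent[OF T I(2), of "\<lambda>z. z"])
      fix z assume "z \<in> I"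
      then have "sc (p z) (u z) \<in> V z" using u sub by (blast intro: subspace_scale)
      then show "app T (sc (p z) (u z)) = sc [:z:] (sc (p z) (u z))" by (simp add: V_def)
    qed (auto simp: p)
    then show False using p u by (auto simp: torsion_free)
  qed
  \<comment> \<open>For \<open>\<beta> 1 = 0\<close> all quotients are 0 by convention and any
    eigenvalue may be picked; no \<open>Lm i\<close> shifts it in that case.\<close>
  have "Max ((\<lambda>z. Re (z / \<beta> 1)) ` E) \<in> (\<lambda>z. Re (z / \<beta> 1)) ` E"
    using E \<open>finite E\<close> by (intro Max_in) auto
  then obtain c where cE: "c \<in> E" and "Re (c / \<beta> 1) = Max ((\<lambda>z. Re (z / \<beta> 1)) ` E)" by auto
  then have c_max: "Re (z / \<beta> 1) \<le> Re (c / \<beta> 1)" if "z \<in> E" for z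
    using that \<open>finite E\<close> by simp
  have kill: "\<beta> 1 = 0 \<or> (\<forall>i\<ge>1. V (c + \<beta> i) = {0})"
  proof (cases "\<beta> 1 = 0")
    case False
    have b: "\<beta> i = of_nat i * \<beta> 1" for i
      by (induction i) (simp_all add: \<beta>_0 \<beta>_Suc algebra_simps del: One_nat_def)
    have "c + \<beta> i \<notin> E" if "i \<ge> 1" for i
    proof
      assume "c + \<beta> i \<in> E"
      then have "Re ((c + \<beta> i) / \<beta> 1) \<le> Re (c / \<beta> 1)" by (rule c_max)
      moreover have "(c + \<beta> i) / \<beta> 1 = c / \<beta> 1 + of_nat i" using False by (simp add: b[of i] add_divide_distrib)
      ultimately show False using that by simp
    qed
    then show ?thesis by (auto simp: E_def)
  qed simp
  have b0: "\<beta> 1 = 0 \<Longrightarrow> \<beta> i = 0" for i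
    by (induction i) (simp_all add: \<beta>_0 \<beta>_Suc del: One_nat_def)
  have "ev x (A i v) \<in> V c" if v: "v \<in> V c" for i x v
  proof (cases "\<beta> 1 = 0 \<or> i = 0")
    case True
    then show ?thesis using LV[OF v, of x i] b0 \<beta>_0 by auto
  next
    case False
    then have "ev x (A i v) = 0" using LV[OF v, of x i] kill by auto
    then show ?thesis using sub by (simp add: subspace_0)
  qed
  moreover obtain v where "v \<in> V c" "v \<noteq> 0" using cE subspace_0[OF sub[of c]] by (auto simp: E_def)
  ultimately have UN: "V c = UNIV" using stable_UNIV[OF sub] by blast
  have "X 0 0 = Del + K c"
  proof (rule endo_eqI)
    fix v have "v \<in> V c" using UN by simp
    then show "app (X 0 0) v = app (Del + K c) v" by (simp add: V_def T_def algebra_simps)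
  qed
  moreover have "\<forall>i\<ge>1. \<forall>v. A i v = 0" if "\<beta> 1 \<noteq> 0"
  proof (intro allI impI)
    fix i :: nat and v assume "i \<ge> 1"
    then have "ev y (A i v) = 0" for y
      using LV[of v c y i] kill that UN by auto
    then show "A i v = 0" by (intro A_eq_0I[of UNIV]) (auto simp: infinite_UNIV_char_0)
  qed
  ultimately show ?thesis by blast
qed

end

section \<open>Weight decomposition\<close>

lemma poly_extI: "(\<And>x. poly p x = poly q x) \<Longrightarrow> p = (q :: complex poly)"
  by (metis poly_eq_poly_eq_iff ext)

locale homog_rep = graded_rep sc A P \<alpha> "\<lambda>_. 0"
  for sc :: "complex poly \<Rightarrow> 'v::ab_group_add \<Rightarrow> 'v" and A P \<alpha> +
  assumes X00: "X 0 0 = Del"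
begin

abbreviation E :: "'v endo" where "E \<equiv> X 0 1"

lemma Lm_Del: "Lm i z * Del = (Del + K z) * Lm i z"
  using Lm_Sc[of i z "[:0, 1:]"] by (simp add: pcompose_pCons flip: Sc_ring(3))

lemma ad_Del_Lm: "ad Del (Lm i z) = K (- z) * Lm i z"
  by (simp add: ad_def Lm_Del K_minus algebra_simps)

lemma A_Del: "A i (sc [:0, 1:] v) = map_poly (sc [:0, 1:]) (A i v) + pCons 0 (A i v)"
  by (rule ev_eqD)
     (simp add: A_scale pcompose_pCons ev_map_poly scale_right_distrib mult.commute
        flip: scale_left_distrib)

lemma X_Del: "X i 0 * Del = Del * X i 0" "X i (Suc n) * Del = Del * X i (Suc n) + X i n"
  by (rule endo_eqI, simp add: A_Del coeff_map_poly)+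

lemma ad_L0: "ad (Lm 0 x) (Lm j y) = K (\<alpha> j * x - y) * Lm j (x + y)"
  using ad_Lm[of 0 x j y] by (simp add: P_0)

text \<open>The coefficient of x in \<open>(\<alpha> i * x - y) * Lm i (x + y)\<close> is
  \<open>\<alpha> i\<close> times \<open>Lm i y\<close> minus y times its derivative in y.
  Comparison of coefficients of powers of y gives the weight \<open>\<alpha> i - n\<close> of
  \<open>X i n\<close>.\<close>

lemma E_X: "E * X i n = X i n * E + K (\<alpha> i - of_nat n) * X i n"
proof (rule endo_eqI, rule eq_by_linear_form)
  fix v l assume l: "linear_form l"
  note ls = linear_form_simps[OF l] linear_form_sum[OF l]
  define q where "q = map_poly l (A i v)"
  define r1 where "r1 = map_poly (\<lambda>w. l (coeff (A 0 w) (Suc 0))) (A i v)"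
  define r2 where "r2 = map_poly l (A i (app E v))"
  have lE: "linear_form (\<lambda>w. l (coeff (A 0 w) (Suc 0)))"
    using linear_form_comp[OF l, of E] Klin_app[OF Klin_X] by simp
  have "poly (r1 - r2) y = poly (smult (\<alpha> i) q - pCons 0 (pderiv q)) y" for y
  proof -
    define s1 where "s1 = map_poly l (A 0 (ev y (A i v)))"
    define s2 where "s2 = map_poly (\<lambda>w. l (ev y (A i w))) (A 0 v)"
    have lL: "linear_form (\<lambda>w. l (ev y (A i w)))"
      using linear_form_comp[OF l, of "Lm i y"] Klin_app[OF Klin_Lm] by simp
    have "poly (s1 - s2) x = poly ([:- y, \<alpha> i:] * pcompose q [:y, 1:]) x" for x
    proof -
      have "poly s1 x = l (ev x (A 0 (ev y (A i v))))" "poly s2 x = l (ev y (A i (ev x (A 0 v))))"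
        by (simp_all add: s1_def s2_def flip: linear_form_ev[OF l] linear_form_ev[OF lL])
      then have "poly (s1 - s2) x = l (ev x (A 0 (ev y (A i v))) - ev y (A i (ev x (A 0 v))))"
        by (simp add: ls)
      also have "\<dots> = (\<alpha> i * x - y) * poly q (x + y)"
        unfolding A_comm by (simp add: ls P_0 q_def linear_form_ev[OF l])
      finally show ?thesis by (simp add: poly_pcompose algebra_simps)
    qed
    then have "s1 - s2 = [:- y, \<alpha> i:] * pcompose q [:y, 1:]" by (rule poly_extI)
    then have "coeff (s1 - s2) 1 = coeff ([:- y, \<alpha> i:] * pcompose q [:y, 1:]) 1" by simp
    moreover have "coeff (s1 - s2) 1 = poly (r1 - r2) y"
      by (simp add: s1_def s2_def r1_def r2_def coeff_map_poly ls linear_form_simps[OF lL]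
          flip: linear_form_ev[OF l] linear_form_ev[OF lE])
    moreover have "coeff (pcompose q [:y, 1:]) 1 = poly (pderiv q) y" "coeff (pcompose q [:y, 1:]) 0 = poly q y"
    proof -
      have c: "coeff p 0 = poly p 0" "coeff p 1 = poly (pderiv p) 0" for p :: "complex poly"
        by (simp_all add: poly_0_coeff_0 coeff_pderiv)
      show "coeff (pcompose q [:y, 1:]) 1 = poly (pderiv q) y" "coeff (pcompose q [:y, 1:]) 0 = poly q y"
        unfolding c by (simp_all add: pderiv_pcompose poly_pcompose pderiv_pCons)
    qed
    ultimately show ?thesis by simp
  qed
  then have "r1 - r2 = smult (\<alpha> i) q - pCons 0 (pderiv q)" by (rule poly_extI)
  then have "coeff (r1 - r2) n = coeff (smult (\<alpha> i) q - pCons 0 (pderiv q)) n" by simp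
  then show "l (app (E * X i n) v) = l (app (X i n * E + K (\<alpha> i - of_nat n) * X i n) v)"
    by (cases n) (auto simp: r1_def r2_def q_def coeff_map_poly coeff_pderiv ls algebra_simps
        linear_form_simps[OF lE])
qed

definition wsp :: "complex \<Rightarrow> 'v set" where
  "wsp w = {v. app E v = sc [:w:] v}"

lemma wsp_subspace: "C.subspace (wsp w)"
  by (auto intro!: C.subspaceI simp: wsp_def scale_right_distrib A_add A_const coeff_map_poly mult.commute)

lemma wsp_0 [simp, intro]: "0 \<in> wsp w"
  by (simp add: wsp_def)

lemma X_wsp:
  assumes "v \<in> wsp w"
  shows "coeff (A i v) n \<in> wsp (w + \<alpha> i - of_nat n)"
proof -
  have v: "app E v = sc [:w:] v" using assms by (simp only: wsp_def mem_Collect_eq)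
  have "app E (app (X i n) v) = app (X i n) (app E v) + sc [:\<alpha> i - of_nat n:] (app (X i n) v)"
    using arg_cong[OF E_X, of "\<lambda>f. app f v" i n] by (simp only: app_ring app_Sc)
  also have "\<dots> = sc [:w + \<alpha> i - of_nat n:] (app (X i n) v)"
    by (simp only: v Klin_app[OF Klin_X] scale_left_distrib[symmetric]) simp
  finally show ?thesis by (simp only: wsp_def mem_Collect_eq app_X)
qed

lemma Del_wsp:
  assumes "v \<in> wsp w"
  shows "sc [:0, 1:] v \<in> wsp (w + 1)"
proof -
  have v: "app E v = sc [:w:] v" using assms by (simp only: wsp_def mem_Collect_eq)
  have "app E (app Del v) = app Del (app E v) + app Del v"
    using arg_cong[OF X_Del(2), of "\<lambda>f. app f v" 0 0] by (simp only: app_ring X00 One_nat_def)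
  also have "\<dots> = sc [:w + 1:] (app Del v)"
    unfolding v by (simp flip: scale_left_distrib)
  finally show ?thesis by (simp only: wsp_def mem_Collect_eq app_Sc)
qed

lemma Del_power_wsp: "v \<in> wsp w \<Longrightarrow> sc (monom 1 a) v \<in> wsp (w + of_nat a)"
proof (induction a)
  case (Suc a)
  have "sc (monom 1 (Suc a)) v = sc [:0, 1:] (sc (monom 1 a) v)"
    by (simp add: monom_Suc)
  then show ?case using Del_wsp[OF Suc.IH[OF Suc.prems]] by (simp add: add_ac)
qed (simp add: monom_0 flip: one_pCons)

lemma sc_as_sum: "sc p v = (\<Sum>a\<le>degree p. sc [:coeff p a:] (sc (monom 1 a) v))"
proof -
  have "p = (\<Sum>a\<le>degree p. [:coeff p a:] * monom 1 a)"
    by (subst poly_as_sum_of_monoms[of p, symmetric]) (simp add: smult_monom)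
  then have "sc p v = sc (\<Sum>a\<le>degree p. [:coeff p a:] * monom 1 a) v" by simp
  also have "\<dots> = (\<Sum>a\<le>degree p. sc [:coeff p a:] (sc (monom 1 a) v))"
    by (simp only: scale_sum_left scale_scale)
  finally show ?thesis .
qed

lemma wsp_exists: "\<exists>w. wsp w \<noteq> {0}"
proof -
  have "X 0 n * E = (E + K (of_nat n - 1)) * X 0 n" for n
    using E_X[of 0 n] by (simp add: \<alpha>_0 K_diff algebra_simps)
  from eigenvector_exists[OF Klin_X this] show ?thesis by (auto simp: wsp_def)
qed

text \<open>\<partial> shifts weights by 1 and \<open>X i n\<close> by
  \<open>\<alpha> i - n\<close>, so the sum of the weight spaces is stable; it is nonzero by
  \<open>wsp_exists\<close>.\<close>

lemma span_wsp: "C.span (\<Union>w. wsp w) = UNIV"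
proof -
  define N where "N = C.span (\<Union>w. wsp w)"
  have CN: "C.subspace N" by (simp add: N_def)
  have inN: "v \<in> wsp w \<Longrightarrow> v \<in> N" for v w by (auto simp: N_def intro: C.span_base)
  have ind: "Q v" if v: "v \<in> N" and Q: "Q 0" "\<And>x y. Q x \<Longrightarrow> Q y \<Longrightarrow> Q (x + y)"
      "\<And>w x. x \<in> wsp w \<Longrightarrow> Q x" for Q v
  proof -
    have *: "Q (sc [:z:] x)" if x: "x \<in> (\<Union>w. wsp w)" for z x
      using x C.subspace_scale[OF wsp_subspace] Q(3) by blast
    show ?thesis
      using v unfolding N_def by (induction rule: C.span_induct_alt) (auto simp: Q(1) intro: Q(2) *)
  qed
  have sub: "subspace N"
  proof (rule subspaceI)
    fix p v assume "v \<in> N"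
    then show "sc p v \<in> N"
    proof (rule ind)
      fix w x assume "x \<in> wsp w"
      then show "sc p x \<in> N" unfolding sc_as_sum[of p]
        by (intro C.subspace_sum[OF CN] C.subspace_scale[OF CN] inN[OF Del_power_wsp])
    qed (use CN in \<open>auto simp: scale_right_distrib intro: C.subspace_add C.subspace_0\<close>)
  qed (use CN in \<open>auto intro: C.subspace_add C.subspace_0\<close>)
  have "ev x (A i v) \<in> N" if "v \<in> N" for i x v
    using that
  proof (rule ind)
    fix w u assume "u \<in> wsp w"
    then show "ev x (A i u) \<in> N" unfolding ev_def
      by (intro C.subspace_sum[OF CN] C.subspace_scale[OF CN] inN[OF X_wsp])
  qed (use CN in \<open>auto simp: A_add intro: C.subspace_add C.subspace_0\<close>)
  moreover obtain w v where "v \<in> wsp w" "v \<noteq> 0" using wsp_exists wsp_0 by blast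
  ultimately have "N = UNIV" using stable_UNIV[OF sub] inN by blast
  then show ?thesis by (simp only: N_def)
qed

definition decomp :: "'v \<Rightarrow> (complex \<Rightarrow> 'v) \<Rightarrow> bool" where
  "decomp v f \<longleftrightarrow> finite {w. f w \<noteq> 0} \<and> (\<forall>w. f w \<in> wsp w) \<and> (\<Sum>w | f w \<noteq> 0. f w) = v"

lemma decomp_alt:
  assumes "finite W" "\<And>w. f w \<in> wsp w" "\<And>w. w \<notin> W \<Longrightarrow> f w = 0" "(\<Sum>w\<in>W. f w) = v"
  shows "decomp v f"
proof -
  have W: "{w. f w \<noteq> 0} \<subseteq> W" using assms(3) by auto
  moreover have "(\<Sum>w | f w \<noteq> 0. f w) = (\<Sum>w\<in>W. f w)"
    by (rule sum.mono_neutral_left[OF assms(1) W]) auto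
  ultimately show ?thesis using assms finite_subset by (auto simp: decomp_def)
qed

lemma decomp_sum_over:
  assumes "decomp v f" "finite W" "{w. f w \<noteq> 0} \<subseteq> W"
  shows "(\<Sum>w\<in>W. f w) = v"
  using assms sum.mono_neutral_left[OF assms(2,3), of f] by (auto simp: decomp_def)

lemma decomp_add:
  assumes "decomp v f" "decomp u g"
  shows "decomp (v + u) (\<lambda>w. f w + g w)"
proof (rule decomp_alt)
  define W where "W = {w. f w \<noteq> 0} \<union> {w. g w \<noteq> 0}"
  show fin: "finite W" using assms by (auto simp: W_def decomp_def)
  show "f w + g w = 0" if "w \<notin> W" for w using that by (auto simp: W_def)
  show "f w + g w \<in> wsp w" for w
    using assms by (auto simp: decomp_def intro: C.subspace_add[OF wsp_subspace])
  show "(\<Sum>w\<in>W. f w + g w) = v + u"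
  proof -
    have "{w. f w \<noteq> 0} \<subseteq> W" "{w. g w \<noteq> 0} \<subseteq> W" by (auto simp: W_def)
    then show ?thesis
      using decomp_sum_over[OF assms(1) fin] decomp_sum_over[OF assms(2) fin] by (simp add: sum.distrib)
  qed
qed

lemma decomp_scale:
  assumes "decomp v f"
  shows "decomp (sc [:z:] v) (\<lambda>w. sc [:z:] (f w))"
proof (rule decomp_alt)
  show "(\<Sum>w | f w \<noteq> 0. sc [:z:] (f w)) = sc [:z:] v"
    using assms by (simp only: scale_sum_right[symmetric] decomp_def)
qed (use assms in \<open>auto simp: decomp_def intro: C.subspace_scale[OF wsp_subspace]\<close>)

lemma decomp_single: "v \<in> wsp w \<Longrightarrow> decomp v (\<lambda>w'. if w' = w then v else 0)"
  by (rule decomp_alt[of "{w}"]) auto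

lemma decomp_unique:
  assumes "decomp v f" "decomp v g"
  shows "f = g"
proof
  fix w
  define W where "W = insert w ({w. f w \<noteq> 0} \<union> {w. g w \<noteq> 0})"
  have fin: "finite W" using assms by (auto simp: W_def decomp_def)
  have "\<forall>w\<in>W. f w - g w = 0"
  proof (rule eigenvectors_independent[of E W "\<lambda>w. w"])
    show "(\<Sum>w\<in>W. f w - g w) = 0"
    proof -
      have "{w. f w \<noteq> 0} \<subseteq> W" "{w. g w \<noteq> 0} \<subseteq> W" by (auto simp: W_def)
      then show ?thesis
        using decomp_sum_over[OF assms(1) fin] decomp_sum_over[OF assms(2) fin] by (simp add: sum_subtractf)
    qed
    fix w
    have "f w - g w \<in> wsp w"
      using assms by (intro C.subspace_diff[OF wsp_subspace]) (auto simp: decomp_def)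
    then show "app E (f w - g w) = sc [:w:] (f w - g w)" by (simp only: wsp_def mem_Collect_eq)
  qed (use fin in auto)
  then show "f w = g w" by (simp add: W_def)
qed

lemma decomp_exists: "\<exists>f. decomp v f"
proof -
  have "v \<in> C.span (\<Union>w. wsp w)" by (simp add: span_wsp)
  then show ?thesis
  proof (induction rule: C.span_induct_alt)
    case base
    show ?case by (intro exI[of _ "\<lambda>_. 0"] decomp_alt[of "{}"]) auto
  next
    case (step c x y)
    then show ?case using decomp_add decomp_scale decomp_single by blast
  qed
qed

definition wcomp :: "'v \<Rightarrow> complex \<Rightarrow> 'v" where
  "wcomp v = (THE f. decomp v f)"

lemma decomp_comp: "decomp v (wcomp v)"
proof -
  obtain f where f: "decomp v f" using decomp_exists by blast
  have "\<exists>!f. decomp v f" by (rule ex1I[of _ f]) (auto intro: f decomp_unique[OF _ f])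
  then show ?thesis unfolding wcomp_def by (rule theI')
qed

lemma comp_eqI: "decomp v f \<Longrightarrow> wcomp v = f"
  by (rule decomp_unique[OF decomp_comp])

lemma comp_wsp [simp, intro]: "wcomp v w \<in> wsp w"
  and comp_finite: "finite {w. wcomp v w \<noteq> 0}"
  and comp_sum: "(\<Sum>w | wcomp v w \<noteq> 0. wcomp v w) = v"
  using decomp_comp[of v] by (auto simp: decomp_def)

lemma comp_add: "wcomp (u + v) w = wcomp u w + wcomp v w"
  using comp_eqI[OF decomp_add[OF decomp_comp decomp_comp]] by simp

lemma comp_scale: "wcomp (sc [:z:] v) w = sc [:z:] (wcomp v w)"
  using comp_eqI[OF decomp_scale[OF decomp_comp]] by simp

lemma comp_zero: "wcomp 0 w = 0"
  using comp_scale[of 0 0 w] by simp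

lemma comp_sum_distrib: "wcomp (\<Sum>i\<in>I. x i) w = (\<Sum>i\<in>I. wcomp (x i) w)"
  by (induction I rule: infinite_finite_induct) (auto simp: comp_add comp_zero)

lemma comp_single: "v \<in> wsp w \<Longrightarrow> wcomp v w' = (if w' = w then v else 0)"
  using comp_eqI[OF decomp_single] by simp

lemma comp_Del: "wcomp (sc [:0, 1:] v) w = sc [:0, 1:] (wcomp v (w - 1))"
proof -
  have "wcomp (sc [:0, 1:] v) = (\<lambda>w. sc [:0, 1:] (wcomp v (w - 1)))"
  proof (intro comp_eqI decomp_alt[of "(\<lambda>w. w + 1) ` {w. wcomp v w \<noteq> 0}"])
    fix w show "sc [:0, 1:] (wcomp v (w - 1)) \<in> wsp w"
      using Del_wsp[OF comp_wsp, of v "w - 1"] by simp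
    show "sc [:0, 1:] (wcomp v (w - 1)) = 0" if w: "w \<notin> (\<lambda>w. w + 1) ` {w. wcomp v w \<noteq> 0}"
    proof -
      have "wcomp v (w - 1) = 0"
      proof (rule ccontr)
        assume "wcomp v (w - 1) \<noteq> 0"
        then have "w - 1 + 1 \<in> (\<lambda>w. w + 1) ` {w. wcomp v w \<noteq> 0}" by blast
        then show False using w by simp
      qed
      then show ?thesis by simp
    qed
  next
    have "(\<Sum>w\<in>(\<lambda>w. w + 1) ` {w. wcomp v w \<noteq> 0}. sc [:0, 1:] (wcomp v (w - 1)))
        = (\<Sum>w | wcomp v w \<noteq> 0. sc [:0, 1:] (wcomp v w))"
      by (subst sum.reindex) (auto simp: inj_on_def)
    also have "\<dots> = sc [:0, 1:] v"
      by (simp only: scale_sum_right[symmetric] comp_sum)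
    finally show "(\<Sum>w\<in>(\<lambda>w. w + 1) ` {w. wcomp v w \<noteq> 0}. sc [:0, 1:] (wcomp v (w - 1))) = sc [:0, 1:] v" .
  qed (simp add: comp_finite)
  then show ?thesis by simp
qed

lemma homogeneous_generators:
  obtains B wt where "finite B" "span B = UNIV" "\<And>e. e \<in> B \<Longrightarrow> e \<in> wsp (wt e)" "\<And>e. e \<in> B \<Longrightarrow> e \<noteq> 0"
proof -
  obtain S where S: "finite S" "span S = UNIV" using fin_gen by blast
  define B where "B = (\<Union>s\<in>S. wcomp s ` {w. wcomp s w \<noteq> 0})"
  have fin: "finite B" using S comp_finite by (auto simp: B_def)
  have wt: "\<exists>w. e \<in> wsp w" "e \<noteq> 0" if "e \<in> B" for e using that by (auto simp: B_def)
  have "s \<in> span B" if "s \<in> S" for s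
  proof -
    have "(\<Sum>w | wcomp s w \<noteq> 0. wcomp s w) \<in> span B"
      by (intro span_sum span_base) (use that in \<open>auto simp: B_def\<close>)
    then show ?thesis by (simp add: comp_sum)
  qed
  then have "span B = UNIV" using S(2) by (metis span_minimal subsetI subspace_span top.extremum_unique)
  moreover have "e \<in> wsp (SOME w. e \<in> wsp w)" if "e \<in> B" for e
    by (rule someI_ex) (rule wt[OF that])
  ultimately show thesis using that[of B "\<lambda>e. SOME w. e \<in> wsp w"] fin wt(2) by blast
qed

end

locale homog_rep_gen = homog_rep +
  fixes B :: "'a set" and wt :: "'a \<Rightarrow> complex"
  assumes B_fin: "finite B" and B_span: "span B = UNIV"
    and B_wt: "e \<in> B \<Longrightarrow> e \<in> wsp (wt e)" and B_nz: "e \<in> B \<Longrightarrow> e \<noteq> 0"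
begin

text \<open>The vectors \<partial>^a e of weight exactly \<open>w\<close>. The exponent is forced to
  be \<open>w - wt e\<close>, which the floor of the real part recovers; hence at most one vector
  per generator and a bound on dimensions uniform in \<open>w\<close>.\<close>

definition Bw :: "complex \<Rightarrow> 'a set" where
  "Bw w = (\<lambda>e. sc (monom 1 (nat \<lfloor>Re (w - wt e)\<rfloor>)) e) ` {e \<in> B. \<exists>a. w = wt e + of_nat a}"

lemma Bw_finite: "finite (Bw w)" and Bw_card: "card (Bw w) \<le> card B"
proof -
  show "finite (Bw w)" using B_fin by (simp add: Bw_def)
  have "card (Bw w) \<le> card {e \<in> B. \<exists>a. w = wt e + of_nat a}"
    unfolding Bw_def using B_fin by (intro card_image_le) auto
  also have "\<dots> \<le> card B" using B_fin by (intro card_mono) auto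
  finally show "card (Bw w) \<le> card B" .
qed

lemma wsp_subset_span: "wsp w \<subseteq> C.span (Bw w)"
proof
  fix v assume v: "v \<in> wsp w"
  have "v \<in> span B" using B_span by simp
  then obtain p where p: "v = (\<Sum>e\<in>B. sc (p e) e)"
    unfolding span_finite[OF B_fin] by blast
  have "v = wcomp v w" using comp_single[OF v] by simp
  also have "\<dots> = (\<Sum>e\<in>B. \<Sum>a\<le>degree (p e). sc [:coeff (p e) a:] (wcomp (sc (monom 1 a) e) w))"
  proof -
    have "wcomp (sc (p e) e) w = (\<Sum>a\<le>degree (p e). sc [:coeff (p e) a:] (wcomp (sc (monom 1 a) e) w))" for e
      by (subst sc_as_sum[of "p e"]) (simp only: comp_sum_distrib comp_scale)
    then show ?thesis by (simp only: p comp_sum_distrib)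
  qed
  also have "\<dots> \<in> C.span (Bw w)"
  proof (intro C.span_sum C.span_scale)
    fix e a assume e: "e \<in> B"
    have "sc (monom 1 a) e \<in> wsp (wt e + of_nat a)" by (intro Del_power_wsp B_wt e)
    then have "wcomp (sc (monom 1 a) e) w = (if w = wt e + of_nat a then sc (monom 1 a) e else 0)"
      by (rule comp_single)
    moreover have "sc (monom 1 a) e \<in> Bw w" if "w = wt e + of_nat a"
      unfolding Bw_def using e that by (intro image_eqI[of _ _ e]) auto
    ultimately show "wcomp (sc (monom 1 a) e) w \<in> C.span (Bw w)"
      by (auto intro: C.span_base C.span_zero)
  qed
  finally show "v \<in> C.span (Bw w)" .
qed

lemma wsp_nonzeroD: "wsp w \<noteq> {0} \<Longrightarrow> (\<exists>e\<in>B. \<exists>a. w = wt e + of_nat a)"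
proof (rule ccontr)
  assume w: "wsp w \<noteq> {0}" and "\<not> ?thesis"
  then have "Bw w = {}" by (auto simp: Bw_def)
  then show False using wsp_subset_span[of w] w wsp_0[of w] by auto
qed

lemma B_nonempty: "B \<noteq> {}"
  using wsp_exists wsp_nonzeroD by blast

lemma lowest_weight: "\<exists>w. wsp w \<noteq> {0} \<and> (\<forall>w'. Re w' < Re w \<longrightarrow> wsp w' = {0})"
proof -
  have "Min ((\<lambda>e. Re (wt e)) ` B) \<in> (\<lambda>e. Re (wt e)) ` B"
    using B_fin B_nonempty by (intro Min_in) auto
  then obtain e where e: "e \<in> B" "Re (wt e) = Min ((\<lambda>e. Re (wt e)) ` B)" by auto
  have "Re (wt e) \<le> Re (wt e')" if "e' \<in> B" for e' using that e B_fin by simp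
  then have "wsp w' = {0}" if "Re w' < Re (wt e)" for w'
    using wsp_nonzeroD[of w'] that by force
  moreover have "wsp (wt e) \<noteq> {0}" using B_wt[OF e(1)] B_nz[OF e(1)] by auto
  ultimately show ?thesis by (intro exI[of _ "wt e"]) auto
qed

lemma A_eq_0_on_generators:
  assumes "\<And>e. e \<in> B \<Longrightarrow> A i e = 0"
  shows "A i v = 0"
proof -
  define N where "N = {v. \<forall>z. ev z (A i v) = 0}"
  have "subspace N"
    by (rule subspaceI) (auto simp: N_def A_add A_scale)
  then have "span B \<subseteq> N" using assms by (intro span_minimal) (auto simp: N_def)
  then show ?thesis using B_span by (intro A_eq_0I[of UNIV]) (auto simp: N_def infinite_UNIV_char_0)
qed

text \<open>Coefficients of \<open>A i\<close> on a generator have weights with real part at most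
  that of \<open>wt e + \<alpha> i\<close>, which falls below the lowest weight. The threshold
  depends on the generators only, so it serves all \<open>i\<close> at once.\<close>

lemma very_negative_weight_trivial: "\<exists>R. \<forall>i. Re (\<alpha> i) < R \<longrightarrow> (\<forall>v. A i v = 0)"
proof -
  obtain w where w: "\<And>w'. Re w' < Re w \<Longrightarrow> wsp w' = {0}" using lowest_weight by blast
  define R where "R = Re w - Max ((\<lambda>e. Re (wt e)) ` B)"
  have "A i v = 0" if "Re (\<alpha> i) < R" for i v
  proof (rule A_eq_0_on_generators)
    fix e assume e: "e \<in> B"
    then have "Re (wt e) \<le> Max ((\<lambda>e. Re (wt e)) ` B)" using B_fin by simp
    then have "Re (wt e + \<alpha> i - of_nat n) < Re w" for n using that by (simp add: R_def)
    then have "coeff (A i e) n = 0" for n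
      using X_wsp[OF B_wt[OF e], of i n] w by blast
    then show "A i e = 0" by (simp add: poly_eq_iff)
  qed
  then show ?thesis by blast
qed

end

section \<open>Stability under the first two generators, and lowest weight vectors\<close>

context homog_rep
begin

text \<open>The commutator of \<open>Lm 1 x\<close> and \<open>Lm i (r - x)\<close> is
  \<open>P 1 i x (r - x)\<close> times \<open>Lm (Suc i) r\<close>. By \<open>P_1\<close> the factor
  can be made nonzero for infinitely many \<open>r\<close>, which determines all
  coefficients.\<close>

lemma stable_of_stable01:
  assumes N: "subspace N"
    and 0: "\<And>x v. v \<in> N \<Longrightarrow> ev x (A 0 v) \<in> N" and 1: "\<And>x v. v \<in> N \<Longrightarrow> ev x (A 1 v) \<in> N"
    and v: "v \<in> N"
  shows "ev x (A i v) \<in> N"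
  using v
proof (induction i arbitrary: x v)
  case (Suc i)
  have "coeff (A (Suc i) v) n \<in> N" for n
  proof (rule coeff_mem_of_ev[OF subspace_imp_C[OF N] P_1[of i]], safe)
    fix r x assume nz: "P 1 i x (r - x) \<noteq> 0"
    have "sc [:P 1 i x (r - x):] (ev r (A (Suc i) v)) \<in> N"
    proof -
      have "ev x (A 1 (ev (r - x) (A i v))) - ev (r - x) (A i (ev x (A 1 v))) \<in> N"
        by (intro subspace_diff[OF N] 1 Suc)
      then show ?thesis unfolding A_comm by simp
    qed
    then have "sc [:inverse (P 1 i x (r - x)):] (sc [:P 1 i x (r - x):] (ev r (A (Suc i) v))) \<in> N"
      using N by (blast intro: subspace_scale)
    then show "ev r (A (Suc i) v) \<in> N" using nz by (simp add: sc_const_const flip: one_pCons)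
  qed
  then show ?case unfolding ev_def by (intro subspace_sum[OF N] subspace_scale[OF N])
qed (rule 0)

lemma span_single: "span {v} = range (\<lambda>p. sc p v)"
  by (auto simp: span_singleton)

lemma generates:
  assumes "v \<noteq> 0" "\<And>x. ev x (A 0 v) \<in> span {v}" "\<And>x. ev x (A 1 v) \<in> span {v}"
  shows "span {v} = UNIV"
proof (rule stable_UNIV[of "span {v}" v])
  have *: "ev x (A i u) \<in> span {v}" if "\<And>x. ev x (A i v) \<in> span {v}" "u \<in> span {v}" for i x u
    using that(2) subspace_scale[OF subspace_span that(1)] by (auto simp: span_single A_scale)
  fix i x u assume "u \<in> span {v}"
  show "ev x (A i u) \<in> span {v}"
    by (rule stable_of_stable01[OF subspace_span *[OF assms(2)] *[OF assms(3)]]) (assumption | fact)+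
qed (use assms in \<open>auto intro: span_base\<close>)

text \<open>The coefficients of \<open>A 0 v\<close> beyond the linear one would lie below the
  lowest weight; the linear one is \<open>w\<close> by the choice of \<open>E\<close>. Thus the
  conformal weight of \<open>v\<close> is its \<open>E\<close>-weight.\<close>

lemma L0_lowest:
  assumes v: "v \<in> wsp w" and low: "\<And>w'. Re w' < Re w \<Longrightarrow> wsp w' = {0}"
  shows "ev x (A 0 v) = sc [:w * x, 1:] v"
proof -
  have c: "coeff (A 0 v) 0 = sc [:0, 1:] v" "coeff (A 0 v) 1 = sc [:w:] v"
    using arg_cong[OF X00, of "\<lambda>f. app f v"] v by (simp_all add: wsp_def)
  have "coeff (A 0 v) n = 0" if "n > 1" for n
    using X_wsp[OF v, of 0 n] low[of "w + \<alpha> 0 - of_nat n"] that by (auto simp: \<alpha>_0)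
  then have "degree (A 0 v) \<le> 1" by (intro degree_le) auto
  then have "ev x (A 0 v) = sc [:0, 1:] v + sc [:x:] (sc [:w:] v)"
    by (simp add: ev_bound[of _ 1] c[unfolded One_nat_def] flip: one_pCons)
  also have "\<dots> = sc [:w * x, 1:] v"
    unfolding sc_const_const scale_left_distrib[symmetric] by (simp add: mult.commute)
  finally show ?thesis .
qed

lemma higher_zero:
  assumes "(\<forall>v. A 1 v = 0) \<or> (\<forall>v. A i v = 0)"
  shows "A (Suc i) v = 0"
proof (rule A_eq_0I[OF P_1[of i]], safe)
  fix r x assume nz: "P 1 i x (r - x) \<noteq> 0"
  have "sc [:P 1 i x (r - x):] (ev r (A (Suc i) v)) = 0"
    using A_comm[of x 1 "r - x" i v] assms by auto
  then show "ev r (A (Suc i) v) = 0" using nz by simp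
qed

end

section \<open>The chain generated by the second generator\<close>

context cmodule
begin

text \<open>Supplies the hypothesis \<open>char0\<close> of
  \<open>commutator_nilpotent\<close>.\<close>

lemma endo_char0:
  assumes "(\<Sum>i<Suc s. y :: 'v endo) = 0"
  shows "y = 0"
proof (rule endo_eqI)
  fix v
  have "(\<Sum>i<n. w) = sc [:of_nat n:] w" for n and w :: 'v
    by (induction n) (simp_all add: scale_left_distrib[symmetric] add.commute flip: one_pCons,
        metis add_pCons add_0 of_nat_1 one_pCons scale_left_distrib scale_one)
  then have "sc [:of_nat (Suc s):] (app y v) = 0"
    using arg_cong[OF assms, of "\<lambda>f. app f v"] by (simp only: app_sum_left app_ring)
  then have "app y v = 0" unfolding sc_const_eq_0_iff by (simp del: of_nat_Suc)
  then show "app y v = app 0 v" by simp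
qed

lemma eq_0_of_many_roots:
  assumes "degree q \<le> n" "finite Z" "card Z > n" "\<And>z. z \<in> Z \<Longrightarrow> ev z q = 0"
  shows "q = 0"
proof -
  have "coeff q m = 0" for m
  proof (rule eq_by_linear_form)
    fix l assume l: "linear_form l"
    define p where "p = map_poly l q"
    have "degree p \<le> n" using assms(1) map_poly_degree_leq le_trans unfolding p_def by blast
    have "poly p z = 0" if "z \<in> Z" for z
      using assms(4)[OF that] linear_form_ev[OF l, of z q] linear_form_simps(1)[OF l] by (simp add: p_def)
    then have "p = 0"
      using card_poly_roots_bound[of p] card_mono[of "{z. poly p z = 0}" Z] assms(3) \<open>degree p \<le> n\<close>
        poly_roots_finite[of p] by force
    then show "l (coeff q m) = l 0"
      unfolding p_def using linear_form_simps(1)[OF l] by (metis coeff_0 coeff_map_poly)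
  qed
  then show ?thesis by (simp add: poly_eq_iff)
qed

text \<open>Infinitely many operators have to be annihilated by finitely many choices. Products
  \<open>Y\<close> of powers of the commuting \<open>Z x\<close> move \<open>u\<close> into the
  kernel at \<open>Suc n\<close> points; \<open>Y\<close> acts on coefficients, so
  \<open>Z z\<close> on \<open>app Y u\<close> still has degree at most \<open>n\<close> in z and
  vanishes identically.\<close>

lemma common_kernel:
  fixes u :: 'v and Z :: "complex \<Rightarrow> 'v endo"
  assumes u: "u \<noteq> 0"
    and Z: "\<And>z v. app (Z z) v = ev z (q v)" "\<And>z. Klin (Z z)"
    and comm: "\<And>x y. Z x * Z y = Z y * Z x"
    and nil: "\<And>x. x \<noteq> 0 \<Longrightarrow> \<exists>k. Z x ^ k = 0"
  shows "\<exists>v. v \<noteq> 0 \<and> (\<forall>x. app (Z x) v = 0)"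
proof -
  define n where "n = degree (q u)"
  \<comment> \<open>The sample points start at 1, as nilpotency is known only for nonzero
    arguments.\<close>
  define I where "I = (of_nat ` {1..Suc n} :: complex set)"
  have I: "finite I" "card I = Suc n" "0 \<notin> I"
    by (auto simp: I_def card_image inj_on_def)
  have "\<exists>Y. Klin Y \<and> (\<forall>x. Y * Z x = Z x * Y) \<and> app Y u \<noteq> 0 \<and> (\<forall>x\<in>J. app (Z x) (app Y u) = 0)"
    if "finite J" "0 \<notin> J" for J
    using that
  proof (induction J rule: finite_induct)
    case empty
    show ?case by (intro exI[of _ 1]) (auto simp: u)
  next
    case (insert y J)
    then obtain Y where Y: "Klin Y" "\<And>x. Y * Z x = Z x * Y" "app Y u \<noteq> 0" "\<And>x. x \<in> J \<Longrightarrow> app (Z x) (app Y u) = 0"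
      by auto
    obtain k where k: "Z y ^ k = 0" using nil[of y] insert.prems by auto
    define m where "m = (LEAST m. app (Z y ^ m) (app Y u) = 0)"
    have m0: "app (Z y ^ m) (app Y u) = 0"
      unfolding m_def by (rule LeastI[of _ k]) (simp add: k)
    then have "m \<noteq> 0" using Y(3) by (intro notI) simp
    then obtain s where s: "m = Suc s" by (cases m) auto
    have nz: "app (Z y ^ s) (app Y u) \<noteq> 0"
      using not_less_Least[of s "\<lambda>m. app (Z y ^ m) (app Y u) = 0"] s unfolding m_def by simp
    have c: "Z y ^ t * Z x = Z x * Z y ^ t" for t x
      by (rule power_commuting_commutes) (rule comm)
    show ?case
    proof (intro exI[of _ "Z y ^ s * Y"] conjI allI ballI)
      show "Klin (Z y ^ s * Y)" using Y(1) Z(2) by simp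
      show "Z y ^ s * Y * Z x = Z x * (Z y ^ s * Y)" for x
      proof -
        have "Z y ^ s * Y * Z x = Z y ^ s * Z x * Y" by (simp only: mult.assoc Y(2))
        then show ?thesis by (simp only: c mult.assoc)
      qed
      show "app (Z y ^ s * Y) u \<noteq> 0" using nz by simp
      show "app (Z x) (app (Z y ^ s * Y) u) = 0" if "x \<in> insert y J" for x
      proof (cases "x = y")
        case True
        then show ?thesis using m0 s by simp
      next
        case False
        then have "app (Z x * Z y ^ s) (app Y u) = app (Z y ^ s) (app (Z x) (app Y u))"
          by (simp flip: c)
        then show ?thesis using False that Y(4) by simp
      qed
    qed
  qed
  from this[OF I(1,3)] obtain Y where Y: "Klin Y" "\<And>x. Y * Z x = Z x * Y" "app Y u \<noteq> 0"
      "\<And>x. x \<in> I \<Longrightarrow> app (Z x) (app Y u) = 0"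
    by auto
  have ZY: "app (Z z) (app Y u) = ev z (map_poly (app Y) (q u))" for z
    using arg_cong[OF Y(2)[of z], of "\<lambda>f. app f u"]
    by (subst ev_map_poly) (simp_all add: Z(1) Klin_app[OF Y(1)])
  have "map_poly (app Y) (q u) = 0"
    by (rule eq_0_of_many_roots[of _ n I]) (use I Y(4) ZY in \<open>auto simp: n_def intro: map_poly_degree_leq\<close>)
  then show ?thesis using ZY Y(3) by (intro exI[of _ "app Y u"]) simp
qed

text \<open>For \<open>x \<noteq> 0\<close> a nonzero multiple of \<open>Z x\<close> is a commutator
  of \<open>Q\<close> that commutes with the nilpotent \<open>Q\<close>, hence nilpotent by
  \<open>commutator_nilpotent\<close>.\<close>

lemma common_kernel_commutator:
  fixes u :: 'v and Z :: "complex \<Rightarrow> 'v endo"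
  assumes u: "u \<noteq> 0"
    and Z: "\<And>z v. app (Z z) v = ev z (q v)" "\<And>z. Klin (Z z)"
    and comm: "\<And>x y. ad (Z x) (Z y) = 0"
    and Q: "Q ^ m = 0" "Klin Q" and QZ: "\<And>x. ad Q (Z x) = 0"
    and QX: "\<And>x. x \<noteq> 0 \<Longrightarrow> \<exists>c T. c \<noteq> 0 \<and> ad Q T = K c * Z x"
  shows "\<exists>v. v \<noteq> 0 \<and> (\<forall>x. app (Z x) v = 0)"
proof (rule common_kernel[OF u Z])
  show "Z x * Z y = Z y * Z x" for x y using comm[of x y] by (simp add: ad_def)
  fix x :: complex assume "x \<noteq> 0"
  then obtain c T where c: "c \<noteq> 0" "ad Q T = K c * Z x" using QX by blast
  have comm': "Q * ad Q T = ad Q T * Q"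
    unfolding c(2) using QZ[of x] Klin_left_commute[OF Q(2), of c "Z x"]
    by (simp add: ad_def mult.assoc)
  have "\<exists>k. ad Q T ^ k = 0"
    by (rule commutator_nilpotent[OF Q(1) comm']) (rule endo_char0)
  then obtain k where k: "(K c * Z x) ^ k = 0" unfolding c(2) by blast
  have "K (inverse c) ^ k * (K c * Z x) ^ k = Z x ^ k"
  proof (induction k)
    case (Suc k)
    have "K (inverse c) ^ Suc k * (K c * Z x) ^ Suc k
        = K (inverse c) ^ k * (K (inverse c) * (K c * (Z x * (K c * Z x) ^ k)))"
      by (simp only: power_Suc2[of "K (inverse c)"] power_Suc[of "K c * Z x"] mult.assoc)
    also have "K (inverse c) * (K c * (Z x * (K c * Z x) ^ k)) = Z x * (K c * Z x) ^ k"
      using c(1) by (simp only: mult.assoc[symmetric] K_mult[symmetric]) (simp flip: one_pCons)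
    also have "K (inverse c) ^ k * (Z x * (K c * Z x) ^ k) = Z x * (K (inverse c) ^ k * (K c * Z x) ^ k)"
      using power_commuting_commutes[of "K (inverse c)" "Z x" k] KlinD[OF Z(2)]
      by (simp only: mult.assoc[symmetric])
    finally show ?case by (simp only: Suc.IH power_Suc)
  qed simp
  then show "\<exists>k. Z x ^ k = 0" using k by (metis mult_zero_right)
qed

end

text \<open>\<open>e j\<close> and \<open>d j\<close> are coefficient and exponent of the monomial
  to which \<open>p_1j\<close> reduces at \<lambda> = 0; they govern the passage from
  \<open>Lm j\<close> to \<open>Lm (Suc j)\<close> by \<open>ad N1\<close>.\<close>

locale chain_rep = homog_rep_gen +
  fixes e :: "nat \<Rightarrow> complex" and d :: "nat \<Rightarrow> nat"
  assumes \<alpha>1_nz: "\<alpha> 1 \<noteq> 0" and L1_nz: "\<exists>v. A 1 v \<noteq> 0"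
    and e_nz: "e j \<noteq> 0" and \<alpha>_Suc: "\<alpha> (Suc j) = \<alpha> 1 + \<alpha> j - of_nat (d j)"
    and P_10: "P 1 j 0 y = e j * (- y) ^ d j"
    and P_1_lin: "\<alpha> 1 = 1 \<Longrightarrow> \<alpha> j = 1 \<Longrightarrow> d j = 1 \<Longrightarrow> P 1 j x y = e j * (x - y)"
begin

abbreviation N1 :: "'a endo" where "N1 \<equiv> X 1 0"

definition S :: "nat \<Rightarrow> nat" where "S j = (\<Sum>i<j. d i)"
definition Ee :: "nat \<Rightarrow> complex" where "Ee j = (\<Prod>i<j. e i)"

lemma Ee_nz: "Ee j \<noteq> 0"
  by (simp add: Ee_def e_nz)

lemma ad_N1_Lm: "ad N1 (Lm j y) = K (e j * (- y) ^ d j) * Lm (Suc j) y"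
  using ad_Lm[of 1 0 j y] by (simp only: P_10 Lm_0 add_0_left plus_1_eq_Suc)

lemma ad_N1_chain: "(ad N1 ^^ j) (Lm 0 y) = K (Ee j * (- y) ^ S j) * Lm j y"
proof (induction j)
  case (Suc j)
  have "(ad N1 ^^ Suc j) (Lm 0 y) = K (Ee j * (- y) ^ S j) * ad N1 (Lm j y)"
    by (simp only: funpow.simps comp_apply Suc.IH ad_mult_central[OF KlinD[OF Klin_X, symmetric]])
  also have "\<dots> = K (Ee (Suc j) * (- y) ^ S (Suc j)) * Lm (Suc j) y"
    by (simp only: ad_N1_Lm mult.assoc[symmetric] K_mult[symmetric])
       (simp add: Ee_def S_def power_add mult_ac)
  finally show ?case .
qed (simp add: Ee_def S_def)

lemma \<alpha>_formula: "\<alpha> j = of_nat j * \<alpha> 1 + 1 - of_nat (S j)"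
proof (induction j)
  case (Suc j)
  show ?case by (subst \<alpha>_Suc, subst Suc.IH) (simp add: S_def algebra_simps)
qed (simp add: \<alpha>_0 S_def)

lemma ad_L0_const: "ad (Lm 0 x) (X j 0) = K (\<alpha> j * x) * Lm j x"
  using ad_L0[of x j 0] by (simp add: Lm_0)

lemma A_eq_0_of_Lm:
  assumes "\<And>z. z \<noteq> 0 \<Longrightarrow> Lm i z = 0"
  shows "A i v = 0"
proof (rule A_eq_0I[of "- {0}"])
  fix z :: complex assume "z \<in> - {0}"
  then show "ev z (A i v) = 0" using assms[of z] Lm_eq_0_iff by simp
qed (simp add: infinite_UNIV_char_0)

lemma K_mult_eq_0: "K c * Y = 0 \<Longrightarrow> c \<noteq> 0 \<Longrightarrow> Y = 0"
proof (rule endo_eqI)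
  fix v assume "K c * Y = 0" "c \<noteq> 0"
  then have "sc [:c:] (app Y v) = 0" by (metis app_Sc app_ring(1,6))
  then show "app Y v = app 0 v" using \<open>c \<noteq> 0\<close> by simp
qed

lemma exists_nonzero: "\<exists>v :: 'a. v \<noteq> 0"
  using nontriv by (metis A_zero)

lemma N1_not_nilpotent: "N1 ^ m \<noteq> 0"
proof
  assume nil: "N1 ^ m = 0"
  have "A (2 * m) v = 0" for v
  proof (rule A_eq_0_of_Lm)
    fix z :: complex assume z: "z \<noteq> 0"
    have "K (Ee (2 * m) * (- z) ^ S (2 * m)) * Lm (2 * m) z = 0"
      unfolding ad_N1_chain[symmetric] by (rule ad_power_nilpotent_0[OF nil]) simp
    then show "Lm (2 * m) z = 0" by (rule K_mult_eq_0) (use z Ee_nz in simp)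
  qed
  define k where "k = (LEAST j. \<forall>v. A j v = 0)"
  have k: "\<forall>v. A k v = 0" unfolding k_def by (rule LeastI[of _ "2 * m"]) (use \<open>\<And>v. A (2 * m) v = 0\<close> in blast)
  have min: "\<exists>v. A j v \<noteq> 0" if "j < k" for j using not_less_Least[OF that[unfolded k_def]] by simp
  have "k \<noteq> 0" using k L0_nonzero by metis
  moreover have "k \<noteq> 1" using k L1_nz by metis
  ultimately obtain i where i: "k = Suc (Suc i)" by (metis One_nat_def not0_implies_Suc)
  have zero: "A j v = 0" if "j \<ge> k" for j v
    using that by (induction j arbitrary: v rule: dec_induct) (auto intro!: higher_zero k[rule_format])
  have "\<exists>v. v \<noteq> 0 \<and> (\<forall>x. app (Lm (Suc i) x) v = 0)"
  proof -
    obtain u :: 'a where u: "u \<noteq> 0" using exists_nonzero by blast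
    have L0: "Lm j x = 0" if "j \<ge> k" for j x
      using zero[OF that] by (simp add: Lm_eq_0_iff)
    show ?thesis
    proof (rule common_kernel_commutator[OF u _ _ _ nil])
      \<comment> \<open>The bracket has index 2(k - 1), which is at least \<open>k\<close> because
        \<open>k \<ge> 2\<close>.\<close>
      show "ad (Lm (Suc i) x) (Lm (Suc i) y) = 0" for x y
        unfolding ad_Lm by (subst L0) (auto simp: i)
      show "ad N1 (Lm (Suc i) x) = 0" for x
        unfolding ad_N1_Lm by (subst L0) (auto simp: i)
      show "\<exists>c T. c \<noteq> 0 \<and> ad N1 T = K c * Lm (Suc i) x" if "x \<noteq> 0" for x
        by (intro exI[of _ "e i * (- x) ^ d i"] exI[of _ "Lm i x"])
           (use that e_nz in \<open>simp only: ad_N1_Lm, simp\<close>)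
    qed auto
  qed
  then obtain v where v: "v \<noteq> 0" "\<And>x. ev x (A (Suc i) v) = 0" by auto
  \<comment> \<open>Stable because commuting \<open>Lm (Suc i)\<close> with \<open>Lm j\<close>
    yields index at least \<open>k\<close> for \<open>j \<ge> 1\<close>, where the action is zero,
    and \<open>Lm (Suc i)\<close> itself for \<open>j = 0\<close>.\<close>
  define W where "W = {v. \<forall>x. ev x (A (Suc i) v) = 0}"
  have "subspace W" by (rule subspaceI) (auto simp: W_def A_add A_scale)
  moreover have "ev x (A j w) \<in> W" if "w \<in> W" for x j w
  proof -
    have "ev y (A (Suc i) (ev x (A j w))) = 0" for y
    proof -
      have "ev y (A (Suc i) (ev x (A j w))) = sc [:P (Suc i) j y x:] (ev (y + x) (A (Suc i + j) w))"
        using A_comm[of y "Suc i" x j w] that by (simp add: W_def)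
      also have "ev (y + x) (A (Suc i + j) w) = 0"
        using that zero[of "Suc i + j" w] by (cases j) (auto simp: W_def i)
      finally show ?thesis by simp
    qed
    then show ?thesis by (simp add: W_def)
  qed
  moreover have "v \<in> W" using v by (simp add: W_def)
  ultimately have "W = UNIV" using stable_UNIV v by blast
  then have "A (Suc i) w = 0" for w
    by (intro A_eq_0I[of UNIV]) (auto simp: W_def infinite_UNIV_char_0)
  then show False using min[of "Suc i"] i by simp
qed

end

section \<open>Orders of vanishing of exponential sums\<close>

definition expsum :: "complex set \<Rightarrow> (complex \<Rightarrow> complex) \<Rightarrow> bool" where
  "expsum G f \<longleftrightarrow> finite G \<and> (\<exists>c. \<forall>u. f u = (\<Sum>g\<in>G. c g * exp (g * u)))"

lemma expsumI: "finite G \<Longrightarrow> (\<And>u. f u = (\<Sum>g\<in>G. c g * exp (g * u))) \<Longrightarrow> expsum G f"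
  by (auto simp: expsum_def)

lemma expsum_mono:
  assumes "expsum G f" "G \<subseteq> H" "finite H"
  shows "expsum H f"
proof -
  obtain c where c: "\<And>u. f u = (\<Sum>g\<in>G. c g * exp (g * u))" using assms by (auto simp: expsum_def)
  show ?thesis
  proof (rule expsumI[OF assms(3)])
    fix u
    have "(\<Sum>g\<in>G. c g * exp (g * u)) = (\<Sum>g\<in>H. (if g \<in> G then c g else 0) * exp (g * u))"
      using assms by (intro sum.mono_neutral_cong_left) auto
    then show "f u = (\<Sum>g\<in>H. (if g \<in> G then c g else 0) * exp (g * u))" by (simp add: c)
  qed
qed

lemma expsum_scale:
  assumes "expsum G f"
  shows "expsum G (\<lambda>u. a * f u)"
proof -
  obtain c where "finite G" "\<And>u. f u = (\<Sum>g\<in>G. c g * exp (g * u))"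
    using assms by (auto simp: expsum_def)
  then show ?thesis
    by (intro expsumI[of _ _ "\<lambda>g. a * c g"]) (simp_all add: sum_distrib_left mult.assoc)
qed

lemma expsum_add_same:
  assumes "expsum G f" "expsum G h"
  shows "expsum G (\<lambda>u. f u + h u)"
proof -
  obtain c c' where "finite G" "\<And>u. f u = (\<Sum>g\<in>G. c g * exp (g * u))"
      "\<And>u. h u = (\<Sum>g\<in>G. c' g * exp (g * u))"
    using assms by (auto simp: expsum_def)
  then show ?thesis
    by (intro expsumI[of _ _ "\<lambda>g. c g + c' g"]) (simp_all add: sum.distrib distrib_right)
qed

lemma expsum_add:
  assumes "expsum G f" "expsum H h"
  shows "expsum (G \<union> H) (\<lambda>u. f u + h u)"
proof (rule expsum_add_same)
  have "finite (G \<union> H)" using assms by (simp add: expsum_def)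
  then show "expsum (G \<union> H) f" "expsum (G \<union> H) h"
    by (rule expsum_mono[OF assms(1) Un_upper1] expsum_mono[OF assms(2) Un_upper2])+
qed

lemma expsum_sum:
  assumes "finite G" "\<And>i. i \<in> I \<Longrightarrow> expsum G (f i)"
  shows "expsum G (\<lambda>u. \<Sum>i\<in>I. f i u)"
  using assms(2)
proof (induction I rule: infinite_finite_induct)
  case (insert x F)
  then show ?case by (simp add: expsum_add_same)
qed (auto intro!: expsumI[OF assms(1), of _ "\<lambda>_. 0"])

lemma expsum_exp_mult:
  assumes "expsum G f"
  shows "expsum ((+) a ` G) (\<lambda>u. exp (a * u) * f u)"
proof -
  obtain c where c: "finite G" "\<And>u. f u = (\<Sum>g\<in>G. c g * exp (g * u))" using assms by (auto simp: expsum_def)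
  show ?thesis
    by (rule expsumI[of _ _ "\<lambda>g. c (g - a)"])
       (use c in \<open>auto simp: sum.reindex sum_distrib_left ring_distribs exp_add mult_ac\<close>)
qed

lemma expsum_poly: "expsum (of_nat ` {..degree q}) (\<lambda>u. poly q (exp u - 1))"
proof -
  define p where "p = pcompose q [:-1, 1:]"
  have deg: "degree p \<le> degree q" unfolding p_def by (rule order.trans[OF degree_pcompose_le]) simp
  have "poly q (exp u - 1) = poly p (exp u)" for u by (simp add: p_def poly_pcompose)
  also have "poly p (exp u) = (\<Sum>n\<le>degree q. coeff p n * exp (of_nat n * u))" for u
    unfolding poly_altdef exp_of_nat_mult
    by (rule sum.mono_neutral_left) (use deg in \<open>auto simp: coeff_eq_0\<close>)
  finally show ?thesis
    by (intro expsumI[of _ _ "\<lambda>g. coeff p (nat \<lfloor>Re g\<rfloor>)"]) (auto simp: sum.reindex)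
qed

text \<open>Pair the vanishing power sums with the polynomial of degree \<open>card G - 1\<close>
  whose roots are the other points of \<open>G\<close>.\<close>

lemma vandermonde_kernel:
  fixes c :: "complex \<Rightarrow> complex"
  assumes "finite G" "\<And>n. n < card G \<Longrightarrow> (\<Sum>g\<in>G. c g * g ^ n) = 0" "x \<in> G"
  shows "c x = 0"
proof -
  define q where "q = (\<Prod>y\<in>G - {x}. [:- y, 1:])"
  have "degree q = card (G - {x})" unfolding q_def
    by (subst degree_prod_eq_sum_degree) auto
  also have "\<dots> = card G - 1" using assms by simp
  finally have deg: "degree q < card G" using assms(1,3) by (metis card_gt_0_iff diff_less empty_iff zero_less_one)
  have "(\<Sum>g\<in>G. c g * poly q g) = (\<Sum>n\<le>degree q. coeff q n * (\<Sum>g\<in>G. c g * g ^ n))"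
    unfolding poly_altdef sum_distrib_left by (subst sum.swap) (simp add: mult_ac)
  also have "\<dots> = 0" using assms(2) deg by (intro sum.neutral) auto
  also have "(\<Sum>g\<in>G. c g * poly q g) = (\<Sum>g\<in>{x}. c g * poly q g)"
    using assms(1,3) by (intro sum.mono_neutral_right) (auto simp: q_def poly_prod)
  finally have "c x * poly q x = 0" by simp
  moreover have "poly q x \<noteq> 0" using assms(1) by (auto simp: q_def poly_prod)
  ultimately show ?thesis by simp
qed

text \<open>The expansion must be nonzero, so having an order at a point includes not being
  identically zero near it.\<close>

definition has_order :: "(complex \<Rightarrow> complex) \<Rightarrow> complex \<Rightarrow> nat \<Rightarrow> bool" where
  "has_order f x n \<longleftrightarrow> (\<exists>F. (\<lambda>t. f (x + t)) has_fps_expansion F \<and> F \<noteq> 0 \<and> subdegree F = n)"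

lemma has_order_unique: "has_order f x n \<Longrightarrow> has_order f x m \<Longrightarrow> n = m"
  unfolding has_order_def using fps_expansion_unique_complex by blast

lemma has_order_mult:
  assumes "has_order f x n" "has_order g x m"
  shows "has_order (\<lambda>u. f u * g u) x (n + m)"
proof -
  obtain F G where F: "(\<lambda>t. f (x + t)) has_fps_expansion F" "F \<noteq> 0" "subdegree F = n"
    and G: "(\<lambda>t. g (x + t)) has_fps_expansion G" "G \<noteq> 0" "subdegree G = m"
    using assms unfolding has_order_def by blast
  show ?thesis unfolding has_order_def
    by (rule exI[of _ "F * G"]) (use F G in \<open>auto intro: has_fps_expansion_mult\<close>)
qed

lemma has_order_const: "a \<noteq> 0 \<Longrightarrow> has_order (\<lambda>_. a) x 0"
  unfolding has_order_def by (intro exI[of _ "fps_const a"]) auto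

lemma has_order_power: "has_order f x n \<Longrightarrow> has_order (\<lambda>u. f u ^ k) x (k * n)"
proof (induction k)
  case 0
  then show ?case using has_order_const[of 1] by simp
next
  case (Suc k)
  then show ?case using has_order_mult[of f x n "\<lambda>u. f u ^ k" "k * n"] by simp
qed

lemma has_order_one_minus_exp:
  assumes "a \<noteq> 0"
  shows "has_order (\<lambda>u. 1 - exp (a * u)) x (if exp (a * x) = 1 then 1 else 0)"
proof -
  define F where "F = 1 - fps_const (exp (a * x)) * fps_exp a"
  have "(\<lambda>t. 1 - exp (a * x) * exp (a * t)) has_fps_expansion F"
    unfolding F_def by (intro fps_expansion_intros)
  then have exp: "(\<lambda>t. 1 - exp (a * (x + t))) has_fps_expansion F"
    by (simp add: exp_add distrib_left)
  show ?thesis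
  proof (cases "exp (a * x) = 1")
    case True
    have "fps_nth F 0 = 0" "fps_nth F 1 \<noteq> 0" using True assms by (simp_all add: F_def)
    then have "subdegree F = 1" "F \<noteq> 0" by (auto intro!: subdegreeI)
    then show ?thesis using exp True unfolding has_order_def by auto
  next
    case False
    then have "fps_nth F 0 \<noteq> 0" by (simp add: F_def)
    then have "subdegree F = 0" "F \<noteq> 0" by auto
    then show ?thesis using exp False unfolding has_order_def by auto
  qed
qed

text \<open>The n-th Taylor coefficient at \<open>x\<close> is 1/n! times the sum of
  \<open>c g * exp (g * x) * g ^ n\<close>. If the first \<open>card G\<close> of them vanished, the
  Vandermonde system would kill all coefficients.\<close>

lemma expsum_has_order:
  assumes "expsum G f" "f u0 \<noteq> 0"
  shows "\<exists>n<card G. has_order f x n"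
proof -
  obtain c where c: "finite G" "\<And>u. f u = (\<Sum>g\<in>G. c g * exp (g * u))" using assms by (auto simp: expsum_def)
  define F where "F = (\<Sum>g\<in>G. fps_const (c g * exp (g * x)) * fps_exp g)"
  have "(\<lambda>t. \<Sum>g\<in>G. (c g * exp (g * x)) * exp (g * t)) has_fps_expansion F"
    unfolding F_def by (intro fps_expansion_intros)
  then have exp: "(\<lambda>t. f (x + t)) has_fps_expansion F"
    by (simp add: c(2) exp_add distrib_left mult_ac)
  have "\<exists>n<card G. fps_nth F n \<noteq> 0"
  proof (rule ccontr)
    assume "\<not> ?thesis"
    then have "(\<Sum>g\<in>G. (c g * exp (g * x)) * g ^ n) = 0" if "n < card G" for n
      using that by (auto simp: F_def fps_sum_nth sum_divide_distrib[symmetric])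
    then have "c g * exp (g * x) = 0" if "g \<in> G" for g
      using vandermonde_kernel[OF c(1), of "\<lambda>g. c g * exp (g * x)"] that by blast
    then have "f u0 = 0" by (simp add: c(2))
    then show False using assms(2) by simp
  qed
  then obtain n where n: "n < card G" "fps_nth F n \<noteq> 0" by blast
  then have "F \<noteq> 0" "subdegree F \<le> n" by (auto intro: subdegree_leI)
  then show ?thesis using exp n(1) unfolding has_order_def by (intro exI[of _ "subdegree F"]) auto
qed

section \<open>The fibre at \<open>\<partial> = 1\<close> and its grading\<close>

context homog_rep
begin

lemma endo_eq_on_wsp:
  assumes "\<And>w v. v \<in> wsp w \<Longrightarrow> app S v = app T v"
  shows "S = T"
proof (rule endo_eqI)
  fix v
  have "app S (\<Sum>w | wcomp v w \<noteq> 0. wcomp v w) = app T (\<Sum>w | wcomp v w \<noteq> 0. wcomp v w)"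
    unfolding app_sum_right by (rule sum.cong[OF refl], rule assms, rule comp_wsp)
  then show "app S v = app T v" by (simp only: comp_sum)
qed

text \<open>The grading operator is \<open>e\<^bsup>-uE\<^esup>\<close>.\<close>

definition gr :: "complex \<Rightarrow> 'v endo" where
  "gr u = Endo (\<lambda>v. \<Sum>w | wcomp v w \<noteq> 0. sc [:exp (- (w * u)):] (wcomp v w))"

lemma app_gr_over:
  assumes "finite W" "{w. wcomp v w \<noteq> 0} \<subseteq> W"
  shows "app (gr u) v = (\<Sum>w\<in>W. sc [:exp (- (w * u)):] (wcomp v w))"
proof -
  define f where "f v = (\<Sum>w | wcomp v w \<noteq> 0. sc [:exp (- (w * u)):] (wcomp v w))" for v
  have f: "f v = (\<Sum>w\<in>W. sc [:exp (- (w * u)):] (wcomp v w))"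
    if "finite W" "{w. wcomp v w \<noteq> 0} \<subseteq> W" for v W
    unfolding f_def by (rule sum.mono_neutral_left) (use that in auto)
  have "f (x + y) = f x + f y" for x y
  proof -
    define W where "W = {w. wcomp x w \<noteq> 0} \<union> {w. wcomp y w \<noteq> 0}"
    have "finite W" by (simp add: W_def comp_finite)
    moreover have "{w. wcomp x w \<noteq> 0} \<subseteq> W" "{w. wcomp y w \<noteq> 0} \<subseteq> W" "{w. wcomp (x + y) w \<noteq> 0} \<subseteq> W"
      by (auto simp: W_def comp_add)
    ultimately show ?thesis by (simp add: f[of W] comp_add scale_right_distrib sum.distrib)
  qed
  then have "app (gr u) v = f v" unfolding gr_def f_def[symmetric] by (simp add: Endo_inverse)
  then show ?thesis using f[OF assms] by simp
qed

lemma app_gr: "app (gr u) v = (\<Sum>w | wcomp v w \<noteq> 0. sc [:exp (- (w * u)):] (wcomp v w))"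
  by (rule app_gr_over) (auto simp: comp_finite)

lemma gr_wsp: "v \<in> wsp w \<Longrightarrow> app (gr u) v = sc [:exp (- (w * u)):] v"
  by (subst app_gr_over[of "{w}"]) (auto simp: comp_single split: if_splits)

lemma Klin_gr [simp, intro]: "Klin (gr u)"
  unfolding Klin_def
proof
  fix z show "gr u * K z = K z * gr u"
    by (rule endo_eq_on_wsp)
       (simp add: gr_wsp[OF C.subspace_scale[OF wsp_subspace]] gr_wsp mult.commute)
qed

lemma gr_0: "gr 0 = 1"
  by (rule endo_eq_on_wsp) (simp add: gr_wsp flip: one_pCons)

lemma gr_X: "X i 0 * gr u = K (exp (\<alpha> i * u)) * (gr u * X i 0)"
proof (rule endo_eq_on_wsp)
  fix w v assume v: "v \<in> wsp w"
  have "coeff (A i v) 0 \<in> wsp (w + \<alpha> i)" using X_wsp[OF v, of i 0] by simp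
  from gr_wsp[OF this] have "app (K (exp (\<alpha> i * u)) * (gr u * X i 0)) v
      = sc [:exp (\<alpha> i * u) * exp (- ((w + \<alpha> i) * u)):] (coeff (A i v) 0)"
    by (simp only: app_ring app_Sc app_X sc_const_const)
  also have "exp (\<alpha> i * u) * exp (- ((w + \<alpha> i) * u)) = exp (- (w * u))"
    by (simp add: algebra_simps flip: exp_add)
  also have "sc [:exp (- (w * u)):] (coeff (A i v) 0) = app (X i 0 * gr u) v"
    by (simp add: gr_wsp[OF v] A_const coeff_map_poly)
  finally show "app (X i 0 * gr u) v = app (K (exp (\<alpha> i * u)) * (gr u * X i 0)) v" by simp
qed

lemma gr_Del: "app (gr u) (sc [:0, 1:] v) = sc [:exp (- u):] (sc [:0, 1:] (app (gr u) v))"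
proof -
  have "gr u * Del = K (exp (- u)) * (Del * gr u)"
  proof (rule endo_eq_on_wsp)
    fix w v assume v: "v \<in> wsp w"
    have "app (gr u * Del) v = sc [:exp (- ((w + 1) * u)):] (sc [:0, 1:] v)"
      using gr_wsp[OF Del_wsp[OF v]] by simp
    also have "exp (- ((w + 1) * u)) = exp (- u) * exp (- (w * u))"
      by (simp add: algebra_simps flip: exp_add)
    finally show "app (gr u * Del) v = app (K (exp (- u)) * (Del * gr u)) v"
      by (simp add: gr_wsp[OF v] mult_ac)
  qed
  from arg_cong[OF this, of "\<lambda>f. app f v"] show ?thesis by (simp only: app_ring app_Sc)
qed

text \<open>The image of \<partial> - 1. The fibre at \<partial> = 1 is the quotient by it,
  represented here by congruence modulo \<open>DD\<close> and by linear forms vanishing on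
  \<open>DD\<close>.\<close>

definition DD :: "'v set" where "DD = range (\<lambda>v. sc [:0, 1:] v - v)"

lemma DD_subspace: "subspace DD"
proof (rule subspaceI)
  show "0 \<in> DD" unfolding DD_def by (rule range_eqI[of _ _ 0]) simp
  fix x y c assume "x \<in> DD" "y \<in> DD"
  then obtain v w where "x = sc [:0, 1:] v - v" "y = sc [:0, 1:] w - w" by (auto simp: DD_def)
  then show "x + y \<in> DD" unfolding DD_def
    by (intro range_eqI[of _ _ "v + w"]) (simp add: scale_right_distrib)
next
  fix x c assume "x \<in> DD"
  then obtain v where "x = sc [:0, 1:] v - v" by (auto simp: DD_def)
  then show "sc c x \<in> DD" unfolding DD_def
    by (intro range_eqI[of _ _ "sc c v"]) (simp add: scale_right_diff_distrib mult.commute)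
qed

lemma DD_eval: "sc q v - sc [:poly q 1:] v \<in> DD"
proof -
  have "poly (q - [:poly q 1:]) 1 = 0" by simp
  then obtain r where "q - [:poly q 1:] = [:- 1, 1:] * r" unfolding poly_eq_0_iff_dvd by (auto elim: dvdE)
  then have "sc q v - sc [:poly q 1:] v = sc ([:- 1, 1:] * r) v" by (metis scale_left_diff_distrib)
  also have "[:- 1, 1:] * r = [:0, 1:] * r - r" by simp
  also have "sc ([:0, 1:] * r - r) v = sc [:0, 1:] (sc r v) - sc r v"
    by (simp only: scale_left_diff_distrib scale_scale)
  finally have e: "sc q v - sc [:poly q 1:] v = sc [:0, 1:] (sc r v) - sc r v" .
  show ?thesis unfolding e DD_def by (rule rangeI)
qed

text \<open>If \<open>y\<close> is \<partial>x - x with \<open>x \<noteq> 0\<close>, both the lowest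
  component of \<open>x\<close> and \<partial> times its highest component survive in
  \<open>y\<close>, in weights that differ; so a homogeneous vector is detected in the
  fibre.\<close>

lemma DD_homogeneous:
  assumes y: "y \<in> wsp w0" "y \<in> DD"
  shows "y = 0"
proof -
  obtain x where x: "y = sc [:0, 1:] x - x" using y(2) by (auto simp: DD_def)
  have c: "wcomp y w = sc [:0, 1:] (wcomp x (w - 1)) - wcomp x w" for w
  proof -
    have "wcomp (y + x) w = wcomp y w + wcomp x w" by (rule comp_add)
    then show ?thesis using comp_Del[of x w] by (simp add: x)
  qed
  define W where "W = {w. wcomp x w \<noteq> 0}"
  have finW: "finite W" by (simp add: W_def comp_finite)
  show ?thesis
  proof (cases "W = {}")
    case True
    then have "x = 0" using comp_sum[of x] by (simp add: W_def)
    then show ?thesis by (simp add: x)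
  next
    case False
    have *: "w = w0" if "wcomp y w \<noteq> 0" for w using comp_single[OF y(1), of w] that by (simp split: if_splits)
    have "Min (Re ` W) \<in> Re ` W" "Max (Re ` W) \<in> Re ` W" using False finW by auto
    then obtain w1 w2 where w: "w1 \<in> W" "Re w1 = Min (Re ` W)" "w2 \<in> W" "Re w2 = Max (Re ` W)"
      by auto
    have lo: "Re w1 \<le> Re w" "Re w \<le> Re w2" if "w \<in> W" for w using that w finW by simp_all
    have "wcomp x (w1 - 1) = 0" using lo(1)[of "w1 - 1"] by (auto simp: W_def)
    then have "w1 = w0" using w(1) by (intro *) (simp add: c W_def)
    moreover have "wcomp x (w2 + 1) = 0" using lo(2)[of "w2 + 1"] by (auto simp: W_def)
    then have "w2 + 1 = w0" using w(3) by (intro *) (simp add: c W_def torsion_free)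
    ultimately show ?thesis using lo(1)[OF w(3)] by auto
  qed
qed

end

context homog_rep_gen
begin

text \<open>A factor \<partial> - 1 common to all coefficients may be cancelled since the module is
  torsion free. The relation then survives specialisation to \<partial> = 1.\<close>

lemma relation_nonzero_at_1:
  assumes "\<exists>i\<in>I. p i \<noteq> 0" "(\<Sum>i\<in>I. sc (p i) (u i)) = 0" "finite I"
  shows "\<exists>p. (\<exists>i\<in>I. poly (p i) 1 \<noteq> 0) \<and> (\<Sum>i\<in>I. sc (p i) (u i)) = 0"
  using assms(1,2)
proof (induction "\<Sum>i\<in>I. degree (p i)" arbitrary: p rule: less_induct)
  case less
  show ?case
  proof (cases "\<exists>i\<in>I. poly (p i) 1 \<noteq> 0")
    case True
    then show ?thesis using less.prems by blast
  next
    case False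
    then have "\<forall>i\<in>I. poly (p i) 1 = 0" by blast
    then have "\<forall>i\<in>I. \<exists>r. p i = [:- 1, 1:] * r" by (simp only: poly_eq_0_iff_dvd dvd_def)
    then obtain r where r: "\<And>i. i \<in> I \<Longrightarrow> p i = [:- 1, 1:] * r i" by metis
    have "sc [:- 1, 1:] (\<Sum>i\<in>I. sc (r i) (u i)) = (\<Sum>i\<in>I. sc (p i) (u i))"
      by (simp add: scale_sum_right r del: mult_pCons_left)
    then have 0: "(\<Sum>i\<in>I. sc (r i) (u i)) = 0" using less.prems(2) by (simp add: torsion_free)
    obtain i where i: "i \<in> I" "p i \<noteq> 0" using less.prems(1) by blast
    have deg: "degree (p j) = Suc (degree (r j))" if "j \<in> I" "r j \<noteq> 0" for j
      using that by (simp add: r[OF that(1)] degree_mult_eq del: mult_pCons_left)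
    have "degree (r j) \<le> degree (p j)" if "j \<in> I" for j
      using deg[OF that] by (cases "r j = 0") (auto simp del: mult_pCons_left)
    moreover have "r i \<noteq> 0" using i(2) r[OF i(1)] by (intro notI) simp
    then have "degree (r i) < degree (p i)" using deg[OF i(1)] by simp
    ultimately have "(\<Sum>i\<in>I. degree (r i)) < (\<Sum>i\<in>I. degree (p i))"
      using assms(3) i(1) by (intro sum_strict_mono_ex1) auto
    then show ?thesis using less.hyps[of r] 0 i(1) \<open>r i \<noteq> 0\<close> by blast
  qed
qed

text \<open>Each generator has its own annihilating polynomial modulo \<open>DD\<close>, from a
  relation between the powers of \<open>M\<close> specialised at \<partial> = 1; the product over
  the generators works for all vectors.\<close>

lemma fibre_annihilator:
  assumes M: "Klin M" "M * Del = Del * M"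
  shows "\<exists>Q. Q \<noteq> 0 \<and> (\<forall>v. app (PE Q M) v \<in> DD)"
proof -
  have MSc: "M * Sc p = Sc p * M" for p
  proof (induction p)
    case (pCons a p)
    have "Sc (pCons a p) = K a + Del * Sc p" by (simp flip: Sc_ring)
    moreover have "M * (Del * Sc p) = Del * Sc p * M"
      by (metis M(2) mult.assoc pCons.IH)
    ultimately show ?case by (simp only: distrib_left distrib_right KlinD[OF M(1)])
  qed simp
  have PSc: "app (PE Q M) (sc p v) = sc p (app (PE Q M) v)" for Q p v
    using arg_cong[OF PE_commute[OF MSc[of p]], of "\<lambda>f. app f v" Q] by simp
  have PDD: "app (PE Q M) v \<in> DD" if v: "v \<in> DD" for Q v
  proof -
    obtain x where x: "v = sc [:0, 1:] x - x" using v by (auto simp: DD_def)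
    show ?thesis unfolding x app_diff_right PSc DD_def by (rule rangeI)
  qed
  have "\<exists>Q. Q \<noteq> 0 \<and> app (PE Q M) v \<in> DD" for v
  proof -
    obtain p where "\<exists>k\<in>{..card B}. p k \<noteq> 0" "(\<Sum>k\<le>card B. sc (p k) (app (M ^ k) v)) = 0"
      using module_dependent_family[OF module_axioms B_fin, of "{..card B}" "\<lambda>k. app (M ^ k) v"]
        B_span by auto
    from relation_nonzero_at_1[OF this] obtain p k0 where
      p: "k0 \<le> card B" "poly (p k0) 1 \<noteq> 0" "(\<Sum>k\<le>card B. sc (p k) (app (M ^ k) v)) = 0" by auto
    define Q where "Q = (\<Sum>k\<le>card B. monom (poly (p k) 1) k)"
    have "coeff Q k0 = poly (p k0) 1" using p(1) by (simp add: Q_def coeff_sum)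
    then have "Q \<noteq> 0" using p by auto
    have "app (PE Q M) v = (\<Sum>k\<le>card B. sc [:poly (p k) 1:] (app (M ^ k) v))"
      by (simp add: Q_def PE_sum PE_monom M(1) app_sum_left)
    also have "\<dots> = - (\<Sum>k\<le>card B. sc (p k) (app (M ^ k) v) - sc [:poly (p k) 1:] (app (M ^ k) v))"
      by (simp only: sum_subtractf p(3)) simp
    also have "\<dots> \<in> DD" by (intro subspace_neg[OF DD_subspace] subspace_sum[OF DD_subspace] DD_eval)
    finally show ?thesis using \<open>Q \<noteq> 0\<close> by blast
  qed
  then obtain Q where Q: "\<And>v. Q v \<noteq> 0" "\<And>v. app (PE (Q v) M) v \<in> DD" by metis
  define R where "R = (\<Prod>v\<in>B. Q v)"
  have "R \<noteq> 0" using B_fin Q(1) by (simp add: R_def)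
  have RB: "app (PE R M) v \<in> DD" if "v \<in> B" for v
  proof -
    have "R = (\<Prod>v\<in>B - {v}. Q v) * Q v" using B_fin that by (simp add: R_def prod.remove)
    then show ?thesis by (simp add: PE_mult[OF M(1)] PDD Q(2))
  qed
  have "app (PE R M) v \<in> DD" for v
  proof -
    have "v \<in> span B" using B_span by simp
    then show ?thesis
      by (induction rule: span_induct_alt)
         (auto simp: PSc intro: subspace_add[OF DD_subspace] subspace_scale[OF DD_subspace] RB
           subspace_0[OF DD_subspace])
  qed
  then show ?thesis using \<open>R \<noteq> 0\<close> by blast
qed

end

lemma only_root_zero:
  fixes Q :: "complex poly"
  assumes "Q \<noteq> 0" "\<And>z. poly Q z = 0 \<Longrightarrow> z = 0"
  shows "\<exists>a n. a \<noteq> 0 \<and> Q = monom a n"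
  using assms
proof (induction "degree Q" arbitrary: Q rule: less_induct)
  case less
  show ?case
  proof (cases "degree Q = 0")
    case True
    then obtain a where "Q = [:a:]" by (metis degree_eq_zeroE)
    then show ?thesis using less.prems(1) by (intro exI[of _ a] exI[of _ 0]) (auto simp: monom_0)
  next
    case False
    then obtain z where "poly Q z = 0"
      using fundamental_theorem_of_algebra[of Q] by (auto simp: constant_degree)
    then have "poly Q 0 = 0" using less.prems(2) by metis
    then obtain R where R: "Q = pCons 0 R" by (cases Q) auto
    then have "R \<noteq> 0" using less.prems(1) by auto
    moreover have "degree R < degree Q" using R \<open>R \<noteq> 0\<close> by simp
    moreover have "z = 0" if "poly R z = 0" for z using less.prems(2)[of z] that R by simp
    ultimately obtain a n where "a \<noteq> 0" "R = monom a n" using less.hyps by blast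
    then show ?thesis using R by (intro exI[of _ a] exI[of _ "Suc n"]) (auto simp: monom_Suc)
  qed
qed

section \<open>The weight of the second generator\<close>

context chain_rep
begin

lemma N1_Del: "N1 * Del = Del * N1"
  by (rule X_Del)

text \<open>Take \<open>Q\<close> of least degree annihilating \<open>N1\<close> on the fibre. If 0
  were its only root, a power of \<open>N1\<close> would send weight vectors to weight vectors in
  \<open>DD\<close>, that is to 0. For a nonzero root \<open>c\<close>, minimality prevents
  \<open>N1 - K c\<close> from being onto the fibre, and a form vanishing on its image is a left
  eigenvector.\<close>

lemma fibre_form:
  obtains l c Q where "linear_form l" "\<And>v. l (sc [:0, 1:] v) = l v" "\<And>v. l (app N1 v) = c * l v"
    "c \<noteq> 0" "\<And>v. v \<in> DD \<Longrightarrow> l v = 0" "\<And>v. app (PE Q N1) v \<in> DD" "Q \<noteq> 0" "l \<noteq> (\<lambda>_. 0)"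
proof -
  have KN: "Klin N1" by simp
  define good where "good Q \<longleftrightarrow> Q \<noteq> 0 \<and> (\<forall>v. app (PE Q N1) v \<in> DD)" for Q
  obtain Q0 where "good Q0" using fibre_annihilator[OF KN N1_Del] by (auto simp: good_def)
  then have "\<exists>Q. good Q \<and> (\<forall>R. good R \<longrightarrow> degree Q \<le> degree R)"
    by (metis (full_types) ex_has_least_nat)
  then obtain Q where Q: "good Q" and least: "\<And>R. good R \<Longrightarrow> degree Q \<le> degree R" by blast
  have "\<exists>c. poly Q c = 0 \<and> c \<noteq> 0"
  proof (rule ccontr)
    assume "\<not> ?thesis"
    then obtain a n where a: "a \<noteq> 0" "Q = monom a n"
      using only_root_zero[of Q] Q by (auto simp: good_def)
    have *: "app (N1 ^ n) v \<in> wsp (w + of_nat n * \<alpha> 1)" if "v \<in> wsp w" for v w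
    proof (induction n)
      case (Suc n)
      show ?case using X_wsp[OF Suc.IH, of 1 0] by (simp add: algebra_simps)
    qed (simp add: that)
    have "N1 ^ n = 0"
    proof (rule endo_eq_on_wsp)
      fix w v assume v: "v \<in> wsp w"
      have "sc [:a:] (app (N1 ^ n) v) \<in> DD"
        using Q unfolding good_def a(2) PE_monom[OF KN] by (metis app_Sc app_ring(6))
      moreover have "sc [:a:] (app (N1 ^ n) v) \<in> wsp (w + of_nat n * \<alpha> 1)"
        using *[OF v] C.subspace_scale[OF wsp_subspace] by blast
      ultimately have "sc [:a:] (app (N1 ^ n) v) = 0" using DD_homogeneous by blast
      then show "app (N1 ^ n) v = app 0 v" using a(1) by simp
    qed
    then show False using N1_not_nilpotent by blast
  qed
  then obtain c where c: "poly Q c = 0" "c \<noteq> 0" by blast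
  obtain R where R: "Q = R * [:- c, 1:]"
    using c(1) by (auto simp: poly_eq_0_iff_dvd mult.commute elim: dvdE)
  have "R \<noteq> 0" using Q R by (auto simp: good_def)
  have "degree R < degree Q" using \<open>R \<noteq> 0\<close> unfolding R by (subst degree_mult_eq) auto
  then have "\<not> good R" using least by fastforce
  \<comment> \<open>The preimage in the module of the image of \<open>N1 - K c\<close> on the
    fibre.\<close>
  define T where "T = {app (N1 - K c) v + t | v t. t \<in> DD}"
  have "C.subspace T"
  proof (rule C.subspaceI)
    show "0 \<in> T" unfolding T_def
      by (intro CollectI exI[of _ 0]) (simp add: subspace_0[OF DD_subspace])
    fix x y assume "x \<in> T" "y \<in> T"
    then obtain v t v' t' where "x = app (N1 - K c) v + t" "t \<in> DD" "y = app (N1 - K c) v' + t'" "t' \<in> DD"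
      by (auto simp: T_def)
    then show "x + y \<in> T" unfolding T_def
      by (intro CollectI exI[of _ "v + v'"] exI[of _ "t + t'"])
         (auto simp only: app_add_right intro: subspace_add[OF DD_subspace] simp: add_ac)
  next
    fix z x assume "x \<in> T"
    then obtain v t where "x = app (N1 - K c) v + t" "t \<in> DD" by (auto simp: T_def)
    moreover have "app (N1 - K c) (sc [:z:] v) = sc [:z:] (app (N1 - K c) v)"
      by (rule Klin_app) simp
    ultimately show "sc [:z:] x \<in> T" unfolding T_def
      by (intro CollectI exI[of _ "sc [:z:] v"] exI[of _ "sc [:z:] t"])
         (auto simp only: scale_right_distrib intro: subspace_scale[OF DD_subspace])
  qed
  have PDD: "app (PE R N1) t \<in> DD" if t: "t \<in> DD" for t
  proof -
    obtain x where x: "t = sc [:0, 1:] x - x" using t by (auto simp: DD_def)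
    have e: "app (PE R N1) (sc [:0, 1:] x) = sc [:0, 1:] (app (PE R N1) x)"
      using arg_cong[OF PE_commute[OF N1_Del], of "\<lambda>f. app f x" R] by simp
    show ?thesis unfolding x app_diff_right e DD_def by (rule rangeI)
  qed
  have "T \<noteq> UNIV"
  proof
    assume "T = UNIV"
    have "app (PE R N1) x \<in> DD" for x
    proof -
      have "x \<in> T" using \<open>T = UNIV\<close> by simp
      then obtain v t where x: "x = app (N1 - K c) v + t" "t \<in> DD" by (auto simp: T_def)
      have "PE R N1 * (N1 - K c) = PE Q N1"
        unfolding R PE_mult[OF KN] by (simp add: K_minus)
      then have "app (PE R N1) (app (N1 - K c) v) = app (PE Q N1) v" by (metis app_ring(6))
      then show ?thesis unfolding x app_add_right
        using Q PDD[OF x(2)] by (auto simp: good_def intro: subspace_add[OF DD_subspace])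
    qed
    then show False using \<open>\<not> good R\<close> \<open>R \<noteq> 0\<close> by (simp add: good_def)
  qed
  then obtain x where "x \<notin> T" by blast
  from separating_linear_form[OF \<open>C.subspace T\<close> this] obtain l
    where l: "linear_form l" "\<And>y. y \<in> T \<Longrightarrow> l y = 0" "l x = 1" by metis
  have DT: "v \<in> T" if "v \<in> DD" for v unfolding T_def
    by (intro CollectI exI[of _ 0] exI[of _ v]) (simp add: that)
  have NT: "app (N1 - K c) v \<in> T" for v unfolding T_def
    by (intro CollectI exI[of _ v] exI[of _ 0]) (simp add: subspace_0[OF DD_subspace])
  show thesis
  proof (rule that[OF l(1) _ _ c(2)])
    show "l v = 0" if "v \<in> DD" for v using l(2) DT that by blast
    show "l (sc [:0, 1:] v) = l v" for v
    proof -
      have "sc [:0, 1:] v - v \<in> DD" by (auto simp: DD_def)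
      then show ?thesis using l(2)[OF DT] linear_form_simps(3)[OF l(1)] by (metis eq_iff_diff_eq_0)
    qed
    show "l (app N1 v) = c * l v" for v
      using l(2)[OF NT, of v] by (simp add: linear_form_simps[OF l(1)])
    show "app (PE Q N1) v \<in> DD" for v using Q by (simp add: good_def)
    show "Q \<noteq> 0" using Q by (simp add: good_def)
    show "l \<noteq> (\<lambda>_. 0)" using l(3) by auto
  qed
qed

text \<open>The frequencies come from the weights of \<open>v\<close> and the degrees in \<lambda>,
  and do not depend on \<open>l\<close>. This order of quantifiers matters: later the form varies
  with \<open>j\<close> while the number of frequencies must stay bounded.\<close>

lemma chain_expsum:
  "\<exists>G. \<forall>l. linear_form l \<longrightarrow> expsum G (\<lambda>u. l (ev (exp u - 1) (A i (app (gr u) v))))"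
proof -
  define W where "W = {w. wcomp v w \<noteq> 0}"
  define G where "G = (\<Union>w\<in>W. (+) (- w) ` of_nat ` {..degree (A i (wcomp v w))})"
  have fin: "finite G" by (simp add: G_def W_def comp_finite)
  have "expsum G (\<lambda>u. l (ev (exp u - 1) (A i (app (gr u) v))))" if l: "linear_form l" for l
  proof -
    have "ev z (A i (app (gr u) v)) = app (Lm i z) (app (gr u) v)" for z u by simp
    also have "app (Lm i z) (app (gr u) v)
        = (\<Sum>w\<in>W. sc [:exp (- (w * u)):] (ev z (A i (wcomp v w))))" for z u
      by (simp only: app_gr W_def app_sum_right) (simp add: A_scale)
    finally have "l (ev z (A i (app (gr u) v)))
        = (\<Sum>w\<in>W. exp (- w * u) * poly (map_poly l (A i (wcomp v w))) z)" for z u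
      by (simp add: linear_form_sum[OF l] linear_form_simps[OF l] linear_form_ev[OF l])
    moreover have "expsum G (\<lambda>u. \<Sum>w\<in>W. exp (- w * u) * poly (map_poly l (A i (wcomp v w))) (exp u - 1))"
    proof (rule expsum_sum[OF fin])
      fix w assume w: "w \<in> W"
      have "expsum ((+) (- w) ` of_nat ` {..degree (map_poly l (A i (wcomp v w)))})
          (\<lambda>u. exp (- w * u) * poly (map_poly l (A i (wcomp v w))) (exp u - 1))"
        by (rule expsum_exp_mult[OF expsum_poly])
      then show "expsum G (\<lambda>u. exp (- w * u) * poly (map_poly l (A i (wcomp v w))) (exp u - 1))"
      proof (rule expsum_mono[OF _ _ fin])
        have "{..degree (map_poly l (A i (wcomp v w)))} \<subseteq> {..degree (A i (wcomp v w))}"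
          by (simp add: map_poly_degree_leq)
        then show "(+) (- w) ` of_nat ` {..degree (map_poly l (A i (wcomp v w)))} \<subseteq> G"
          unfolding G_def by (intro order.trans[OF _ UN_upper[OF w]] image_mono)
      qed
    qed
    ultimately show ?thesis by simp
  qed
  then show ?thesis by blast
qed

text \<open>
  Evaluating \<open>(ad N\<^sub>1)\<^sup>j L\<^sub>0\<close> on a left eigenvector \<open>l\<close> of \<open>N\<^sub>1\<close> in the fibre and on a suitable vector of
  the same generalised eigenspace gives \<open>c\<^sup>j (1 - e\<^bsup>\<alpha>u\<^esup>)\<^sup>j \<phi>(u)\<close>, where \<open>1 + \<lambda> = e\<^sup>u\<close>.
\<close>

lemma chain_functions:
  obtains c k \<phi> f b where
    "c \<noteq> 0" "\<And>x. \<exists>n. has_order \<phi> x n"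
    "\<And>j. \<exists>G. expsum G (f j)" "\<And>j. \<exists>G. expsum G (b j) \<and> card G \<le> k"
    "\<And>j. (\<exists>v. A j v \<noteq> 0) \<or> (\<forall>u. f j u = 0)"
    "\<And>j u. c ^ j * (1 - exp (\<alpha> 1 * u)) ^ j * \<phi> u = Ee j * (1 - exp u) ^ S j * f j u"
    "\<And>j u. \<alpha> j * (exp u - 1) * f j u = b j u" "\<exists>u. \<phi> u \<noteq> 0"
proof -
  obtain l c Q where l: "linear_form l" and lD: "\<And>v. l (sc [:0, 1:] v) = l v"
    and lN: "\<And>v. l (app N1 v) = c * l v" and c: "c \<noteq> 0" and lDD: "\<And>v. v \<in> DD \<Longrightarrow> l v = 0"
    and Q: "\<And>v. app (PE Q N1) v \<in> DD" "Q \<noteq> 0" and l_nz: "l \<noteq> (\<lambda>_. 0)"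
    by (rule fibre_form, rule that)
  note ls = linear_form_simps[OF l] linear_form_sum[OF l]
  define h where "h v u = l (ev (exp u - 1) (A 0 (app (gr u) v)))" for v u
  have h_add: "h (v + w) u = h v u + h w u" for v w u by (simp add: h_def A_add ls)
  have h_scale: "h (sc [:z:] v) u = z * h v u" for z v u
    by (simp add: h_def ls Klin_app[OF Klin_gr] A_scale)
  have h_diff: "h (v - w) u = h v u - h w u" for v w u
    using h_add[of "v - w" w u] by simp
  \<comment> \<open>\<partial> picks up e^(-u) from \<open>gr u\<close>, and \<open>Lm 0\<close>
    turns it into \<partial> + \<lambda>, which \<open>l\<close> reads as 1 + \<lambda> = e^u. The
    factors cancel, so \<open>h\<close> factors through the fibre.\<close>
  have h_Del: "h (sc [:0, 1:] v) u = h v u" for v u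
  proof -
    define y where "y = ev (exp u - 1) (A 0 (app (gr u) v))"
    have "ev (exp u - 1) (A 0 (app (gr u) (sc [:0, 1:] v)))
        = sc [:exp (- u):] (app (Lm 0 (exp u - 1) * Del) (app (gr u) v))"
      unfolding gr_Del by (simp add: A_scale del: scale_scale)
    also have "\<dots> = sc [:exp (- u):] (sc [:0, 1:] y + sc [:exp u - 1:] y)"
      by (simp only: Lm_Del y_def app_ring app_Sc app_Lm)
    finally have "h (sc [:0, 1:] v) u = exp (- u) * (l y + (exp u - 1) * l y)"
      by (simp only: h_def ls lD)
    also have "\<dots> = l y" by (simp add: algebra_simps flip: exp_add)
    finally show ?thesis by (simp add: h_def y_def)
  qed
  have h_DD: "h v u = 0" if v: "v \<in> DD" for v u
  proof -
    obtain x where "v = sc [:0, 1:] x - x" using v by (auto simp: DD_def)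
    then show ?thesis using h_diff h_Del by simp
  qed
  have h_0: "h v 0 = l v" for v
  proof -
    have "ev 0 (A 0 v) = sc [:0, 1:] v"
      using arg_cong[OF X00, of "\<lambda>f. app f v"] by (simp add: ev_zero)
    then show ?thesis by (simp add: h_def gr_0 lD)
  qed
  have lPE: "l (app (PE R N1) v) = poly R c * l v" for R v
  proof (induction R)
    case (pCons a R)
    show ?case by (simp only: PE_pCons app_ring app_Sc ls lN pCons.IH poly_pCons) (simp add: algebra_simps)
  qed (simp add: ls)
  \<comment> \<open>\<open>PE R N1\<close> projects to the generalised eigenspace of
    \<open>c\<close> in the fibre, up to an invertible factor there.\<close>
  obtain m R where R: "Q = [:- c, 1:] ^ m * R" "poly R c \<noteq> 0"
    using order_decomp[OF Q(2), of c] by (metis poly_eq_0_iff_dvd)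
  obtain x where x: "l x \<noteq> 0" using l_nz by auto
  define M where "M = N1 - K c"
  have KM: "Klin M" and KN: "Klin N1" by (simp_all add: M_def)
  have PM: "PE ([:- c, 1:] ^ m) N1 = M ^ m" for m
  proof (induction m)
    case 0
    show ?case by (simp add: one_pCons)
  next
    case (Suc m)
    have "PE [:- c, 1:] N1 = M" by (simp add: M_def K_minus)
    then show ?case by (simp only: power_Suc PE_mult[OF KN] Suc.IH)
  qed
  have NM: "N1 * M ^ s = M ^ s * N1" for s
    by (rule power_commuting_commutes[symmetric]) (simp add: M_def algebra_simps KlinD)
  define w0 where "w0 = app (PE R N1) x"
  have w0: "l w0 \<noteq> 0" using x R(2) unfolding w0_def lPE by simp
  have "app (M ^ m) w0 \<in> DD"
    using Q(1)[of x] unfolding R(1) PE_mult[OF KN] PM w0_def by (simp only: app_ring)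
  moreover have MDD: "app (M ^ n) v \<in> DD" if v: "v \<in> DD" for n v
  proof -
    obtain y where y: "v = sc [:0, 1:] y - y" using v by (auto simp: DD_def)
    have "M * Del = Del * M" using N1_Del KlinD[of Del c] by (simp add: M_def algebra_simps)
    then have "M ^ n * Del = Del * M ^ n" by (rule power_commuting_commutes)
    from arg_cong[OF this, of "\<lambda>f. app f y"]
    have e: "app (M ^ n) (sc [:0, 1:] y) = sc [:0, 1:] (app (M ^ n) y)"
      by (simp only: app_ring app_Sc)
    show ?thesis unfolding y app_diff_right e DD_def by (rule rangeI)
  qed
  ultimately have far: "app (M ^ s) w0 \<in> DD" if "s \<ge> m" for s
    using that MDD[of "app (M ^ m) w0" "s - m"] by (metis app_ring(6) le_add_diff_inverse2 power_add)
  define NZ where "NZ s \<longleftrightarrow> (\<exists>u. h (app (M ^ s) w0) u \<noteq> 0)" for s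
  have "h (app (M ^ 0) w0) 0 \<noteq> 0" using w0 by (simp add: h_0)
  then have NZ_0: "NZ 0" unfolding NZ_def by blast
  have NZ_far: "s \<le> m" if s: "NZ s" for s
  proof (rule ccontr)
    assume "\<not> s \<le> m"
    then have "h (app (M ^ s) w0) u = 0" for u using h_DD[OF far[of s]] by simp
    then show False using s by (simp add: NZ_def)
  qed
  \<comment> \<open>Replacing \<open>w0\<close> by the last power of \<open>M\<close> that
    \<open>h\<close> still sees makes \<open>h\<close> treat \<open>N1\<close> on it as the scalar
    \<open>c\<close>, although \<open>N1\<close> need not be diagonalisable.\<close>
  define s where "s = (GREATEST s. NZ s)"
  have s: "NZ s" "\<And>t. t > s \<Longrightarrow> \<not> NZ t"
    unfolding s_def using GreatestI_nat[of NZ 0 m] Greatest_le_nat[of NZ _ m] NZ_0 NZ_far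
    by (auto simp: not_le[symmetric])
  define w where "w = app (M ^ s) w0"
  have hM: "h (app (M ^ t) w) u = 0" if "t > 0" for t u
  proof -
    have "app (M ^ t) w = app (M ^ (t + s)) w0" by (simp add: w_def power_add)
    then show ?thesis using s(2)[of "t + s"] that by (auto simp: NZ_def)
  qed
  have hMN: "h (app (M ^ t) (app (N1 ^ n) w)) u = c ^ n * h (app (M ^ t) w) u" for t n u
  proof (induction n arbitrary: t)
    case (Suc n)
    have "app (M ^ t) (app (N1 ^ Suc n) w) = app (M ^ Suc t) (app (N1 ^ n) w) + sc [:c:] (app (M ^ t) (app (N1 ^ n) w))"
    proof -
      have "M ^ Suc t + K c * M ^ t = (M + K c) * M ^ t" by (simp only: power_Suc distrib_right)
      also have "M + K c = N1" by (simp add: M_def)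
      finally have "M ^ Suc t + K c * M ^ t = M ^ t * N1" by (simp only: NM)
      then have "app (M ^ t * N1) y = app (M ^ Suc t) y + sc [:c:] (app (M ^ t) y)" for y
        by (metis app_Sc app_ring(3,6))
      then show ?thesis by (simp only: power_Suc[of N1] app_ring)
    qed
    then show ?case using Suc.IH[of t] Suc.IH[of "Suc t"] hM[of "Suc t"]
      by (simp only: h_add h_scale) (simp add: hM[of "Suc t", simplified])
  qed simp
  have hN: "h (app (N1 ^ n) w) u = c ^ n * h w u" for n u
    using hMN[of 0 n u] by simp
  have chain: "l (app ((ad N1 ^^ j) (Lm 0 (exp u - 1))) (app (gr u) (app (N1 ^ n) w)))
      = c ^ (n + j) * (1 - exp (\<alpha> 1 * u)) ^ j * h w u" for j n u
  proof (induction j arbitrary: n)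
    case 0
    show ?case using hN[of n u] by (simp add: h_def)
  next
    case (Suc j)
    define Y where "Y = (ad N1 ^^ j) (Lm 0 (exp u - 1))"
    have KY: "Klin Y" unfolding Y_def ad_N1_chain by simp
    have g: "app N1 (app (gr u) y) = sc [:exp (\<alpha> 1 * u):] (app (gr u) (app N1 y))" for y
      using arg_cong[OF gr_X[of 1 u], of "\<lambda>f. app f y"] by (simp only: app_ring app_Sc)
    have "app (ad N1 Y) (app (gr u) (app (N1 ^ n) w))
        = app N1 (app Y (app (gr u) (app (N1 ^ n) w)))
          - sc [:exp (\<alpha> 1 * u):] (app Y (app (gr u) (app (N1 ^ Suc n) w)))"
      by (simp only: ad_def app_ring g Klin_app[OF KY] power_Suc)
    then have "l (app (ad N1 Y) (app (gr u) (app (N1 ^ n) w)))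
        = c * (c ^ (n + j) * (1 - exp (\<alpha> 1 * u)) ^ j * h w u)
          - exp (\<alpha> 1 * u) * (c ^ (Suc n + j) * (1 - exp (\<alpha> 1 * u)) ^ j * h w u)"
      by (simp only: ls lN Y_def Suc.IH)
    then show ?case by (simp add: Y_def algebra_simps)
  qed
  obtain G0 where G0: "\<And>l. linear_form l \<Longrightarrow> expsum G0 (\<lambda>u. l (ev (exp u - 1) (A 0 (app (gr u) w))))"
    using chain_expsum[of 0 w] by blast
  have "\<forall>v. \<exists>G. expsum G (h v)" using chain_expsum[of 0] l unfolding h_def by blast
  then obtain GG where GG: "\<And>v. expsum (GG v) (h v)" by metis
  \<comment> \<open>Since \<open>h\<close> factors through the fibre, the frequencies on the
    generators suffice for every vector, in particular for \<open>app (X j 0) w\<close> with any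
    \<open>j\<close>.\<close>
  define GB where "GB = (\<Union>v\<in>B. GG v)"
  have finGB: "finite GB" using B_fin GG by (auto simp: GB_def expsum_def)
  have hB: "expsum GB (h v)" for v
  proof -
    have "v \<in> span B" using B_span by simp
    then obtain p where p: "v = (\<Sum>y\<in>B. sc (p y) y)" unfolding span_finite[OF B_fin] by blast
    have h_sum: "h (\<Sum>y\<in>I. g y) u = (\<Sum>y\<in>I. h (g y) u)" for g :: "'a \<Rightarrow> 'a" and I u
      using h_scale[of 0 0 u] by (induction I rule: infinite_finite_induct) (auto simp: h_add)
    have "h (sc q y) u = poly q 1 * h y u" for q y u
      using h_DD[OF DD_eval[of q y], of u] by (simp add: h_diff h_scale)
    then have "h v = (\<lambda>u. \<Sum>y\<in>B. poly (p y) 1 * h y u)" by (simp add: p h_sum fun_eq_iff)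
    moreover have "expsum GB (\<lambda>u. \<Sum>y\<in>B. poly (p y) 1 * h y u)"
      by (intro expsum_sum[OF finGB] expsum_scale expsum_mono[OF GG _ finGB]) (auto simp: GB_def)
    ultimately show ?thesis by simp
  qed
  define f where "f j u = l (ev (exp u - 1) (A j (app (gr u) w)))" for j u
  \<comment> \<open>The two halves of the commutator of \<open>Lm 0\<close> with
    \<open>X j 0\<close>, which is \<open>\<alpha> j\<close> \<lambda> \<open>Lm j\<close>. Unlike
    \<open>f j\<close>, whose degree in \<lambda> is uncontrolled, they involve only
    \<open>Lm 0\<close>, hence boundedly many frequencies.\<close>
  define b where "b j u = exp (\<alpha> j * u) * h (app (X j 0) w) u
      + (- 1) * l (app (X j 0) (ev (exp u - 1) (A 0 (app (gr u) w))))" for j u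
  show thesis
  proof (rule that[of c "h w" f b "card GB + card G0"])
    show "c \<noteq> 0" by fact
    obtain u0 where u0: "h w u0 \<noteq> 0" using s(1) by (auto simp: NZ_def w_def)
    then show "\<exists>u. h w u \<noteq> 0" by blast
    show "\<exists>n. has_order (h w) x n" for x using expsum_has_order[OF hB u0] by blast
    show "\<exists>G. expsum G (f j)" for j using chain_expsum[of j w] l unfolding f_def by blast
    show "\<exists>G. expsum G (b j) \<and> card G \<le> card GB + card G0" for j
    proof (intro exI conjI)
      have lX: "linear_form (\<lambda>v. l (app (X j 0) v))"
        by (rule linear_form_comp[OF l Klin_app[OF Klin_X]])
      show "expsum ((+) (\<alpha> j) ` GB \<union> G0) (b j)"
        unfolding b_def by (intro expsum_add expsum_exp_mult hB expsum_scale G0[OF lX])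
      have "card ((+) (\<alpha> j) ` GB \<union> G0) \<le> card ((+) (\<alpha> j) ` GB) + card G0" by (rule card_Un_le)
      then show "card ((+) (\<alpha> j) ` GB \<union> G0) \<le> card GB + card G0"
        using card_image_le[OF finGB, of "(+) (\<alpha> j)"] by linarith
    qed
    show "(\<exists>v. A j v \<noteq> 0) \<or> (\<forall>u. f j u = 0)" for j by (auto simp: f_def ls)
    show "c ^ j * (1 - exp (\<alpha> 1 * u)) ^ j * h w u = Ee j * (1 - exp u) ^ S j * f j u" for j u
      using chain[of j u 0] unfolding ad_N1_chain by (simp add: ls f_def)
    show "\<alpha> j * (exp u - 1) * f j u = b j u" for j u
    proof -
      have g: "app (X j 0) (app (gr u) w) = sc [:exp (\<alpha> j * u):] (app (gr u) (app (X j 0) w))"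
        using arg_cong[OF gr_X[of j u], of "\<lambda>f. app f w"] by (simp only: app_ring app_Sc)
      have "l (app (ad (Lm 0 (exp u - 1)) (X j 0)) (app (gr u) w))
          = exp (\<alpha> j * u) * h (app (X j 0) w) u
            - l (app (X j 0) (ev (exp u - 1) (A 0 (app (gr u) w))))"
        by (simp only: ad_def app_ring g app_Lm) (simp add: ls h_def A_scale)
      then show ?thesis unfolding ad_L0_const by (simp add: b_def ls f_def)
    qed
  qed
qed

end

declare One_nat_def [simp del]

lemma not_has_order_0: "\<not> has_order (\<lambda>_. 0) x n"
  unfolding has_order_def using fps_expansion_unique_complex[OF _ has_fps_expansion_0] by blast

context chain_rep
begin

text \<open>Orders at \<open>x\<close> satisfy \<open>j * r x + n = S j * q x + m\<close>, and
  \<open>m < k\<close> when \<open>\<alpha> j \<noteq> 0\<close>. At 0 this compares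
  \<open>S j\<close> with \<open>j\<close>; at a period of exp(\<alpha>_1 u) it forces a period of
  exp(u), so that \<open>\<alpha> 1\<close> is the reciprocal of an integer. Any value but 1 drives
  the weights below the bound of \<open>very_negative_weight_trivial\<close>. If eventually
  \<open>\<alpha> j = 0\<close>, the upper bound on \<open>S j\<close> decides instead.\<close>

lemma \<alpha>1_eq_1_and_bound: "\<alpha> 1 = 1 \<and> (\<exists>k. \<forall>j. j \<le> S j + k) \<and> (\<forall>j. \<exists>v. A j v \<noteq> 0)"
proof -
  obtain c k \<phi> f b where c: "c \<noteq> 0" and \<phi>: "\<And>x. \<exists>n. has_order \<phi> x n"
    and f: "\<And>j. \<exists>G. expsum G (f j)" and b: "\<And>j. \<exists>G. expsum G (b j) \<and> card G \<le> k"
    and fA: "\<And>j. (\<exists>v. A j v \<noteq> 0) \<or> (\<forall>u. f j u = 0)"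
    and eq1: "\<And>j u. c ^ j * (1 - exp (\<alpha> 1 * u)) ^ j * \<phi> u = Ee j * (1 - exp u) ^ S j * f j u"
    and eq2: "\<And>j u. \<alpha> j * (exp u - 1) * f j u = b j u"
    by (rule chain_functions, rule that)
  define r where "r x = (if exp (\<alpha> 1 * x) = 1 then 1 else 0 :: nat)" for x
  define q where "q x = (if exp x = 1 then 1 else 0 :: nat)" for x :: complex
  have o1: "has_order (\<lambda>u. 1 - exp (\<alpha> 1 * u)) x (r x)" for x
    unfolding r_def by (rule has_order_one_minus_exp[OF \<alpha>1_nz])
  have o2: "has_order (\<lambda>u. 1 - exp u) x (q x)" for x
    using has_order_one_minus_exp[of 1 x] by (simp add: q_def)
  have o3: "has_order (\<lambda>u. exp u - 1) x (q x)" for x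
    using has_order_mult[OF has_order_const[of "-1" x] o2[of x]] by simp
  have lhs: "has_order (\<lambda>u. c ^ j * (1 - exp (\<alpha> 1 * u)) ^ j * \<phi> u) x (0 + j * r x + n)"
    if "has_order \<phi> x n" for x j n
    by (intro has_order_mult has_order_power o1 that has_order_const) (use c in auto)
  have f_nz: "\<exists>u. f j u \<noteq> 0" for j
  proof (rule ccontr)
    assume "\<not> ?thesis"
    then have "(\<lambda>u. c ^ j * (1 - exp (\<alpha> 1 * u)) ^ j * \<phi> u) = (\<lambda>_. 0)" by (simp add: eq1)
    then show False using lhs[of 0 _ j] \<phi>[of 0] not_has_order_0 by metis
  qed
  have f_order: "\<exists>n. has_order (f j) x n" for j x
    using f[of j] f_nz[of j] expsum_has_order by blast
  have orders: "j * r x + n = S j * q x + m" if "has_order \<phi> x n" "has_order (f j) x m" for j x n m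
  proof -
    have "has_order (\<lambda>u. Ee j * (1 - exp u) ^ S j * f j u) x (0 + S j * q x + m)"
      by (intro has_order_mult has_order_power o2 that has_order_const) (rule Ee_nz)
    then show ?thesis using lhs[OF that(1), of j] has_order_unique unfolding eq1 by fastforce
  qed
  have small: "q x + m < k" if "\<alpha> j \<noteq> 0" "has_order (f j) x m" for j x m
  proof -
    have ob: "has_order (b j) x (0 + q x + m)"
      unfolding eq2[symmetric, abs_def]
      by (intro has_order_mult o3 that has_order_const)
    have "b j \<noteq> (\<lambda>_. 0)" using ob not_has_order_0 by auto
    then obtain u where u: "b j u \<noteq> 0" by blast
    obtain G where G: "expsum G (b j)" "card G \<le> k" using b by blast
    obtain n where "n < card G" "has_order (b j) x n" using expsum_has_order[OF G(1) u] by blast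
    then show ?thesis using has_order_unique[OF ob] G(2) by fastforce
  qed
  have rq0: "r 0 = 1" "q 0 = 1" by (simp_all add: r_def q_def)
  obtain n0 where n0: "has_order \<phi> 0 n0" using \<phi> by blast
  have upper: "S j \<le> j + n0" for j
    using orders[OF n0] f_order[of j 0] rq0 by (metis add_leD1 le_add1 mult.right_neutral)
  have lower: "j \<le> S j + k" if "\<alpha> j \<noteq> 0" for j
  proof -
    obtain m where m: "has_order (f j) 0 m" using f_order by blast
    show ?thesis using orders[OF n0 m] small[OF that m] rq0 by simp
  qed
  have "\<alpha> 1 = 1"
  proof (rule ccontr)
    assume ne1: "\<alpha> 1 \<noteq> 1"
    show False
    proof (cases "\<forall>J. \<exists>j\<ge>J. \<alpha> j \<noteq> 0")
      case True
      \<comment> \<open>Here \<open>r x = 1\<close>; if exp x were not 1, then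
        \<open>q x = 0\<close> and \<open>j \<le> m < k\<close>, against the choice of
        \<open>j\<close>.\<close>
      define x where "x = 2 * of_real pi * \<i> / \<alpha> 1"
      have rx: "r x = 1" using \<alpha>1_nz by (simp add: r_def x_def)
      obtain j where j: "j \<ge> k" "\<alpha> j \<noteq> 0" using True by blast
      obtain n m where nm: "has_order \<phi> x n" "has_order (f j) x m" using \<phi> f_order by blast
      have "exp x = 1"
        using orders[OF nm] small[OF j(2) nm(2)] j(1) rx by (auto simp: q_def split: if_splits)
      then obtain z :: int where z: "Re x = 0" "Im x = of_int (2 * z) * pi" by (auto simp: exp_eq_1)
      then have "x = 2 * of_real pi * \<i> * of_int z" by (auto simp: complex_eq_iff)
      then have z1: "\<alpha> 1 * of_int z = 1" using \<alpha>1_nz by (simp add: x_def field_simps)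
      then have zn: "z \<noteq> 0" "z \<noteq> 1" using ne1 by auto
      have "\<alpha> 1 = of_real (1 / of_int z)" using z1 zn by (simp add: field_simps)
      then have "Re (\<alpha> 1) = 1 / of_int z" by simp
      moreover have "1 / (of_int z :: real) \<le> 1 / 2"
      proof (cases "z < 0")
        case True
        then have "1 / (of_int z :: real) < 0" by simp
        then show ?thesis by simp
      next
        case False
        then have "(2 :: real) \<le> of_int z" using zn by simp
        then show ?thesis by (simp add: field_simps)
      qed
      ultimately have re: "Re (\<alpha> 1) \<le> 1 / 2" by simp
      obtain R where R: "\<And>i v. Re (\<alpha> i) < R \<Longrightarrow> A i v = 0" using very_negative_weight_trivial by blast
      obtain j where j: "j \<ge> nat \<lceil>2 * (real k + 2 - R)\<rceil>" "\<alpha> j \<noteq> 0" using True by blast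
      have "2 * (real k + 2 - R) \<le> real j" using j(1) by linarith
      moreover have "real j \<le> real (S j) + real k" using lower[OF j(2)] by linarith
      moreover have "Re (\<alpha> j) = real j * Re (\<alpha> 1) + 1 - real (S j)"
        by (subst \<alpha>_formula) simp
      moreover have "real j * Re (\<alpha> 1) \<le> real j * (1 / 2)" using re by (intro mult_left_mono) auto
      ultimately have "Re (\<alpha> j) < R" by argo
      then show False using R fA[of j] f_nz[of j] by blast
    next
      case False
      then obtain J where J: "\<And>j. j \<ge> J \<Longrightarrow> \<alpha> j = 0" by blast
      \<comment> \<open>Two consecutive vanishing weights make \<open>\<alpha> 1\<close> a natural
        number, at least 2 here, so \<open>S j\<close> grows at least twice as fast as
        \<open>j\<close>.\<close>
      have d: "\<alpha> 1 = of_nat (d J)" using \<alpha>_Suc[of J] J[of J] J[of "Suc J"] by simp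
      then have "d J \<noteq> 0" "d J \<noteq> 1" using \<alpha>1_nz ne1 by auto
      then have d2: "d J \<ge> 2" by linarith
      define j where "j = J + n0"
      have "(of_nat (S j) :: complex) = of_nat (j * d J + 1)"
        using \<alpha>_formula[of j] J[of j] d by (simp add: j_def algebra_simps)
      then have "S j = j * d J + 1" by (simp only: of_nat_eq_iff)
      then show False using upper[of j] d2 mult_le_mono2[OF d2, of j] by (simp add: j_def)
    qed
  qed
  moreover have "j \<le> S j + k" for j
  proof (cases "\<alpha> j = 0")
    case True
    then have "(of_nat (S j) :: complex) = of_nat (j + 1)"
      using \<alpha>_formula[of j] \<open>\<alpha> 1 = 1\<close> by simp
    then have "S j = j + 1" by (simp only: of_nat_eq_iff)
    then show ?thesis by simp
  qed (rule lower)
  moreover have "\<exists>v. A j v \<noteq> 0" for j using fA[of j] f_nz[of j] by blast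
  ultimately show ?thesis by blast
qed

end

section \<open>Binomial inversion\<close>

text \<open>The binomial transform has finite support, so by inversion
  \<open>(- 1) ^ n * x n\<close> is a polynomial in \<open>n\<close>; infinitely many zeros make it
  the zero polynomial.\<close>

lemma sum_choose_zero_imp_zero:
  fixes x :: "nat \<Rightarrow> complex"
  assumes rel: "\<And>M. M \<ge> M0 \<Longrightarrow> (\<Sum>j\<le>M. of_nat (M choose j) * x j) = 0"
    and inf: "infinite {j. x j = 0}"
  shows "x j = 0"
proof -
  define z where "z M = (\<Sum>j\<le>M. of_nat (M choose j) * x j)" for M
  have inv: "(- 1) ^ n * x n = (\<Sum>M\<le>n. of_nat (n choose M) * (- 1) ^ M * z M)" for n
  proof -
    have "(\<Sum>M\<le>n. of_nat (n choose M) * (- 1) ^ M * z M)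
        = (\<Sum>M\<le>n. \<Sum>j\<le>n. of_nat (n choose M) * (- 1) ^ M * of_nat (M choose j) * x j)"
    proof (intro sum.cong refl)
      fix M assume M: "M \<in> {..n}"
      have "z M = (\<Sum>j\<le>n. of_nat (M choose j) * x j)"
        unfolding z_def using M by (intro sum.mono_neutral_left) auto
      then show "of_nat (n choose M) * (- 1) ^ M * z M
          = (\<Sum>j\<le>n. of_nat (n choose M) * (- 1) ^ M * of_nat (M choose j) * x j)"
        by (simp add: sum_distrib_left mult.assoc)
    qed
    also have "\<dots> = (\<Sum>j\<le>n. (\<Sum>M\<le>n. of_nat (n choose M) * (- 1) ^ M * of_nat (M choose j)) * x j)"
      by (subst sum.swap) (simp add: sum_distrib_right)
    also have "\<dots> = (\<Sum>j\<le>n. (if j = n then (- 1) ^ n * x n else 0))"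
    proof (intro sum.cong refl)
      fix j assume "j \<in> {..n}"
      then have j: "j \<le> n" by simp
      have "(\<Sum>M\<le>n. of_nat (n choose M) * (- 1) ^ M * of_nat (M choose j) :: complex)
          = (\<Sum>M\<in>{j..n}. of_nat (n choose M) * (- 1) ^ M * of_nat (M choose j))"
        by (rule sum.mono_neutral_right) (auto simp: binomial_eq_0)
      also have "\<dots> = (\<Sum>i\<le>n - j. of_nat (n choose (i + j)) * (- 1) ^ (i + j) * of_nat ((i + j) choose j))"
        using j by (intro sum.reindex_bij_witness[of _ "\<lambda>i. i + j" "\<lambda>M. M - j"]) auto
      also have "\<dots> = (\<Sum>i\<le>n - j. of_nat (n choose j) * (- 1) ^ j * (of_nat ((n - j) choose i) * (- 1) ^ i))"
      proof (intro sum.cong refl)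
        fix i assume "i \<in> {..n - j}"
        then have "(n choose (i + j)) * ((i + j) choose j) = (n choose j) * ((n - j) choose i)"
          using choose_mult[of j "i + j" n] j by simp
        then have "(of_nat (n choose (i + j)) * of_nat ((i + j) choose j) :: complex)
            = of_nat (n choose j) * of_nat ((n - j) choose i)"
          by (metis of_nat_mult)
        then show "of_nat (n choose (i + j)) * (- 1) ^ (i + j) * of_nat ((i + j) choose j)
            = (of_nat (n choose j) * (- 1) ^ j * (of_nat ((n - j) choose i) * (- 1) ^ i) :: complex)"
          by (simp add: power_add mult_ac)
      qed
      also have "\<dots> = of_nat (n choose j) * (- 1) ^ j * (\<Sum>i\<le>n - j. (- 1) ^ i * of_nat ((n - j) choose i))"
        by (simp add: sum_distrib_left mult_ac)
      also have "\<dots> = (if j = n then (- 1) ^ n else 0)"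
        using j choose_alternating_sum[of "n - j", where 'a = complex] by auto
      finally show "(\<Sum>M\<le>n. of_nat (n choose M) * (- 1) ^ M * of_nat (M choose j)) * x j
          = (if j = n then (- 1) ^ n * x n else 0)" by simp
    qed
    finally show ?thesis by simp
  qed
  \<comment> \<open>Newton's form: the factor after the coefficient, divided by
    \<open>fact M\<close>, is the binomial coefficient as a polynomial.\<close>
  define p where "p = (\<Sum>M<M0. smult ((- 1) ^ M * z M / fact M) (\<Prod>i<M. [:- of_nat i, 1:]))"
  have p: "poly p (of_nat n) = (- 1) ^ n * x n" for n
  proof -
    have "of_nat (n choose M) = (\<Prod>i<M. of_nat n - of_nat i) / (fact M :: complex)" for M
      by (simp add: binomial_gbinomial gbinomial_prod_rev atLeast0LessThan)
    then have "poly p (of_nat n) = (\<Sum>M<M0. of_nat (n choose M) * (- 1) ^ M * z M)"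
      by (simp add: p_def poly_sum poly_prod algebra_simps)
    also have "\<dots> = (\<Sum>M\<le>n. of_nat (n choose M) * (- 1) ^ M * z M)"
      by (rule sum.mono_neutral_cong) (use rel in \<open>auto simp: z_def binomial_eq_0\<close>)
    finally show ?thesis by (simp add: inv)
  qed
  have "infinite ((of_nat :: nat \<Rightarrow> complex) ` {j. x j = 0})"
    using inf by (simp add: finite_image_iff inj_on_def)
  moreover have "of_nat ` {j. x j = 0} \<subseteq> {y. poly p y = 0}" by (auto simp: p)
  ultimately have "p = 0" using poly_roots_finite infinite_super by blast
  then have "(- 1) ^ j * x j = 0" using p[of j] by simp
  then show ?thesis by simp
qed

section \<open>The second generator acts as a multiple of the first\<close>

lemma ad_Jacobi: "ad (ad a b) z = ad a (ad b z) - ad b (ad a z)"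
  by (simp add: ad_def algebra_simps)

lemma ad_commute:
  assumes "a * b = b * a"
  shows "ad a (ad b z) = ad b (ad a z)"
proof -
  have "ad a b = 0" using assms by (simp add: ad_def)
  then have "ad a (ad b z) - ad b (ad a z) = 0" using ad_Jacobi[of a b z] by (simp add: ad_def[of 0])
  then show ?thesis by simp
qed

lemma (in cmodule) ad_K_mult: "Klin T \<Longrightarrow> ad T (K c * Y) = K c * ad T Y"
  by (rule ad_mult_central) (simp add: KlinD)

lemma (in cmodule) ad_K_mult_left: "Klin Y \<Longrightarrow> ad (K c * T) Y = K c * ad T Y"
  by (rule ad_mult_central_left) (simp add: KlinD)

text \<open>On the family \<open>w\<close>, \<open>ad T\<close> is the shift plus the scalar
  \<open>z\<close>, which commute.\<close>

lemma (in cmodule) ad_binomial: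
  assumes T: "Klin T" and w: "\<And>j. ad T (w j) = w (Suc j) + K z * w j"
  shows "(ad T ^^ M) (w i) = (\<Sum>j\<le>M. K (of_nat (M choose j) * z ^ (M - j)) * w (i + j))"
proof (induction M arbitrary: i)
  case (Suc M)
  have add: "(ad T ^^ n) (a + b) = (ad T ^^ n) a + (ad T ^^ n) b" for n a b
    by (induction n) (simp_all add: ad_add)
  have scale: "(ad T ^^ n) (K c * a) = K c * (ad T ^^ n) a" for n a c
    by (induction n) (simp_all add: ad_K_mult[OF T])
  define t where "t M j = of_nat (M choose j) * z ^ (M - j)" for M j
  have t: "t (Suc M) (Suc j) = t M j + z * t M (Suc j)" if "j \<le> M" for j
    using that by (cases "j = M") (auto simp: t_def algebra_simps Suc_diff_Suc binomial_eq_0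
      simp flip: power_Suc)
  have "(ad T ^^ Suc M) (w i) = (ad T ^^ M) (w (Suc i)) + K z * (ad T ^^ M) (w i)"
    by (simp only: funpow_Suc_right comp_apply w add scale)
  also have "\<dots> = (\<Sum>j\<le>M. K (t M j) * w (Suc i + j)) + K z * (\<Sum>j\<le>M. K (t M j) * w (i + j))"
    by (simp only: Suc.IH t_def)
  also have "K z * (\<Sum>j\<le>M. K (t M j) * w (i + j)) = (\<Sum>j\<le>Suc M. K (z * t M j) * w (i + j))"
    by (simp add: sum_distrib_left K_mult mult.assoc t_def binomial_eq_0 del: Sc_ring(6))
  also have "\<dots> = K (z * t M 0) * w i + (\<Sum>j\<le>M. K (z * t M (Suc j)) * w (Suc i + j))"
    by (subst sum.atMost_Suc_shift) simp
  also have "(\<Sum>j\<le>M. K (t M j) * w (Suc i + j)) + (K (z * t M 0) * w i + (\<Sum>j\<le>M. K (z * t M (Suc j)) * w (Suc i + j)))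
      = K (z * t M 0) * w i + (\<Sum>j\<le>M. K (t M j + z * t M (Suc j)) * w (Suc i + j))"
    by (simp only: K_add distrib_right sum.distrib) (simp only: add_ac)
  also have "\<dots> = K (t (Suc M) 0) * w (i + 0) + (\<Sum>j\<le>M. K (t (Suc M) (Suc j)) * w (i + Suc j))"
    by (simp add: t cong: sum.cong_simp) (simp add: t_def)
  also have "\<dots> = (\<Sum>j\<le>Suc M. K (t (Suc M) j) * w (i + j))"
    by (subst sum.atMost_Suc_shift) simp
  finally show ?case by (simp only: t_def)
qed simp

context homog_rep
begin

lemma X_Sc: "X i 0 * Sc p = Sc p * X i 0"
  using Lm_Sc[of i 0 p] by (simp add: Lm_0 pcompose_idR)

lemma ad_Del_X: "ad Del (X i 0) = 0" "ad Del (X i (Suc n)) = - X i n"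
  by (simp_all only: ad_def X_Del) simp_all

end

section \<open>The eigenvalue of \<open>N1\<close> relative to \<partial>\<close>

context chain_rep
begin

text \<open>\<open>HP r Q\<close> is the homogenisation of degree \<open>r\<close> of \<open>Q(N\<^sub>1)\<close> by \<open>\<partial>\<close>; it factors like \<open>Q\<close>.\<close>

definition HP :: "nat \<Rightarrow> complex poly \<Rightarrow> 'a endo" where
  "HP r Q = (\<Sum>t\<le>r. K (coeff Q t) * (Del ^ (r - t) * N1 ^ t))"

lemma Del_N1_power: "Del ^ n * N1 = N1 * Del ^ n"
  by (rule power_commuting_commutes) (simp add: N1_Del)

lemma HP_pCons: "HP (Suc r) (pCons a R) = K a * Del ^ Suc r + N1 * HP r R"
proof -
  have "K z * (Del ^ m * N1 ^ Suc t) = N1 * (K z * (Del ^ m * N1 ^ t))" for z m t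
    using Del_N1_power[of m] KlinD[of N1 z] Klin_X by (simp only: power_Suc mult.assoc[symmetric])
  then show ?thesis
    unfolding HP_def by (subst sum.atMost_Suc_shift) (simp add: sum_distrib_left del: power_Suc Sc_ring(6))
qed

lemma HP_Del:
  assumes "degree R \<le> r"
  shows "HP (Suc r) R = Del * HP r R"
proof -
  have "K z * (Del ^ (Suc r - t) * N1 ^ t) = Del * (K z * (Del ^ (r - t) * N1 ^ t))" if "t \<le> r" for z t
    using that by (simp only: Suc_diff_le power_Suc mult.assoc[symmetric]) (simp add: mult.commute flip: Sc_ring)
  then show ?thesis
    using assms by (simp add: HP_def sum_distrib_left coeff_eq_0 del: power_Suc Sc_ring(6))
qed

lemma HP_diff: "HP r (Q - R) = HP r Q - HP r R"
  by (simp add: HP_def K_diff left_diff_distrib sum_subtractf)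

lemma HP_smult: "HP r (smult a Q) = K a * HP r Q"
  by (simp add: HP_def K_mult sum_distrib_left mult.assoc del: Sc_ring(6))

lemma HP_root:
  assumes "degree R \<le> r"
  shows "HP (Suc r) ([:- c, 1:] * R) = (N1 - K c * Del) * HP r R"
proof -
  have "[:- c, 1:] * R = pCons 0 R - smult c R" by simp
  then show ?thesis
    using HP_Del[OF assms] by (simp only: HP_diff HP_smult HP_pCons left_diff_distrib mult.assoc) simp
qed

text \<open>\<open>HP r Q\<close> is a product of factors \<open>N1 - K c * Del\<close> and powers
  of \<open>Del\<close>. The latter are injective, so one of the former has a kernel.\<close>

lemma HP_eigenvector:
  assumes "degree Q \<le> r" "Q \<noteq> 0" "u \<noteq> 0" "app (HP r Q) u = 0"
  shows "\<exists>c v. v \<noteq> 0 \<and> app (N1 - K c * Del) v = 0"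
  using assms
proof (induction r arbitrary: Q)
  case 0
  then obtain a where "Q = [:a:]" by (metis degree_eq_zeroE le_zero_eq)
  then show ?case using 0 by (simp add: HP_def)
next
  case (Suc r)
  show ?case
  proof (cases "degree Q = 0")
    case True
    then obtain a where a: "Q = [:a:]" by (metis degree_eq_zeroE)
    have "HP (Suc r) Q = K a * Del ^ Suc r" unfolding a HP_pCons by (simp add: HP_def)
    also have "Del ^ n = Sc ([:0, 1:] ^ n)" for n
      by (induction n) (simp_all only: power_Suc power_0 Sc_ring)
    finally have "sc ([:a:] * [:0, 1:] ^ Suc r) u = 0"
      using Suc.prems(4) by (simp only: app_ring app_Sc scale_scale)
    then have False using Suc.prems(2,3) a by (simp add: torsion_free)
    then show ?thesis ..
  next
    case False
    then obtain c where "poly Q c = 0"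
      using fundamental_theorem_of_algebra[of Q] by (auto simp: constant_degree)
    then obtain R where R: "Q = [:- c, 1:] * R" by (auto simp: poly_eq_0_iff_dvd elim: dvdE)
    then have "R \<noteq> 0" using Suc.prems(2) by auto
    have "degree Q = Suc (degree R)" using \<open>R \<noteq> 0\<close> unfolding R by (subst degree_mult_eq) auto
    then have deg: "degree R \<le> r" using Suc.prems(1) by simp
    have 0: "app (N1 - K c * Del) (app (HP r R) u) = 0"
      using Suc.prems(4) unfolding R HP_root[OF deg] by (simp only: app_ring(6))
    show ?thesis
    proof (cases "app (HP r R) u = 0")
      case True
      then show ?thesis using Suc.IH deg \<open>R \<noteq> 0\<close> Suc.prems(3) by blast
    qed (use 0 in blast)
  qed
qed

text \<open>With \<open>\<alpha> 1 = 1\<close> both \<partial> and \<open>N1\<close> raise the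
  weight by 1, so all \<open>Del ^ (r - t) * N1 ^ t\<close> send \<open>u\<close> to one weight
  space. For \<open>r = card B\<close> these \<open>r + 1\<close> vectors are dependent, which is a
  relation \<open>HP r Q\<close> on \<open>u\<close>.\<close>

lemma N1_eigenvector:
  assumes \<alpha>1: "\<alpha> 1 = 1"
  shows "\<exists>c v. v \<noteq> 0 \<and> app (N1 - K c * Del) v = 0"
proof -
  obtain w u where u: "u \<in> wsp w" "u \<noteq> 0" using wsp_exists wsp_0 by blast
  define r where "r = card (B)"
  define y where "y t = app (Del ^ (r - t) * N1 ^ t) u" for t
  have N: "app (N1 ^ t) u \<in> wsp (w + of_nat t)" for t
  proof (induction t)
    case (Suc t)
    then show ?case using X_wsp[OF Suc.IH, of 1 0] \<alpha>1 by (simp add: add_ac)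
  qed (simp add: u)
  have D: "app (Del ^ n) x \<in> wsp (z + of_nat n)" if "x \<in> wsp z" for n x z
  proof (induction n)
    case (Suc n)
    then show ?case using Del_wsp[OF Suc.IH] by (simp add: add_ac)
  qed (simp add: that)
  have y: "y t \<in> wsp (w + of_nat r)" if "t \<le> r" for t
    using D[OF N[of t], of "r - t"] that by (simp add: y_def of_nat_diff)
  have "\<exists>p. (\<exists>i\<in>{..r}. p i \<noteq> 0) \<and> (\<Sum>i\<in>{..r}. sc [:p i:] (y i)) = 0"
  proof (rule module_dependent_family[OF C.module_axioms Bw_finite])
    show "card (Bw (w + of_nat r)) < card {..r}" using Bw_card[of "w + of_nat r"] by (simp add: r_def)
    show "y i \<in> C.span (Bw (w + of_nat r))" if "i \<in> {..r}" for i
      using y[of i] that wsp_subset_span by auto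
  qed simp
  then obtain p k where p: "k \<le> r" "p k \<noteq> 0" "(\<Sum>i\<le>r. sc [:p i:] (y i)) = 0" by auto
  define Q where "Q = (\<Sum>i\<le>r. monom (p i) i)"
  have cQ: "coeff Q t = p t" if "t \<le> r" for t using that by (simp add: Q_def coeff_sum)
  have "app (HP r Q) u = 0"
    using p(3) by (simp add: HP_def app_sum_left cQ y_def)
  moreover have "Q \<noteq> 0" using cQ[OF p(1)] p(2) by auto
  moreover have "degree Q \<le> r" unfolding Q_def by (intro degree_sum_le) (auto intro: order.trans[OF degree_monom_le])
  ultimately show ?thesis using HP_eigenvector u(2) by blast
qed

primrec F :: "nat \<Rightarrow> 'a \<Rightarrow> 'a poly" where
  "F 0 v = A 0 v"
| "F (Suc j) v = map_poly (app N1) (F j v) - F j (app N1 v)"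

lemma F_ev: "ev y (F j v) = app ((ad N1 ^^ j) (Lm 0 y)) v"
proof (induction j arbitrary: v)
  case (Suc j)
  have "ev y (map_poly (app N1) (F j v)) = app N1 (ev y (F j v))"
    by (rule ev_map_poly) (simp_all add: Klin_app[OF Klin_X, unfolded app_X] A_add A_const coeff_map_poly)
  then show ?case using Suc.IH[of v] Suc.IH[of "app N1 v"] by (simp add: ad_def del: app_X)
qed simp

lemma F_coeff: "coeff (F j v) n = app ((ad N1 ^^ j) (X 0 n)) v"
proof (induction j arbitrary: v)
  case (Suc j)
  have "coeff (map_poly (app N1) (F j v)) n = app N1 (coeff (F j v) n)"
    by (rule coeff_map_poly) simp
  then show ?case using Suc.IH[of v] Suc.IH[of "app N1 v"] by (simp add: ad_def del: app_X)
qed simp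

text \<open>By \<open>ad_N1_chain\<close> the polynomial \<open>F j v\<close> is divisible by the
  power \<open>S j\<close> of its variable.\<close>

lemma ad_N1_X_zero:
  assumes "n < S j"
  shows "(ad N1 ^^ j) (X 0 n) = 0"
proof (rule endo_eqI, rule eq_by_linear_form)
  fix v l assume l: "linear_form l"
  have "poly (map_poly l (F j v)) y = poly (monom (Ee j * (- 1) ^ S j) (S j) * map_poly l (A j v)) y" for y
  proof -
    have "poly (map_poly l (F j v)) y = l (app (K (Ee j * (- y) ^ S j) * Lm j y) v)"
      by (simp only: linear_form_ev[OF l, symmetric] F_ev ad_N1_chain)
    also have "(- y) ^ S j = (- 1) ^ S j * y ^ S j" by (simp flip: power_mult_distrib)
    finally show ?thesis
      by (simp add: linear_form_simps[OF l] linear_form_ev[OF l] poly_monom)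
  qed
  then have "map_poly l (F j v) = monom (Ee j * (- 1) ^ S j) (S j) * map_poly l (A j v)"
    by (rule poly_extI)
  then have "coeff (map_poly l (F j v)) n = 0" using assms by (simp add: coeff_monom_mult)
  then show "l (app ((ad N1 ^^ j) (X 0 n)) v) = l (app 0 v)"
    by (simp add: coeff_map_poly linear_form_simps[OF l] F_coeff)
qed

text \<open>The generalised kernel of \<open>Q = N1 - K c * Del\<close> is nonzero by
  \<open>N1_eigenvector\<close>. It is stable under the coefficients of \<open>L_0\<close>, on which
  \<open>ad Q\<close> is nilpotent, and under \<open>N1\<close>, hence under \<open>L_1\<close>,
  which arises from \<open>ad N1\<close> on \<open>L_0\<close>. So it is everything, and the
  generators give a uniform exponent.\<close>

lemma N1_unipotent:
  assumes \<alpha>1: "\<alpha> 1 = 1" and k: "\<And>j. j \<le> S j + k"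
  shows "\<exists>c m. (N1 - K c * Del) ^ m = 0"
proof -
  obtain c v0 where v0: "v0 \<noteq> 0" "app (N1 - K c * Del) v0 = 0" using N1_eigenvector[OF \<alpha>1] by blast
  define Q where "Q = N1 - K c * Del"
  have KQ: "Klin Q" by (simp add: Q_def)
  have QSc: "Q * Sc p = Sc p * Q" for p
    using X_Sc[of 1 p] by (simp add: Q_def left_diff_distrib right_diff_distrib mult.commute flip: Sc_ring)
  have QSc': "app (Q ^ n) (sc p v) = sc p (app (Q ^ n) v)" for n p v
    using arg_cong[OF power_commuting_commutes[OF QSc[of p], of n], of "\<lambda>f. app f v"]
    by (simp only: app_ring app_Sc)
  define N where "N = {v. \<exists>n. app (Q ^ n) v = 0}"
  have up: "app (Q ^ n) v = 0" if "app (Q ^ m) v = 0" "m \<le> n" for m n v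
  proof -
    have "Q ^ n = Q ^ (n - m) * Q ^ m" using that(2) by (simp flip: power_add)
    then show ?thesis using that(1) by simp
  qed
  have sub: "subspace N"
  proof (rule subspaceI)
    show "0 \<in> N" by (simp add: N_def)
    fix p v w assume "v \<in> N"
    then obtain m where m: "app (Q ^ m) v = 0" by (auto simp: N_def)
    then show "sc p v \<in> N" unfolding N_def using QSc'[of m p v] by (intro CollectI exI[of _ m]) simp
    assume "w \<in> N"
    then obtain n where "app (Q ^ n) w = 0" by (auto simp: N_def)
    then show "v + w \<in> N" using up[OF m, of "max m n"] up[of n w "max m n"]
      unfolding N_def by (intro CollectI exI[of _ "max m n"]) simp
  qed
  have Q_pre: "v \<in> N" if Qv: "app Q v \<in> N" for v
  proof -
    obtain n where "app (Q ^ n) (app Q v) = 0" using Qv by (auto simp: N_def)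
    then have "app (Q ^ Suc n) v = 0" by (simp only: power_Suc2 app_ring(6))
    then show ?thesis unfolding N_def by blast
  qed
  \<comment> \<open>Such \<open>Y\<close> preserve \<open>N\<close>, since
    \<open>Q * Y = ad Q Y + Y * Q\<close> allows induction on both nilpotency exponents.\<close>
  define nil where "nil Y \<longleftrightarrow> (\<exists>J. (ad Q ^^ J) Y = 0)" for Y
  have ad_pow_0: "(ad Q ^^ n) 0 = 0" for n by (induction n) simp_all
  have nil_N: "app Y v \<in> N" if "nil Y" "v \<in> N" for Y v
  proof -
    obtain J where "(ad Q ^^ J) Y = 0" using \<open>nil Y\<close> by (auto simp: nil_def)
    then show ?thesis using \<open>v \<in> N\<close>
    proof (induction J arbitrary: Y v)
      case 0
      then show ?case using subspace_0[OF sub] by simp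
    next
      case (Suc J)
      have IH: "app (ad Q Y) w \<in> N" if "w \<in> N" for w
        using Suc.IH[of "ad Q Y"] Suc.prems(1) that by (simp add: funpow_swap1)
      obtain n where "app (Q ^ n) v = 0" using Suc.prems(2) by (auto simp: N_def)
      then show ?case
      proof (induction n arbitrary: v)
        case 0
        then show ?case using subspace_0[OF sub] by simp
      next
        case (Suc n)
        have "app (Q ^ n) (app Q v) = 0" using Suc.prems by (metis app_ring(6) power_Suc2)
        then have "app Y (app Q v) \<in> N" by (rule Suc.IH)
        moreover have "v \<in> N" using Suc.prems unfolding N_def by blast
        ultimately have "app (ad Q Y) v + app Y (app Q v) \<in> N"
          using IH by (intro subspace_add[OF sub]) auto
        then have "app Q (app Y v) \<in> N" by (simp add: ad_def)
        then show ?case by (rule Q_pre)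
      qed
    qed
  qed
  have nil_ad: "nil Y" if "nil (ad Q Y)" for Y
    using that unfolding nil_def by (metis comp_apply funpow_Suc_right)
  have nil_add: "nil (Y + Z)" if YZ: "nil Y" "nil Z" for Y Z
  proof -
    obtain a b where ab: "(ad Q ^^ a) Y = 0" "(ad Q ^^ b) Z = 0" using YZ by (auto simp: nil_def)
    have "(ad Q ^^ n) (Y + Z) = (ad Q ^^ n) Y + (ad Q ^^ n) Z" for n
      by (induction n) (simp_all add: ad_add)
    moreover have "(ad Q ^^ (b + a)) Y = 0" unfolding funpow_add comp_apply by (simp add: ab ad_pow_0)
    moreover have "(ad Q ^^ (b + a)) Z = 0" unfolding add.commute[of b] funpow_add comp_apply by (simp add: ab ad_pow_0)
    ultimately show ?thesis unfolding nil_def by (intro exI[of _ "b + a"]) simp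
  qed
  have nil_K: "nil (K z * Y)" if "nil Y" for z Y
  proof -
    have "(ad Q ^^ n) (K z * Y) = K z * (ad Q ^^ n) Y" for n
      by (induction n) (simp_all add: ad_K_mult[OF KQ])
    then show ?thesis using that unfolding nil_def by (metis mult_zero_right)
  qed
  have adQ: "ad Q Y = ad N1 Y - K c * ad Del Y" if "Klin Y" for Y
    using ad_K_mult_left[OF that, of c Del] by (simp add: Q_def ad_diff_left)
  have Klin_ad: "Klin ((ad N1 ^^ j) (X 0 n))" for j n
    by (induction j) (simp_all add: ad_def)
  have ad_Del_chain: "ad Del ((ad N1 ^^ j) Y) = (ad N1 ^^ j) (ad Del Y)" for j Y
    by (induction j) (simp_all add: ad_commute[OF N1_Del, symmetric])
  have ad_minus: "(ad N1 ^^ j) (- Y) = - (ad N1 ^^ j) Y" for j Y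
    by (induction j) (simp_all add: ad_def)
  have ad_N1_0: "(ad N1 ^^ j) 0 = 0" for j by (induction j) simp_all
  \<comment> \<open>\<open>ad Q\<close> raises \<open>j\<close> or, through \<open>ad Del\<close>,
    lowers \<open>n\<close>. For \<open>j > n + k\<close> the bound gives \<open>S j > n\<close> and
    the operator is zero; hence induction on \<open>n\<close> and, inside, downward on
    \<open>j\<close>.\<close>
  have nil_X: "nil ((ad N1 ^^ j) (X 0 n))" for j n
  proof (induction n arbitrary: j)
    case n: 0
    show ?case
    proof (induction "k + 1 - j" arbitrary: j)
      case 0
      then show ?case using k[of j] by (simp add: ad_N1_X_zero nil_def exI[of _ 0])
    next
      case (Suc i)
      have "ad Q ((ad N1 ^^ j) (X 0 0)) = (ad N1 ^^ Suc j) (X 0 0)"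
        by (simp add: adQ[OF Klin_ad] ad_Del_chain ad_Del_X ad_N1_0)
      moreover have "nil ((ad N1 ^^ Suc j) (X 0 0))" by (rule Suc.hyps(1)) (use Suc.hyps(2) in simp)
      ultimately show ?case by (metis nil_ad)
    qed
  next
    case n: (Suc n)
    show ?case
    proof (induction "Suc n + k + 1 - j" arbitrary: j)
      case 0
      then show ?case using k[of j] by (simp add: ad_N1_X_zero nil_def exI[of _ 0])
    next
      case (Suc i)
      have "ad Q ((ad N1 ^^ j) (X 0 (Suc n))) = (ad N1 ^^ Suc j) (X 0 (Suc n)) + K c * (ad N1 ^^ j) (X 0 n)"
        by (simp add: adQ[OF Klin_ad] ad_Del_chain ad_Del_X ad_minus)
      moreover have "nil ((ad N1 ^^ Suc j) (X 0 (Suc n)))"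
        by (rule Suc.hyps(1)) (use Suc.hyps(2) in simp)
      ultimately have "nil (ad Q ((ad N1 ^^ j) (X 0 (Suc n))))" using nil_K[OF n] nil_add by metis
      then show ?case by (rule nil_ad)
    qed
  qed
  have X0: "coeff (A 0 v) n \<in> N" if "v \<in> N" for v n
    using nil_N[OF nil_X[of 0 n] that] by simp
  then have L0: "ev x (A 0 v) \<in> N" if "v \<in> N" for v x
    unfolding ev_def using that by (intro subspace_sum[OF sub] subspace_scale[OF sub]) auto
  have N1N: "app N1 v \<in> N" if v: "v \<in> N" for v
  proof -
    have "app N1 v = app Q v + sc [:c:] (sc [:0, 1:] v)" by (simp add: Q_def)
    moreover have "app Q v \<in> N"
    proof -
      obtain n where "app (Q ^ n) v = 0" using v by (auto simp: N_def)
      then have "app (Q ^ n) (app Q v) = 0"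
        using up[of n v "Suc n"] by (metis app_ring(6) le_SucI order_refl power_Suc2)
      then show ?thesis by (auto simp: N_def)
    qed
    ultimately show ?thesis using that by (simp add: subspace_add[OF sub] subspace_scale[OF sub] del: scale_scale app_X)
  qed
  have L1nz: "ev x (A 1 v) \<in> N" if "v \<in> N" "x \<noteq> 0" for v x
  proof -
    define z where "z = e 0 * (- x) ^ d 0"
    have z: "z \<noteq> 0" using that(2) e_nz by (simp add: z_def)
    have "ev x (A 0 (app N1 v)) \<in> N" "app N1 (ev x (A 0 v)) \<in> N"
      using L0 N1N that(1) by blast+
    then have "app (ad N1 (Lm 0 x)) v \<in> N" unfolding ad_def by (simp add: subspace_diff[OF sub] del: app_X)
    then have "sc [:z:] (ev x (A 1 v)) \<in> N" unfolding ad_N1_Lm by (simp add: z_def One_nat_def)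
    then have "sc [:inverse z:] (sc [:z:] (ev x (A 1 v))) \<in> N" by (rule subspace_scale[OF sub])
    then show ?thesis using z by (simp add: sc_const_const flip: one_pCons)
  qed
  have L1: "ev x (A 1 v) \<in> N" if "v \<in> N" for v x
    unfolding ev_def
    by (intro subspace_sum[OF sub] subspace_scale[OF sub] coeff_mem_of_ev[OF subspace_imp_C[OF sub], of "- {0}"])
       (use L1nz[OF that] in \<open>auto simp: infinite_UNIV_char_0\<close>)
  have "v0 \<in> N" using v0(2) unfolding N_def Q_def by (intro CollectI exI[of _ 1]) simp
  then have UN: "N = UNIV"
    using stable_UNIV[OF sub] stable_of_stable01[OF sub L0 L1] v0(1) by blast
  then have "\<forall>v. \<exists>n. app (Q ^ n) v = 0" by (auto simp: N_def)
  then obtain m where m: "\<And>v. app (Q ^ m v) v = 0" by metis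
  define n where "n = Max (m ` B)"
  have B0: "app (Q ^ n) v = 0" if "v \<in> B" for v
    using up[OF m[of v], of n] that B_fin by (simp add: n_def)
  have "Q ^ n = 0"
  proof (rule endo_eqI)
    fix v
    have "v \<in> span B" using B_span by simp
    then have "app (Q ^ n) v = 0"
      by (induction rule: span_induct_alt) (simp_all add: QSc' B0)
    then show "app (Q ^ n) v = app 0 v" by simp
  qed
  then show ?thesis unfolding Q_def by blast
qed

end

section \<open>Linear relations along the chain and the remaining weights\<close>

context chain_rep
begin

text \<open>On \<open>w j\<close> the operator \<open>ad Del\<close> is the scalar
  \<open>- y\<close>, so \<open>ad Q\<close> is the shift plus \<open>c * y\<close>. As
  \<open>Q\<close> is nilpotent, \<open>(ad Q ^^ M) (Lm 0 y)\<close> vanishes, and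
  \<open>ad_binomial\<close> expands it.\<close>

lemma chain_relation:
  assumes Q: "(N1 - K c * Del) ^ m = 0" and M: "M \<ge> 2 * m"
  shows "(\<Sum>j\<le>M. K (of_nat (M choose j) * (c * y) ^ (M - j) * (Ee j * (- y) ^ S j)) * Lm j y) = 0"
proof -
  define Q where "Q = N1 - K c * Del"
  have KQ: "Klin Q" by (simp add: Q_def)
  define w where "w j = (ad N1 ^^ j) (Lm 0 y)" for j
  have w: "w j = K (Ee j * (- y) ^ S j) * Lm j y" for j by (simp only: w_def ad_N1_chain)
  have Del: "ad Del (w j) = K (- y) * w j" for j
  proof -
    have "ad Del (w j) = K (Ee j * (- y) ^ S j) * (K (- y) * Lm j y)"
      unfolding w by (subst ad_K_mult) (simp_all only: ad_Del_Lm Klin_intros)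
    also have "\<dots> = K (- y) * w j"
      unfolding w by (simp only: mult.assoc[symmetric] K_mult[symmetric] mult.commute)
    finally show ?thesis .
  qed
  have Klin_w: "Klin (w j)" for j unfolding w by (simp only: Klin_intros Klin_Lm)
  have "ad Q (w j) = w (Suc j) + K (c * y) * w j" for j
  proof -
    have "ad Q (w j) = ad N1 (w j) - K c * (K (- y) * w j)"
      by (simp only: Q_def ad_diff_left ad_K_mult_left[OF Klin_w] Del)
    also have "K c * (K (- y) * w j) = - (K (c * y) * w j)"
      by (simp only: mult.assoc[symmetric] K_mult[symmetric]) (simp only: mult_minus_right mult_minus_left K_minus)
    finally show ?thesis by (simp add: w_def)
  qed
  from ad_binomial[where w = w, OF KQ this, of M 0]
  have "(ad Q ^^ M) (w 0) = (\<Sum>j\<le>M. K (of_nat (M choose j) * (c * y) ^ (M - j)) * w j)" by simp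
  moreover have "(ad Q ^^ M) (w 0) = 0"
    by (rule ad_power_nilpotent_0[OF _ M]) (simp only: Q_def Q)
  ultimately show ?thesis unfolding w by (simp only: mult.assoc[symmetric] K_mult[symmetric])
qed

text \<open>Bracketing the relation at \<open>y\<close> with \<open>Lm 0 (\<rho> - y)\<close> makes
  every operator an \<open>Lm j \<rho>\<close>, leaving \<open>y\<close> only in the coefficients.
  The coefficient of \<open>y ^ Suc M\<close> isolates the indices with
  \<open>S j = j\<close>.\<close>

lemma chain_relation_diagonal:
  assumes \<alpha>1: "\<alpha> 1 = 1" and Q: "(N1 - K c * Del) ^ m = 0" and M: "M \<ge> 2 * m" and l: "linear_form l"
  shows "(\<Sum>j\<le>M. of_nat (M choose j) * c ^ (M - j) * Ee j * (if S j = j then (- 1) ^ j * l (ev \<rho> (A j v)) else 0)) = 0"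
proof -
  define g where "g j = of_nat (M choose j) * c ^ (M - j) * Ee j * (- 1) ^ S j * l (ev \<rho> (A j v))" for j
  define p where "p = (\<Sum>j\<le>M. monom (g j * \<alpha> j * \<rho>) (M - j + S j) - monom (g j * (\<alpha> j + 1)) (Suc (M - j + S j)))"
  have "poly p y = 0" for y
  proof -
    have "0 = ad (Lm 0 (\<rho> - y)) (\<Sum>j\<le>M. K (of_nat (M choose j) * (c * y) ^ (M - j) * (Ee j * (- y) ^ S j)) * Lm j y)"
      by (simp only: chain_relation[OF Q M] ad_zero)
    also have "\<dots> = (\<Sum>j\<le>M. K (of_nat (M choose j) * (c * y) ^ (M - j) * (Ee j * (- y) ^ S j) * (\<alpha> j * (\<rho> - y) - y)) * Lm j \<rho>)"
    proof -
      have "ad T (\<Sum>j\<in>J. f j) = (\<Sum>j\<in>J. ad T (f j))" for T and f :: "nat \<Rightarrow> 'a endo" and J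
        by (simp add: ad_def sum_distrib_left sum_distrib_right sum_subtractf)
      then show ?thesis
        by (simp only: ad_K_mult[OF Klin_Lm] ad_L0 mult.assoc[symmetric] K_mult[symmetric]) simp
    qed
    finally have "0 = l (app (\<Sum>j\<le>M. K (of_nat (M choose j) * (c * y) ^ (M - j) * (Ee j * (- y) ^ S j) * (\<alpha> j * (\<rho> - y) - y)) * Lm j \<rho>) v)"
      by (metis app_ring(1) linear_form_simps(1)[OF l])
    also have "\<dots> = (\<Sum>j\<le>M. of_nat (M choose j) * (c * y) ^ (M - j) * (Ee j * (- y) ^ S j) * (\<alpha> j * (\<rho> - y) - y) * l (ev \<rho> (A j v)))"
      by (simp only: app_sum_left linear_form_sum[OF l] app_ring app_Sc linear_form_simps[OF l] app_Lm)
    also have "\<dots> = poly p y"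
      unfolding p_def poly_sum
    proof (rule sum.cong)
      fix j
      have y: "(- y) ^ S j = (- 1) ^ S j * y ^ S j" by (simp flip: power_mult_distrib)
      show "of_nat (M choose j) * (c * y) ^ (M - j) * (Ee j * (- y) ^ S j) * (\<alpha> j * (\<rho> - y) - y) * l (ev \<rho> (A j v))
          = poly (monom (g j * \<alpha> j * \<rho>) (M - j + S j) - monom (g j * (\<alpha> j + 1)) (Suc (M - j + S j))) y"
        unfolding y by (simp add: g_def poly_monom power_mult_distrib power_add algebra_simps)
    qed simp
    finally show ?thesis by simp
  qed
  then have "p = 0" using poly_all_0_iff_0 by blast
  then have "0 = coeff p (Suc M)" by simp
  also have "\<dots> = (\<Sum>j\<le>M. - 2 * (if S j = j then g j else 0))"
    unfolding p_def coeff_sum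
  proof (rule sum.cong)
    fix j assume "j \<in> {..M}"
    \<comment> \<open>Besides \<open>S j = j\<close>, where \<open>\<alpha> j + 1 = 2\<close>, only
      \<open>S j = Suc j\<close> could contribute, but then \<open>\<alpha> j = 0\<close>.\<close>
    then have iff: "M - j + S j = Suc M \<longleftrightarrow> S j = Suc j" "Suc (M - j + S j) = Suc M \<longleftrightarrow> S j = j" by auto
    have "\<alpha> j = 1 + of_nat j - of_nat (S j)" using \<alpha>_formula[of j] by (simp add: \<alpha>1)
    then show "coeff (monom (g j * \<alpha> j * \<rho>) (M - j + S j) - monom (g j * (\<alpha> j + 1)) (Suc (M - j + S j))) (Suc M)
        = - 2 * (if S j = j then g j else 0)"
      unfolding coeff_diff coeff_monom iff by auto
  qed simp
  finally have "(\<Sum>j\<le>M. if S j = j then g j else 0) = 0" by (simp only: sum_distrib_left[symmetric]) simp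
  moreover have "(if S j = j then g j else 0) = of_nat (M choose j) * c ^ (M - j) * Ee j * (if S j = j then (- 1) ^ j * l (ev \<rho> (A j v)) else 0)" for j
    by (simp add: g_def)
  ultimately show ?thesis by simp
qed

text \<open>If \<open>S j \<noteq> j\<close> infinitely often, inversion of the diagonal relation
  kills its term at 0, that is \<open>L_0\<close>. Otherwise the diagonal relation is subtracted
  from the full one; the difference lives on the finitely many exceptional indices, and inversion
  kills those \<open>L_j\<close> as well.\<close>

lemma all_weights_one:
  assumes \<alpha>1: "\<alpha> 1 = 1" and Q: "(N1 - K c * Del) ^ m = 0" and c: "c \<noteq> 0" and nz: "\<And>j. \<exists>v. A j v \<noteq> 0"
  shows "S j = j"
proof -
  have pow: "c ^ (M - j) = c ^ M * inverse (c ^ j)" if "j \<le> M" "c \<noteq> 0" for M j and c :: complex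
    using that by (simp add: power_diff divide_inverse)
  have detect: "A j v = 0" if "\<And>l \<rho>. linear_form l \<Longrightarrow> \<rho> \<noteq> 0 \<Longrightarrow> l (ev \<rho> (A j v)) = 0" for j v
  proof (rule A_eq_0I[of "- {0}"])
    fix \<rho> :: complex assume \<rho>: "\<rho> \<in> - {0}"
    show "ev \<rho> (A j v) = 0"
      by (rule eq_by_linear_form) (use that \<rho> in \<open>simp add: linear_form_simps\<close>)
  qed (simp add: infinite_UNIV_char_0)
  define x where "x l \<rho> v j = (if S j = j then inverse (c ^ j) * Ee j * ((- 1) ^ j * l (ev \<rho> (A j v))) else 0)" for l \<rho> v j
  have relx: "(\<Sum>j\<le>M. of_nat (M choose j) * x l \<rho> v j) = 0" if l: "linear_form l" and M: "M \<ge> 2 * m" for l \<rho> v M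
  proof -
    have "c ^ M * (\<Sum>j\<le>M. of_nat (M choose j) * x l \<rho> v j)
        = (\<Sum>j\<le>M. of_nat (M choose j) * c ^ (M - j) * Ee j * (if S j = j then (- 1) ^ j * l (ev \<rho> (A j v)) else 0))"
      unfolding sum_distrib_left by (rule sum.cong) (auto simp: x_def pow c)
    then show ?thesis using chain_relation_diagonal[OF \<alpha>1 Q M l] c by simp
  qed
  have fin: "finite {j. S j \<noteq> j}"
  proof (rule ccontr)
    assume inf: "infinite {j. S j \<noteq> j}"
    have "A 0 v = 0" for v
    proof (rule detect)
      fix l \<rho> assume l: "linear_form l"
      have "infinite {j. x l \<rho> v j = 0}"
        by (rule infinite_super[OF _ inf]) (auto simp: x_def)
      then have "x l \<rho> v 0 = 0" using sum_choose_zero_imp_zero[of "2 * m" "x l \<rho> v"] relx[OF l] by blast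
      then show "l (ev \<rho> (A 0 v)) = 0" by (simp add: x_def S_def Ee_def)
    qed
    then show False using nz by blast
  qed
  show ?thesis
  proof (rule ccontr)
    assume j: "S j \<noteq> j"
    have "A j v = 0" for v
    proof (rule detect)
      fix l \<rho> assume l: "linear_form l" and \<rho>: "\<rho> \<noteq> (0 :: complex)"
      define x' where "x' j = inverse ((c * \<rho>) ^ j) * Ee j * ((- \<rho>) ^ S j * l (ev \<rho> (A j v)))" for j
      have rel': "(\<Sum>j\<le>M. of_nat (M choose j) * x' j) = 0" if M: "M \<ge> 2 * m" for M
      proof -
        have "0 = l (app (\<Sum>j\<le>M. K (of_nat (M choose j) * (c * \<rho>) ^ (M - j) * (Ee j * (- \<rho>) ^ S j)) * Lm j \<rho>) v)"
          unfolding chain_relation[OF Q M] by (simp add: linear_form_simps[OF l])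
        also have "\<dots> = (\<Sum>j\<le>M. of_nat (M choose j) * (c * \<rho>) ^ (M - j) * (Ee j * (- \<rho>) ^ S j) * l (ev \<rho> (A j v)))"
          by (simp only: app_sum_left linear_form_sum[OF l] app_ring app_Sc linear_form_simps[OF l] app_Lm)
        also have "\<dots> = (c * \<rho>) ^ M * (\<Sum>j\<le>M. of_nat (M choose j) * x' j)"
          unfolding sum_distrib_left by (rule sum.cong) (auto simp: x'_def pow c \<rho>)
        finally show ?thesis using c \<rho> by simp
      qed
      have same: "x' j = x l \<rho> v j" if "S j = j" for j
        using \<rho> that by (simp add: x'_def x_def power_mult_distrib power_minus[of \<rho>])
      have "x' j - x l \<rho> v j = 0"
      proof (rule sum_choose_zero_imp_zero[of "2 * m" "\<lambda>j. x' j - x l \<rho> v j"])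
        show "(\<Sum>j\<le>M. of_nat (M choose j) * (x' j - x l \<rho> v j)) = 0" if "M \<ge> 2 * m" for M
          using rel'[OF that] relx[OF l that] by (simp add: right_diff_distrib sum_subtractf)
        have "infinite (- {j. S j \<noteq> j})" using fin by (simp add: finite_compl)
        then show "infinite {j. x' j - x l \<rho> v j = 0}"
          by (rule infinite_super[rotated]) (auto simp: same)
      qed
      then show "l (ev \<rho> (A j v)) = 0" using j c \<rho> Ee_nz[of j] by (simp add: x'_def x_def)
    qed
    then show False using nz by blast
  qed
qed

text \<open>
  \<open>M c k i y\<close> is \<open>\<Sum>\<^sub>j (k choose j) (-c)\<^bsup>k-j\<^esup> K\<^bsub>i+j\<^esub>(y)\<close> with \<open>K\<^sub>j = E\<^sub>j L\<^sub>j\<close>; for weights \<open>1\<close> the index \<open>k\<close> goes up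
  under the adjoint action of \<open>L\<^sub>1 - c L\<^sub>0\<close>, and \<open>M c 1 0 = L\<^sub>1 - c L\<^sub>0\<close>.
\<close>

primrec qM :: "complex \<Rightarrow> nat \<Rightarrow> nat \<Rightarrow> 'a \<Rightarrow> 'a poly" where
  "qM c 0 i v = map_poly (sc [:Ee i:]) (A i v)"
| "qM c (Suc k) i v = qM c k (Suc i) v - map_poly (sc [:c:]) (qM c k i v)"

primrec M :: "complex \<Rightarrow> nat \<Rightarrow> nat \<Rightarrow> complex \<Rightarrow> 'a endo" where
  "M c 0 i y = K (Ee i) * Lm i y"
| "M c (Suc k) i y = M c k (Suc i) y - K c * M c k i y"

declare qM.simps [simp del] M.simps [simp del]

lemma ev_map_sc: "ev y (map_poly (sc p) q) = sc p (ev y q)"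
  by (rule ev_map_poly) (simp_all add: scale_right_distrib mult.commute)

lemma app_M: "app (M c k i y) v = ev y (qM c k i v)"
  by (induction k arbitrary: i) (simp_all add: qM.simps M.simps ev_map_sc)

lemma Klin_M: "Klin (M c k i y)"
  by (induction k arbitrary: i) (simp_all add: M.simps)

lemma M_Sc: "M c k i y * Sc p = Sc (pcompose p [:y, 1:]) * M c k i y"
proof (induction k arbitrary: i)
  case 0
  have "K (Ee i) * (Lm i y * Sc p) = Sc (pcompose p [:y, 1:]) * (K (Ee i) * Lm i y)"
    by (simp only: Lm_Sc mult.assoc[symmetric] Sc_ring(6)[symmetric] mult.commute)
  then show ?case by (simp only: M.simps mult.assoc)
next
  case (Suc k)
  have "K c * (Sc (pcompose p [:y, 1:]) * M c k i y) = Sc (pcompose p [:y, 1:]) * (K c * M c k i y)"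
    by (simp only: mult.assoc[symmetric] Sc_ring(6)[symmetric] mult.commute)
  then show ?case by (simp only: M.simps left_diff_distrib right_diff_distrib Suc.IH mult.assoc)
qed

text \<open>Nilpotency of \<open>L_1(0) - c \<partial>\<close> makes \<open>M c k 0\<close> vanish
  for some \<open>k\<close>; take the least. \<open>k = 0\<close> would give \<open>L_0 = 0\<close>.
  For \<open>k \<ge> 2\<close> the family before it commutes and consists of commutators with
  \<open>Q'\<close>, so it has a common kernel, which is stable under \<open>L_0\<close> and
  \<open>L_1\<close>. What remains is \<open>k = 1\<close>, the claim.\<close>

lemma second_generator_proportional:
  assumes \<alpha>1: "\<alpha> 1 = 1" and Q: "(N1 - K c * Del) ^ m = 0"
    and S: "\<And>j. S j = j" and nz: "\<And>j. \<exists>v. A j v \<noteq> 0"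
  shows "Lm 1 x = K c * Lm 0 x"
proof -
  have d: "d j = 1" for j using S[of "Suc j"] S[of j] by (simp add: S_def)
  have \<alpha>: "\<alpha> j = 1" for j using \<alpha>_formula[of j] by (simp add: \<alpha>1 S)
  have L0: "ad (Lm 0 x) (Lm j y) = K (x - y) * Lm j (x + y)" for j x y by (simp add: ad_L0 \<alpha>)
  have L1: "ad (Lm 1 x) (Lm j y) = K (e j * (x - y)) * Lm (Suc j) (x + y)" for j x y
    using ad_Lm[of 1 x j y] P_1_lin[OF \<alpha>1 \<alpha> d] by (simp only: plus_1_eq_Suc)
  have nzLm: "\<exists>x. x \<noteq> 0 \<and> Lm j x \<noteq> 0" for j using nz A_eq_0_of_Lm by metis
  \<comment> \<open>Compute the bracket of \<open>Lm 1 x\<close> with \<open>Lm 0 0\<close> from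
    either side.\<close>
  have e0: "e 0 = 1"
  proof -
    obtain x where x: "x \<noteq> 0" "Lm 1 x \<noteq> 0" using nzLm by blast
    have "ad (Lm 1 x) (Lm 0 0) = - ad (Lm 0 0) (Lm 1 x)" by (simp add: ad_def)
    then have "K (e 0 * x - x) * Lm 1 x = 0"
      by (simp add: L0 L1 K_diff left_diff_distrib K_minus flip: One_nat_def)
    then have "e 0 * x - x = 0" using K_mult_eq_0 x(2) by blast
    then show ?thesis using x(1) by simp
  qed
  let ?M = "M c"
  have M1: "ad (Lm 1 x) (?M k i y) = K (x - y) * ?M k (Suc i) (x + y)" for x y k i
  proof (induction k arbitrary: i)
    case 0
    have "ad (Lm 1 x) (K (Ee i) * Lm i y) = K (Ee i) * (K (e i * (x - y)) * Lm (Suc i) (x + y))"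
      by (simp only: ad_K_mult[OF Klin_Lm] L1)
    also have "\<dots> = K (x - y) * (K (Ee (Suc i)) * Lm (Suc i) (x + y))"
      by (simp only: mult.assoc[symmetric] K_mult[symmetric]) (simp add: Ee_def mult_ac)
    finally show ?case by (simp only: M.simps)
  next
    case (Suc k)
    have "K c * (K (x - y) * ?M k (Suc i) (x + y)) = K (x - y) * (K c * ?M k (Suc i) (x + y))"
      by (simp only: mult.assoc[symmetric] K_mult[symmetric] mult.commute)
    then show ?case by (simp only: M.simps ad_diff ad_K_mult[OF Klin_Lm] Suc.IH right_diff_distrib)
  qed
  have M0: "ad (Lm 0 x) (?M k i y) = K (x - y) * ?M k i (x + y)" for x y k i
  proof (induction k arbitrary: i)
    case 0
    show ?case
      by (simp only: M.simps ad_K_mult[OF Klin_Lm] L0 mult.assoc[symmetric] K_mult[symmetric] mult.commute)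
  next
    case (Suc k)
    have "K c * (K (x - y) * ?M k i (x + y)) = K (x - y) * (K c * ?M k i (x + y))"
      by (simp only: mult.assoc[symmetric] K_mult[symmetric] mult.commute)
    then show ?case by (simp only: M.simps ad_diff ad_K_mult[OF Klin_Lm] Suc.IH right_diff_distrib)
  qed
  define L' where "L' x = Lm 1 x - K c * Lm 0 x" for x
  have L'M: "ad (L' x) (?M k i y) = K (x - y) * ?M (Suc k) i (x + y)" for x y k i
  proof -
    have "K c * (K (x - y) * ?M k i (x + y)) = K (x - y) * (K c * ?M k i (x + y))"
      by (simp only: mult.assoc[symmetric] K_mult[symmetric] mult.commute)
    then show ?thesis
      by (simp only: L'_def ad_diff_left ad_K_mult_left[OF Klin_M] M0 M1 M.simps right_diff_distrib)
  qed
  have L'1: "L' x = ?M 1 0 x" for x by (simp add: L'_def One_nat_def Ee_def M.simps e0)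
  define Q' where "Q' = L' 0"
  have "Q' = N1 - K c * Del" by (simp only: Q'_def L'_def Lm_0 X00)
  then have nil: "Q' ^ m = 0" and KQ: "Klin Q'" using Q by simp_all
  have Q'M: "ad Q' (?M k i y) = K (- y) * ?M (Suc k) i y" for k i y
    using L'M[of 0 k i y] by (simp add: Q'_def)
  have zeroI: "\<forall>y. ?M k 0 y = 0" if "\<And>y. y \<noteq> 0 \<Longrightarrow> ?M k 0 y = 0" for k
  proof -
    have "qM c k 0 v = 0" for v
    proof -
      have "coeff (qM c k 0 v) n \<in> {0}" for n
      proof (rule coeff_mem_of_ev[OF C.subspace_single_0, of "- {0}"])
        show "ev z (qM c k 0 v) \<in> {0}" if "z \<in> - {0}" for z
          using \<open>\<And>y. y \<noteq> 0 \<Longrightarrow> ?M k 0 y = 0\<close>[of z] that by (simp flip: app_M)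
      qed (simp add: infinite_UNIV_char_0)
      then show ?thesis by (simp add: poly_eq_iff)
    qed
    then show ?thesis by (auto intro!: endo_eqI simp: app_M)
  qed
  have pw: "(ad Q' ^^ k) (?M 0 0 y) = K ((- y) ^ k) * ?M k 0 y" for k y
  proof (induction k)
    case (Suc k)
    have "(ad Q' ^^ Suc k) (?M 0 0 y) = K ((- y) ^ k) * (K (- y) * ?M (Suc k) 0 y)"
      by (simp only: funpow.simps comp_apply Suc.IH ad_K_mult[OF KQ] Q'M)
    then show ?case by (simp only: mult.assoc[symmetric] K_mult[symmetric] power_Suc2)
  qed simp
  have ex: "\<forall>y. ?M (2 * m) 0 y = 0"
  proof (rule zeroI)
    fix y :: complex assume "y \<noteq> 0"
    moreover have "K ((- y) ^ (2 * m)) * ?M (2 * m) 0 y = 0"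
      unfolding pw[symmetric] by (rule ad_power_nilpotent_0[OF nil]) simp
    ultimately show "?M (2 * m) 0 y = 0" using K_mult_eq_0 by (metis neg_equal_0_iff_equal power_not_zero)
  qed
  define k where "k = (LEAST k. \<forall>y. ?M k 0 y = 0)"
  have k: "\<forall>y. ?M k 0 y = 0" unfolding k_def by (rule LeastI[of _ "2 * m"]) (rule ex)
  have min: "\<not> (\<forall>y. ?M j 0 y = 0)" if "j < k" for j using not_less_Least[OF that[unfolded k_def]] .
  have "k \<noteq> 0"
  proof
    assume "k = 0"
    then have "Lm 0 y = 0" for y using k by (simp add: Ee_def M.simps)
    then show False using nzLm by blast
  qed
  moreover have "k \<noteq> Suc (Suc i)" for i
  proof
    assume i: "k = Suc (Suc i)"
    let ?Z = "?M (Suc i) 0"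
    have L'Z: "ad (L' x) (?Z y) = 0" for x y unfolding L'M using k i by simp
    have ZZ: "ad (?M (Suc j) 0 x) (?Z y) = 0" for j x y
    proof (induction j arbitrary: x y)
      case 0
      then show ?case using L'Z[of x y] by (simp only: L'1 One_nat_def)
    next
      case (Suc j)
      \<comment> \<open>The arguments have sum \<open>x\<close> and difference 1, so the scalar in
        \<open>L'M\<close> is 1.\<close>
      have "ad (L' ((x + 1) / 2)) (?M (Suc j) 0 ((x - 1) / 2)) = ?M (Suc (Suc j)) 0 x"
        unfolding L'M by (simp flip: add_divide_distrib diff_divide_distrib)
      then show ?case using ad_Jacobi[of "L' ((x + 1) / 2)" "?M (Suc j) 0 ((x - 1) / 2)" "?Z y"]
        by (simp add: Suc.IH L'Z)
    qed
    obtain u :: 'a where u: "u \<noteq> 0" using exists_nonzero by blast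
    have "\<exists>v. v \<noteq> 0 \<and> (\<forall>x. app (?Z x) v = 0)"
    proof (rule common_kernel_commutator[OF u app_M Klin_M ZZ nil KQ])
      show "ad Q' (?Z x) = 0" for x unfolding Q'_def by (rule L'Z)
      show "\<exists>c' T. c' \<noteq> 0 \<and> ad Q' T = K c' * ?Z x" if "x \<noteq> 0" for x
        by (intro exI[of _ "- x"] exI[of _ "?M i 0 x"]) (use that Q'M in simp)
    qed
    then obtain v where v: "v \<noteq> 0" "\<And>x. app (?Z x) v = 0" by blast
    define W where "W = {v. \<forall>x. app (?Z x) v = 0}"
    have sub: "subspace W"
    proof (rule subspaceI)
      fix p w assume w: "w \<in> W"
      have "app (?Z x) (sc p w) = app (?Z x * Sc p) w" for x by (simp only: app_ring app_Sc)
      then show "sc p w \<in> W" using w unfolding W_def by (simp only: M_Sc) simp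
    qed (simp_all add: W_def app_add_right)
    have comm: "app (?Z y) (app T w) = app T (app (?Z y) w) - app (ad T (?Z y)) w" for T y w
      by (simp add: ad_def)
    have W0: "app (Lm 0 x) w \<in> W" if "w \<in> W" for x w
      using that unfolding W_def by (simp only: mem_Collect_eq comm M0 app_ring app_Sc) simp
    have WL': "app (L' x) w \<in> W" if "w \<in> W" for x w
      using that unfolding W_def by (simp only: mem_Collect_eq comm L'Z app_ring) simp
    have W1: "app (Lm 1 x) w \<in> W" if "w \<in> W" for x w
    proof -
      have "app (Lm 1 x) w = app (L' x) w + sc [:c:] (app (Lm 0 x) w)" by (simp add: L'_def)
      then show ?thesis using WL'[OF that] W0[OF that] by (simp only: subspace_add[OF sub] subspace_scale[OF sub])
    qed
    have "W = UNIV"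
    proof (rule stable_UNIV[OF sub])
      show "v \<in> W" using v by (simp add: W_def)
      show "ev x (A i w) \<in> W" if "w \<in> W" for i x w
        using stable_of_stable01[OF sub _ _ that] W0 W1 by (simp only: app_Lm)
    qed (rule v)
    then have "?Z y = 0" for y by (intro endo_eqI) (auto simp: W_def)
    then show False using min[of "Suc i"] i by simp
  qed
  ultimately have "k = 1" by (metis One_nat_def not0_implies_Suc)
  then have "L' x = 0" using k L'1 by simp
  then show ?thesis by (simp add: L'_def)
qed

end

section \<open>Generators of the irreducible representations\<close>

context chain_rep
begin

lemma proportional_to_first:
  "\<alpha> 1 = 1 \<and> (\<forall>j. \<exists>k. \<forall>x. Lm j x = K k * Lm 0 x)"
proof -
  obtain k where \<alpha>1: "\<alpha> 1 = 1" and k: "\<And>j. j \<le> S j + k" and nz: "\<And>j. \<exists>v. A j v \<noteq> 0"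
    using \<alpha>1_eq_1_and_bound by blast
  obtain c m where Q: "(N1 - K c * Del) ^ m = 0" using N1_unipotent[OF \<alpha>1 k] by blast
  have c: "c \<noteq> 0"
  proof
    assume "c = 0"
    then show False using Q N1_not_nilpotent[of m] by simp
  qed
  have S: "S j = j" for j by (rule all_weights_one[OF \<alpha>1 Q c nz])
  have L1: "Lm 1 x = K c * Lm 0 x" for x by (rule second_generator_proportional[OF \<alpha>1 Q S nz])
  have d: "d j = 1" for j using S[of "Suc j"] S[of j] by (simp add: S_def)
  have \<alpha>: "\<alpha> j = 1" for j using \<alpha>_formula[of j] by (simp add: \<alpha>1 S)
  have "\<exists>k. \<forall>x. Lm j x = K k * Lm 0 x" for j
  proof (induction j)
    case 0
    show ?case by (intro exI[of _ 1]) simp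
  next
    case (Suc j)
    then obtain k where k: "\<And>x. Lm j x = K k * Lm 0 x" by blast
    have "Lm (Suc j) z = K (inverse (e j) * (c * k)) * Lm 0 z" for z
    proof -
      \<comment> \<open>Sum \<open>z\<close> and difference 1 remove the linear factors from both
        brackets.\<close>
      define x y where "x = (z + 1) / 2" and "y = (z - 1) / 2"
      have xy: "x - y = 1" "x + y = z" by (simp_all add: x_def y_def flip: add_divide_distrib diff_divide_distrib)
      have "ad (Lm 1 x) (Lm j y) = K (e j) * Lm (Suc j) z"
        using ad_Lm[of 1 x j y] P_1_lin[OF \<alpha>1 \<alpha> d] xy by (simp only: plus_1_eq_Suc mult_1_right)
      moreover have "ad (Lm 1 x) (Lm j y) = K c * (K k * Lm 0 z)"
      proof -
        have "ad (Lm 0 x) (Lm 0 y) = Lm 0 z" using ad_L0[of x 0 y] xy by (simp add: \<alpha>_0)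
        moreover have "K k * (K c * Lm 0 z) = K c * (K k * Lm 0 z)"
          by (simp only: mult.assoc[symmetric] K_mult[symmetric] mult.commute)
        ultimately show ?thesis
          unfolding L1 k by (simp only: ad_K_mult_left ad_K_mult Klin_Lm Klin_intros)
      qed
      ultimately have "K (inverse (e j)) * (K (e j) * Lm (Suc j) z) = K (inverse (e j)) * (K c * (K k * Lm 0 z))"
        by simp
      then show ?thesis using e_nz[of j] by (simp only: mult.assoc[symmetric] K_mult[symmetric]) simp
    qed
    then show ?case by blast
  qed
  with \<alpha>1 show ?thesis by blast
qed

end

context homog_rep
begin

lemma A_eq_0_of_generator:
  assumes "span {v0} = UNIV" "A i v0 = 0"
  shows "A i v = 0"
proof -
  have "v \<in> span {v0}" using assms(1) by simp
  then obtain p where "v = sc p v0" by (auto simp: span_single)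
  then show ?thesis using assms(2) by (intro A_eq_0I[of UNIV]) (simp_all add: A_scale infinite_UNIV_char_0)
qed

text \<open>For \<open>\<Delta> = 0\<close> the image of \<partial> would be a proper nonzero
  submodule, because \<open>L_0\<close> sends \<partial>v0 to (\<partial> +
  \<lambda>)\<partial>v0.\<close>

lemma conformal_weight_nonzero:
  assumes v0: "v0 \<noteq> 0" and L0: "\<And>x. ev x (A 0 v0) = sc [:\<Delta> * x, 1:] v0"
    and L: "\<And>i x v. \<exists>k. ev x (A i v) = sc [:k:] (ev x (A 0 v))"
  shows "\<Delta> \<noteq> 0"
proof
  assume "\<Delta> = 0"
  define u where "u = sc [:0, 1:] v0"
  have u: "u \<noteq> 0" using v0 by (simp add: u_def torsion_free)
  have L0u: "ev x (A 0 (sc p u)) \<in> span {u}" for x p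
  proof -
    have "ev x (A 0 (sc p u)) = sc (pcompose (p * [:0, 1:]) [:x, 1:]) u"
      using \<open>\<Delta> = 0\<close> by (simp only: u_def scale_scale A_scale L0 mult_zero_left)
    then show ?thesis by (auto simp: span_single)
  qed
  have "span {u} = UNIV"
  proof (rule stable_UNIV[of "span {u}" u])
    show "ev x (A i v) \<in> span {u}" if v: "v \<in> span {u}" for i x v
    proof -
      obtain p where "v = sc p u" using v by (auto simp: span_single)
      moreover obtain k where "ev x (A i v) = sc [:k:] (ev x (A 0 v))" using L by blast
      ultimately show ?thesis using L0u by (metis subspace_scale[OF subspace_span])
    qed
  qed (use u in \<open>auto intro: span_base\<close>)
  then obtain p where "v0 = sc p u" by (metis UNIV_I rangeE span_single)
  then have "sc (1 - p * [:0, 1:]) v0 = 0" by (simp add: u_def scale_left_diff_distrib del: mult_pCons_right)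
  then have "1 - p * [:0, 1:] = 0" using v0 torsion_free by blast
  then have "poly (1 - p * [:0, 1:]) 0 = 0" by simp
  then show False by simp
qed

theorem generator:
  obtains v0 \<Delta> \<gamma> k where "v0 \<noteq> 0" "span {v0} = UNIV" "\<And>x. ev x (A 0 v0) = sc [:\<Delta> * x, 1:] v0"
    "(\<forall>i\<ge>1. A i v0 = 0) \<and> \<Delta> \<noteq> 0 \<or>
     \<alpha> 1 = 0 \<and> \<gamma> \<noteq> 0 \<and> (\<forall>x. ev x (A 1 v0) = sc [:\<gamma>:] v0) \<and> (\<forall>i\<ge>2. A i v0 = 0) \<or>
     \<alpha> 1 = 1 \<and> \<Delta> \<noteq> 0 \<and> (\<forall>i x. ev x (A i v0) = sc [:k i:] (ev x (A 0 v0)))"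
proof -
  obtain B wt where B: "finite B" "span B = UNIV" "\<And>e. e \<in> B \<Longrightarrow> e \<in> wsp (wt e)" "\<And>e. e \<in> B \<Longrightarrow> e \<noteq> 0"
    by (rule homogeneous_generators, rule that)
  interpret homog_rep_gen sc A P \<alpha> B wt by unfold_locales (use B in auto)
  obtain w where w: "wsp w \<noteq> {0}" "\<And>w'. Re w' < Re w \<Longrightarrow> wsp w' = {0}"
    using lowest_weight by blast
  obtain u where u: "u \<in> wsp w" "u \<noteq> 0" using w(1) wsp_0 by blast
  have L0: "ev x (A 0 v) = sc [:w * x, 1:] v" if "v \<in> wsp w" for v x
    using L0_lowest[OF that w(2)] .
  have L0s: "ev x (A 0 v) \<in> span {v}" if "v \<in> wsp w" for v x
    unfolding L0[OF that] by (simp add: span_single)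
  show thesis
  proof (cases "\<forall>v. A 1 v = 0")
    case True
    have z: "A i v = 0" if "i \<ge> 1" for i v
      using that True higher_zero by (cases i) auto
    show ?thesis
    proof (rule that[of u w])
      show "span {u} = UNIV" by (rule generates) (use u L0s z in \<open>auto intro: span_zero\<close>)
      have "w \<noteq> 0"
      proof (rule conformal_weight_nonzero[OF u(2) L0[OF u(1)]])
        show "\<exists>k. ev x (A i v) = sc [:k:] (ev x (A 0 v))" for i x v
          by (cases "i = 0") (auto simp: z Suc_le_eq one_pCons[symmetric] intro: exI[of _ 0] exI[of _ 1])
      qed
      then show "(\<forall>i\<ge>1. A i u = 0) \<and> w \<noteq> 0 \<or>
          \<alpha> 1 = 0 \<and> 0 \<noteq> 0 \<and> (\<forall>x. ev x (A 1 u) = sc [:0:] u) \<and> (\<forall>i\<ge>2. A i u = 0) \<or>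
          \<alpha> 1 = 1 \<and> w \<noteq> 0 \<and> (\<forall>i x. ev x (A i u) = sc [:0:] (ev x (A 0 u)))"
        using z by blast
    qed (use u L0 in auto)
  next
    case L1: False
    show ?thesis
    proof (cases "\<alpha> 1 = 0")
      case True
      let ?N = "X 1 0"
      have N: "app ?N v \<in> wsp w" if "v \<in> wsp w" for v
        using X_wsp[OF that, of 1 0] True by simp
      have pow: "app (?N ^ t) u \<in> wsp w" for t
        by (induction t) (simp_all only: power_0 power_Suc app_ring N u)
      define r where "r = card B"
      have "\<exists>p. (\<exists>i\<in>{..r}. p i \<noteq> 0) \<and> (\<Sum>i\<in>{..r}. sc [:p i:] (app (?N ^ i) u)) = 0"
      proof (rule module_dependent_family[OF C.module_axioms Bw_finite])
        show "card (Bw w) < card {..r}" using Bw_card[of w] by (simp add: r_def)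
        show "app (?N ^ i) u \<in> C.span (Bw w)" if "i \<in> {..r}" for i
          using pow wsp_subset_span by blast
      qed simp
      then obtain p j where p: "j \<le> r" "p j \<noteq> 0" "(\<Sum>i\<le>r. sc [:p i:] (app (?N ^ i) u)) = 0" by auto
      define Q where "Q = (\<Sum>i\<le>r. monom (p i) i)"
      have "coeff Q j = p j" using p(1) by (simp add: Q_def coeff_sum)
      then have "Q \<noteq> 0" using p(2) by auto
      moreover have "app (PE Q ?N) u = 0"
        using p(3) by (simp add: Q_def PE_sum PE_monom app_sum_left)
      ultimately obtain \<gamma> R where R: "app (PE R ?N) u \<noteq> 0"
          "app ?N (app (PE R ?N) u) = sc [:\<gamma>:] (app (PE R ?N) u)"
        using PE_eigenvector[OF Klin_X _ u(2)] by blast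
      \<comment> \<open>A polynomial in \<open>?N\<close> applied to \<open>u\<close>, so still of
        lowest weight; this kills the higher coefficients of \<open>A 1 v0\<close>.\<close>
      define v0 where "v0 = app (PE R ?N) u"
      have v0: "v0 \<noteq> 0" using R by (simp add: v0_def)
      have v0w: "v0 \<in> wsp w"
        unfolding v0_def
      proof (induction R)
        case (pCons a R)
        then show ?case
          by (simp only: PE_pCons app_ring app_Sc) (intro C.subspace_add[OF wsp_subspace] C.subspace_scale[OF wsp_subspace] N u)
      qed simp
      have "coeff (A 1 v0) n = 0" if "n > 0" for n
        using X_wsp[OF v0w, of 1 n] w(2)[of "w + \<alpha> 1 - of_nat n"] True that by auto
      then have "degree (A 1 v0) \<le> 0" by (intro degree_le) auto
      then have A1: "ev x (A 1 v0) = sc [:\<gamma>:] v0" for x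
        using R(2) by (simp add: ev_bound[of _ 0] v0_def flip: one_pCons)
      have gen: "span {v0} = UNIV"
        by (rule generates[OF v0 L0s[OF v0w]]) (simp add: A1 span_single)
      have "\<gamma> \<noteq> 0"
      proof
        assume "\<gamma> = 0"
        then have "A 1 v0 = 0" by (intro A_eq_0I[of UNIV]) (simp_all add: A1 infinite_UNIV_char_0)
        then show False using L1 A_eq_0_of_generator[OF gen] by blast
      qed
      have A2: "A 2 v0 = 0"
      proof (rule A_eq_0I[OF P_1[of 1]], safe)
        fix r x assume nz: "P 1 1 x (r - x) \<noteq> 0"
        \<comment> \<open>On \<open>v0\<close> the operators \<open>Lm 1 x\<close> are the constant
          \<open>\<gamma>\<close>, free of \<partial>, and hence commute there.\<close>
        have "sc [:P 1 1 x (r - x):] (ev r (A 2 v0)) = 0"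
          using A_comm[of x 1 "r - x" 1 v0] by (simp only: A1 A_scale) (simp add: A1 pcompose_pCons)
        then show "ev r (A 2 v0) = 0" using nz by simp
      qed
      have higher: "A i v0 = 0" if "i \<ge> 2" for i
      proof -
        have "\<forall>v. A i v = 0"
          using that by (induction i rule: dec_induct) (use A_eq_0_of_generator[OF gen A2] higher_zero in blast)+
        then show ?thesis ..
      qed
      show ?thesis
        by (rule that[of v0 w \<gamma>]) (use v0 gen L0[OF v0w] True \<open>\<gamma> \<noteq> 0\<close> A1 higher in auto)
    next
      case False
      have "\<forall>j. \<exists>ed. fst ed \<noteq> 0 \<and> \<alpha> (Suc j) = \<alpha> 1 + \<alpha> j - of_nat (snd ed) \<and> (\<forall>y. P 1 j 0 y = fst ed * (- y) ^ snd ed) \<and>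
        (\<alpha> 1 = 1 \<and> \<alpha> j = 1 \<and> snd ed = 1 \<longrightarrow> (\<forall>x y. P 1 j x y = fst ed * (x - y)))"
        using P_1_shape[OF False refl] by simp
      from choice[OF this] obtain ed where ed: "\<And>j. fst (ed j) \<noteq> 0 \<and> \<alpha> (Suc j) = \<alpha> 1 + \<alpha> j - of_nat (snd (ed j)) \<and>
        (\<forall>y. P 1 j 0 y = fst (ed j) * (- y) ^ snd (ed j)) \<and>
        (\<alpha> 1 = 1 \<and> \<alpha> j = 1 \<and> snd (ed j) = 1 \<longrightarrow> (\<forall>x y. P 1 j x y = fst (ed j) * (x - y)))"
        by blast
      interpret chain_rep sc A P \<alpha> B wt "\<lambda>j. fst (ed j)" "\<lambda>j. snd (ed j)"
        by unfold_locales (use ed False L1 in auto)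
      have \<alpha>1: "\<alpha> 1 = 1" using proportional_to_first by blast
      have "\<forall>j. \<exists>k. \<forall>x. Lm j x = K k * Lm 0 x" using proportional_to_first by blast
      from choice[OF this] obtain k where k': "\<forall>j x. Lm j x = K (k j) * Lm 0 x" ..
      have k: "ev x (A j v) = sc [:k j:] (ev x (A 0 v))" for j x v
        using arg_cong[OF k'[rule_format, of j x], of "\<lambda>T. app T v"] by (simp only: app_Lm app_ring app_Sc)
      have gen: "span {u} = UNIV"
        by (rule generates[OF u(2) L0s[OF u(1)]])
           (subst k, intro subspace_scale[OF subspace_span] L0s u)
      have "w \<noteq> 0" by (rule conformal_weight_nonzero[OF u(2) L0[OF u(1)]]) (rule exI, rule k)
      then show ?thesis
        using that[of u w 0 k, OF u(2) gen L0[OF u(1)]] \<alpha>1 k by blast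
    qed
  qed
qed

end

context graded_rep
begin

lemma \<beta>_formula: "\<beta> j = of_nat j * \<beta> 1"
  by (induction j) (simp_all only: \<beta>_0 \<beta>_Suc, simp_all add: algebra_simps)

text \<open>
  \<open>L\<^sub>0\<close> at \<open>\<lambda> = 0\<close> acts as \<open>\<partial> + c\<close>; letting the indeterminate act as \<open>\<partial> + c\<close> instead makes the
  representation homogeneous. If \<open>\<beta> 1 \<noteq> 0\<close>, then all \<open>L\<^sub>i\<close> with \<open>i \<ge> 1\<close> act as zero, so their weights
  may be changed to \<open>0\<close>.
\<close>

theorem classification:
  obtains v0 \<Delta> c \<gamma> k where "v0 \<noteq> 0" "span {v0} = UNIV" "\<And>x. ev x (A 0 v0) = sc [:\<Delta> * x + c, 1:] v0"
    "(\<forall>i\<ge>1. A i v0 = 0) \<and> \<Delta> \<noteq> 0 \<or>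
     \<alpha> 1 = 0 \<and> \<gamma> \<noteq> 0 \<and> (\<forall>x. ev x (A 1 v0) = sc [:\<gamma>:] v0) \<and> (\<forall>i\<ge>2. A i v0 = 0) \<or>
     \<alpha> 1 = 1 \<and> \<Delta> \<noteq> 0 \<and> (\<forall>i x. ev x (A i v0) = sc [:k i:] (ev x (A 0 v0)))"
proof -
  obtain c where c: "X 0 0 = Del + K c" and \<beta>: "\<beta> 1 = 0 \<or> (\<forall>i\<ge>1. \<forall>v. A i v = 0)"
    using X00_scalar by blast
  define sc' where "sc' p = sc (pcompose p [:c, 1:])" for p
  have module: "module sc'"
    by unfold_locales (simp_all add: sc'_def scale_right_distrib scale_left_distrib pcompose_add pcompose_mult pcompose_1)
  interpret T: cmodule sc' using module by (rule cmodule.intro)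
  have const: "sc' [:z:] = sc [:z:]" for z by (simp add: sc'_def)
  have ev: "T.ev z q = ev z q" for z q by (simp only: T.ev_def ev_def const)
  have sc_sc': "sc p = sc' (pcompose p [:- c, 1:])" for p
    by (simp add: sc'_def pcompose_pCons pcompose_idR flip: pcompose_assoc)
  have sub: "T.subspace N \<longleftrightarrow> subspace N" for N
    unfolding T.subspace_def subspace_def using sc_sc' sc'_def by metis
  have "T.subspace = subspace" by (rule ext) (rule sub)
  then have span: "T.span S = span S" for S by (simp only: T.span_def span_def)
  \<comment> \<open>If \<open>\<beta> 1 \<noteq> 0\<close>, the value \<open>\<alpha>' 1 = 0\<close>
    makes \<open>P_1_shape\<close> vacuous, while \<open>\<alpha>' 0 = 1\<close> is kept.\<close>
  define \<alpha>' where "\<alpha>' j = (if \<beta> 1 = 0 \<or> j = 0 then \<alpha> j else 0)" for j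
  define P' where "P' i j x y = (if i = 0 then \<alpha>' j * x - y else P i j x y)" for i j x y
  interpret T: graded_rep sc' A P' \<alpha>' "\<lambda>_. 0"
  proof unfold_locales
    show "A i (v + w) = A i v + A i w" for i v w by (rule A_add)
    show "T.ev z (A i (sc' p v)) = sc' (pcompose p [:z, 1:]) (T.ev z (A i v))" for z i p v
      unfolding ev sc'_def A_scale by (simp add: pcompose_pCons add.commute flip: pcompose_assoc)
    show "T.ev x (A i (T.ev y (A j v))) - T.ev y (A j (T.ev x (A i v)))
        = sc' [:P' i j x y:] (T.ev (x + y) (A (i + j) v))" for x y i j v
    proof (cases "i = 0 \<and> (j = 0 \<or> \<beta> 1 = 0)")
      case True
      then have "P' i j x y = P i j x y" using \<beta>_0 \<beta>_formula[of j] by (auto simp: P'_def \<alpha>'_def P_0)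
      then show ?thesis unfolding ev const by (simp only: A_comm)
    next
      case False
      show ?thesis
      proof (cases "i = 0")
        case True
        then have "A j v = 0" for v using False \<beta> by auto
        then show ?thesis using True by (simp add: ev)
      next
        case i: False
        then show ?thesis unfolding ev const by (simp only: A_comm P'_def if_False)
      qed
    qed
    show "P' 0 j x y = \<alpha>' j * x - y + 0" for j x y by (simp add: P'_def)
    show "\<alpha>' 0 = 1" by (simp add: \<alpha>'_def \<alpha>_0)
    show "infinite {r. \<exists>x. P' 1 j x (r - x) \<noteq> 0}" for j using P_1[of j] by (simp add: P'_def)
    show "\<exists>e d. e \<noteq> 0 \<and> \<alpha>' (Suc j) = \<alpha>' 1 + \<alpha>' j - of_nat d \<and> (\<forall>y. P' 1 j 0 y = e * (- y) ^ d) \<and>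
        (\<alpha>' 1 = 1 \<and> \<alpha>' j = 1 \<and> d = 1 \<longrightarrow> (\<forall>x y. P' 1 j x y = e * (x - y)))" if "\<alpha>' 1 \<noteq> 0" for j
    proof -
      have "\<beta> 1 = 0" "\<alpha> 1 \<noteq> 0" using that by (auto simp: \<alpha>'_def split: if_splits)
      then show ?thesis using P_1_shape[of j] by (simp add: \<alpha>'_def P'_def)
    qed
    show "N = {0} \<or> N = UNIV" if "T.subspace N" "\<And>i x v. v \<in> N \<Longrightarrow> T.ev x (A i v) \<in> N" for N
      using irred[of N] that by (simp only: sub ev)
    show "\<exists>i v. A i v \<noteq> 0" by (rule nontriv)
    show "\<exists>S. finite S \<and> T.span S = UNIV" using fin_gen by (simp only: span)
  qed simp_all
  interpret T: homog_rep sc' A P' \<alpha>'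
  proof unfold_locales
    have "coeff (A 0 v) 0 = sc' [:0, 1:] v" for v
      using arg_cong[OF c, of "\<lambda>f. app f v"] by (simp add: sc'_def pcompose_pCons flip: scale_left_distrib)
    then show "T.X 0 0 = T.Del" by (intro endo_eqI) simp
  qed
  obtain v0 \<Delta> \<gamma> k where v0: "v0 \<noteq> 0" "T.span {v0} = UNIV" "\<And>x. T.ev x (A 0 v0) = sc' [:\<Delta> * x, 1:] v0"
    "(\<forall>i\<ge>1. A i v0 = 0) \<and> \<Delta> \<noteq> 0 \<or>
     \<alpha>' 1 = 0 \<and> \<gamma> \<noteq> 0 \<and> (\<forall>x. T.ev x (A 1 v0) = sc' [:\<gamma>:] v0) \<and> (\<forall>i\<ge>2. A i v0 = 0) \<or>
     \<alpha>' 1 = 1 \<and> \<Delta> \<noteq> 0 \<and> (\<forall>i x. T.ev x (A i v0) = sc' [:k i:] (T.ev x (A 0 v0)))"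
    by (rule T.generator, rule that)
  show thesis
  proof (rule that[of v0 \<Delta> c \<gamma> k])
    show "ev x (A 0 v0) = sc [:\<Delta> * x + c, 1:] v0" for x
      using v0(3)[of x] by (simp add: ev sc'_def pcompose_pCons)
    show "(\<forall>i\<ge>1. A i v0 = 0) \<and> \<Delta> \<noteq> 0 \<or>
     \<alpha> 1 = 0 \<and> \<gamma> \<noteq> 0 \<and> (\<forall>x. ev x (A 1 v0) = sc [:\<gamma>:] v0) \<and> (\<forall>i\<ge>2. A i v0 = 0) \<or>
     \<alpha> 1 = 1 \<and> \<Delta> \<noteq> 0 \<and> (\<forall>i x. ev x (A i v0) = sc [:k i:] (ev x (A 0 v0)))"
    proof (cases "\<beta> 1 = 0")
      case True
      then show ?thesis using v0(4) unfolding ev const by (simp add: \<alpha>'_def)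
    next
      case False
      then have "A 1 v0 = 0" using \<beta> by auto
      \<comment> \<open>The artificial weight 0 must not let the second alternative through: it
        would need \<open>\<gamma>\<close> times \<open>v0\<close> to vanish.\<close>
      then have "\<not> (\<gamma> \<noteq> 0 \<and> (\<forall>x. ev x (A 1 v0) = sc [:\<gamma>:] v0))" using v0(1) by auto
      moreover have "\<alpha>' 1 \<noteq> 1" using False by (simp add: \<alpha>'_def)
      ultimately show ?thesis using v0(4) unfolding ev const by blast
    qed
  qed (use v0 in \<open>simp_all only: span not_False_eq_True\<close>)
qed

end

section \<open>The structure polynomials\<close>

lemma monomial_of_Euler_equation:
  fixes h :: "complex poly"
  assumes "h \<noteq> 0" and eq: "\<And>t. t * poly (pderiv h) t = \<kappa> * poly h t"
  obtains s m where "s \<noteq> 0" "h = monom s m" "\<kappa> = of_nat m"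
proof -
  have "pCons 0 (pderiv h) = smult \<kappa> h"
    by (rule poly_extI) (simp add: eq)
  then have c: "of_nat n * coeff h n = \<kappa> * coeff h n" for n
    by (metis coeff_pCons_0 coeff_pCons_Suc coeff_pderiv coeff_smult mult_zero_left of_nat_0 not0_implies_Suc)
  define m where "m = degree h"
  have m: "coeff h m \<noteq> 0" using assms(1) by (simp add: m_def)
  then have \<kappa>: "\<kappa> = of_nat m" using c[of m] by simp
  have "coeff h n = 0" if "n \<noteq> m" for n using c[of n] that by (simp add: \<kappa>)
  then have "h = monom (coeff h m) m" by (intro poly_eqI) simp
  then show thesis using that m \<kappa> by blast
qed

text \<open>The constants are infinitely many candidates for roots in a domain.\<close>

lemma poly_const_arg_nonzero:
  assumes "(p :: complex poly poly) \<noteq> 0"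
  shows "\<exists>x. poly p [:x:] \<noteq> 0"
proof (rule ccontr)
  assume "\<not> ?thesis"
  then have "range (\<lambda>x. [:x:]) \<subseteq> {q. poly p q = 0}" by auto
  then have "finite (range (\<lambda>x :: complex. [:x:]))" using poly_roots_finite[OF assms] finite_subset by blast
  then have "finite (UNIV :: complex set)" by (rule finite_imageD) (simp add: inj_on_def)
  then show False by (simp add: infinite_UNIV_char_0)
qed

text \<open>
  The Jacobi identity for \<open>L\<^sub>0, L\<^sub>1, L\<^sub>j\<close> is a functional equation for \<open>f(\<partial>,\<lambda>) = p\<^sub>1\<^sub>j(\<partial>,\<lambda>)\<close>. At \<open>\<mu> = 0\<close>
  it expresses \<open>f\<close> by \<open>h = f(\<cdot>, 0)\<close>, and its first order part in \<open>\<lambda>\<close> is an Euler equation for \<open>h\<close>.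
\<close>

lemma functional_equation_solution:
  fixes f :: "complex poly poly" and a1 aj a' :: complex
  defines "F \<equiv> \<lambda>t x. poly (poly f [:x:]) t"
  assumes f: "f \<noteq> 0" and a1: "a1 \<noteq> 1"
    and eq: "\<And>t x y. (t + a' * x) * F (t + x) y = ((a1 - 1) * x - y) * F t (x + y) + (t + y + aj * x) * F t y"
  obtains s m where "s \<noteq> 0" "a' = a1 + aj - 1 - of_nat m" "\<And>t. F t 0 = s * t ^ m"
    "\<And>t x. a1 = 2 \<Longrightarrow> aj = 2 \<Longrightarrow> m = 1 \<Longrightarrow> F t x = s * (t + 2 * x)"
proof -
  define h where "h = poly f 0"
  have h: "F t 0 = poly h t" for t by (simp add: F_def h_def)
  have eq0: "(a1 - 1) * x * F t x = (t + a' * x) * poly h (t + x) - (t + aj * x) * poly h t" for t x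
    using eq[of t x 0] by (simp add: h algebra_simps)
  have F: "F t x = poly (map_poly (\<lambda>q. poly q t) f) x" for t x
    unfolding F_def by (induction f) (simp_all add: map_poly_pCons)
  have "h \<noteq> 0"
  proof
    assume 0: "h = 0"
    have "F t x = 0" for t x using eq0[of x t] h[of t] a1 by (cases "x = 0") (auto simp: 0)
    then have "poly f [:x:] = 0" for x by (intro poly_extI) (simp add: F_def)
    then show False using poly_const_arg_nonzero[OF f] by blast
  qed
  moreover have "t * poly (pderiv h) t = (a1 - 1 + aj - a') * poly h t" for t
  proof -
    have "smult (a1 - 1) (pCons 0 (map_poly (\<lambda>q. poly q t) f)) = [:t, a':] * pcompose h [:t, 1:] - smult (poly h t) [:t, aj:]"
      by (rule poly_extI) (use eq0[of _ t] in \<open>simp add: poly_pcompose F[symmetric] algebra_simps\<close>)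
    from arg_cong[OF this, of "\<lambda>p. poly (pderiv p) 0"] show ?thesis
      by (simp add: pderiv_smult pderiv_pCons pderiv_diff pderiv_mult pderiv_pcompose poly_pcompose F[symmetric] h algebra_simps
        del: mult_pCons_left mult_pCons_right)
  qed
  ultimately obtain s m where s: "s \<noteq> 0" "h = monom s m" "a1 - 1 + aj - a' = of_nat m"
    using monomial_of_Euler_equation[of h "a1 - 1 + aj - a'"] by metis
  show thesis
  proof (rule that[OF s(1)])
    show "a' = a1 + aj - 1 - of_nat m" using s(3) by (simp add: algebra_simps)
    show "F t 0 = s * t ^ m" for t by (simp add: h s poly_monom)
    fix t x assume *: "a1 = 2" "aj = 2" "m = 1"
    then have "a' = 2" using s(3) by simp
    then have "x * F t x = x * (s * (t + 2 * x))"
      using eq0[of x t] * by (simp add: s poly_monom algebra_simps)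
    then show "F t x = s * (t + 2 * x)"
      using h[of t] * by (cases "x = 0") (auto simp: s poly_monom)
  qed
qed

context graded_lie_conformal_algebra
begin

lemma scale_L_eq_0: "scale q (L i) = 0 \<Longrightarrow> q = 0"
  using independentD[OF independent_L, of "{L i}" "\<lambda>_. q"] by simp

lemma scale_L_inject: "scale q (L i) = scale r (L i) \<Longrightarrow> q = r"
  using scale_L_eq_0[of "q - r" i] by (simp add: scale_left_diff_distrib)

text \<open>Compare the coefficients of \<open>L (i + j + k)\<close> in \<open>actv_actv\<close> for
  the adjoint module, then put \<partial> = \<open>t\<close>. In the term with the inner bracket on
  the left \<partial> acts as \<open>- x - y\<close>.\<close>

lemma structure_Jacobi:
  assumes p: "\<And>i j. bracket (L i) (L j) = bipoly_act scale (p i j) (L (i + j))"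
  defines "F \<equiv> \<lambda>i j t x. poly (poly (p i j) [:x:]) t"
  shows "F i (j + k) t x * F j k (t + x) y
    = F i j (- x - y) x * F (i + j) k t (x + y) + F i k (t + y) x * F j (i + k) t y"
proof -
  interpret ad: conformal_module scale bracket scale bracket by (rule adjoint_module)
  have b: "ad.actv (L i) z (L j) = scale (poly (p i j) [:z:]) (L (i + j))" for i j z
    by (simp add: p ad.CA.ev_bipoly_act)
  have "scale (pcompose (poly (p j k) [:y:]) [:x, 1:] * poly (p i (j + k)) [:x:]) (L (i + j + k))
    = scale ([:poly (poly (p i j) [:x:]) (- (x + y)):] * poly (p (i + j) k) [:x + y:]
        + pcompose (poly (p i k) [:x:]) [:y, 1:] * poly (p j (i + k)) [:y:]) (L (i + j + k))"
    using ad.actv_actv[where a = "L i" and b = "L j" and m = "L k" and x = x and y = y]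
    by (simp only: b ad.actv_scale_right ad.actv_scale_left scale_scale scale_left_distrib add_ac)
  then have "pcompose (poly (p j k) [:y:]) [:x, 1:] * poly (p i (j + k)) [:x:]
    = [:poly (poly (p i j) [:x:]) (- (x + y)):] * poly (p (i + j) k) [:x + y:]
        + pcompose (poly (p i k) [:x:]) [:y, 1:] * poly (p j (i + k)) [:y:]"
    by (rule scale_L_inject)
  from arg_cong[OF this, of "\<lambda>q. poly q t"] show ?thesis
    by (simp add: F_def poly_pcompose add.commute mult.commute)
qed

end

theorem theorem4p7:
  fixes scaleL :: "complex poly \<Rightarrow> 'l::ab_group_add \<Rightarrow> 'l"
    and bracket :: "'l \<Rightarrow> 'l \<Rightarrow> 'l poly"
    and L :: "nat \<Rightarrow> 'l"
    and a b :: "nat \<Rightarrow> complex"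
    and scaleV :: "complex poly \<Rightarrow> 'v::ab_group_add \<Rightarrow> 'v"
    and act :: "'l \<Rightarrow> 'v \<Rightarrow> 'v poly"
  assumes graded: "graded_lie_conformal_algebra scaleL bracket L"
    and vir: "bracket (L 0) (L 0) = bipoly_act scaleL (lin_poly 2 0) (L 0)"
    and L1_nonzero: "\<forall>i. bracket (L 1) (L i) \<noteq> 0"
    and ab: "\<forall>i. bracket (L 0) (L i) = bipoly_act scaleL (lin_poly (a i) (b i)) (L i)"
    and module: "conformal_module scaleL bracket scaleV act"
    and nontrivial: "\<not> conformal_module.trivial_module act"
    and irreducible: "conformal_module.irreducible_module scaleV act"
  shows "(conformal_module.finite_module scaleV \<longrightarrow> (\<exists>v. free_generator scaleV v)) \<and>
    (\<forall>v. free_generator scaleV v \<longrightarrow>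
      (a 1 \<noteq> 2 \<longrightarrow>
        (\<exists>\<Delta> c \<gamma>.
          act (L 0) v = bipoly_act scaleV (lin_poly \<Delta> c) v \<and>
          act (L 1) v = bipoly_act scaleV [:[:\<gamma>:]:] v \<and>
          (\<forall>i>1. act (L i) v = 0) \<and>
          (\<gamma> \<noteq> 0 \<longrightarrow> a 1 = 1) \<and>
          (\<gamma> = 0 \<longrightarrow> \<Delta> \<noteq> 0))) \<and>
      (a 1 = 2 \<longrightarrow>
        (\<exists>\<Delta> c. \<exists>cc :: nat \<Rightarrow> complex.
          \<Delta> \<noteq> 0 \<and>
          act (L 0) v = bipoly_act scaleV (lin_poly \<Delta> c) v \<and>
          (\<forall>i\<ge>1. act (L i) v = bipoly_act scaleV (smult [:cc i:] (lin_poly \<Delta> c)) v))))"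
proof -
  interpret G: graded_lie_conformal_algebra scaleL bracket L by (rule graded)
  interpret V: conformal_module scaleL bracket scaleV act by (rule module)
  define p where "p i j = (SOME p. bracket (L i) (L j) = bipoly_act scaleL p (L (i + j)) \<and>
    (i = 0 \<longrightarrow> p = lin_poly (a j) (b j)))" for i j
  have "\<exists>p. bracket (L i) (L j) = bipoly_act scaleL p (L (i + j)) \<and> (i = 0 \<longrightarrow> p = lin_poly (a j) (b j))" for i j
    using ab G.bracket_graded[of i j] by (cases "i = 0") auto
  then have p_all: "bracket (L i) (L j) = bipoly_act scaleL (p i j) (L (i + j)) \<and>
      (i = 0 \<longrightarrow> p i j = lin_poly (a j) (b j))" for i j
    unfolding p_def by (rule someI_ex)
  have p: "bracket (L i) (L j) = bipoly_act scaleL (p i j) (L (i + j))" and p0: "p 0 j = lin_poly (a j) (b j)" for i j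
    using p_all by blast+
  define F where "F i j t x = poly (poly (p i j) [:x:]) t" for i j t x
  have F0: "F 0 j t x = t + a j * x + b j" for j t x
    by (simp add: F_def p0 lin_poly_def)
  have Jacobi: "F i (j + k) t x * F j k (t + x) y
    = F i j (- x - y) x * F (i + j) k t (x + y) + F i k (t + y) x * F j (i + k) t y" for i j k t x y
    unfolding F_def by (rule G.structure_Jacobi) (rule p)
  have p1: "p 1 j \<noteq> 0" for j
    using L1_nonzero p[of 1 j] by (auto simp: bipoly_act_def)
  have "lin_poly (a 0) (b 0) = lin_poly 2 0"
  proof -
    have "V.CA.ev x (bipoly_act scaleL (lin_poly (a 0) (b 0)) (L 0)) = V.CA.ev x (bipoly_act scaleL (lin_poly 2 0) (L 0))" for x
      using vir ab by metis
    then have *: "poly (lin_poly (a 0) (b 0)) [:x:] = poly (lin_poly 2 0) [:x:]" for x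
      unfolding V.CA.ev_bipoly_act by (rule G.scale_L_inject)
    show ?thesis using *[of 0] *[of 1] by (simp add: lin_poly_def)
  qed
  then have ab0: "a 0 = 2" "b 0 = 0" by (simp_all add: lin_poly_def)
  \<comment> \<open>The Jacobi identity for \<open>L 0\<close>, \<open>L 1\<close>,
    \<open>L j\<close> at \<lambda> = 0 reads (b_(j+1) - b_j - b_1) times \<open>p 1 j\<close> =
    0.\<close>
  have b_Suc: "b (Suc j) = b j + b 1" for j
  proof -
    obtain y where "poly (p 1 j) [:y:] \<noteq> 0" using poly_const_arg_nonzero[OF p1] by blast
    then obtain t where "F 1 j t y \<noteq> 0" unfolding F_def by (metis poly_all_0_iff_0)
    moreover have "(b (Suc j) - b j - b 1) * F 1 j t y = 0"
      using Jacobi[of 0 1 j t 0 y] by (simp add: F0 algebra_simps One_nat_def)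
    ultimately show ?thesis by (simp add: diff_eq_eq add.commute)
  qed
  define P where "P i j x y = F i j (- x - y) x" for i j x y
  define A where "A i v = act (L i) v" for i v
  have rep: "graded_rep scaleV A P (\<lambda>j. a j - 1) b" if fin: "V.finite_module"
  proof unfold_locales
    show "A i (v + w) = A i v + A i w" for i v w by (simp add: A_def V.act_add_right)
    show "V.CM.ev z (A i (scaleV q v)) = scaleV (pcompose q [:z, 1:]) (V.CM.ev z (A i v))" for z i q v
      unfolding A_def by (rule V.actv_scale_right)
    show "V.CM.ev x (A i (V.CM.ev y (A j v))) - V.CM.ev y (A j (V.CM.ev x (A i v)))
        = scaleV [:P i j x y:] (V.CM.ev (x + y) (A (i + j) v))" for x i y j v
      using V.actv_actv[where a = "L i" and b = "L j" and m = v and x = x and y = y]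
      by (simp add: A_def p V.CA.ev_bipoly_act V.actv_scale_left P_def F_def)
    show "P 0 j x y = (a j - 1) * x - y + b j" for j x y
      by (simp add: P_def F0 algebra_simps)
    show "a 0 - 1 = 1" "b 0 = 0" "b (Suc j) = b j + b 1" for j by (simp_all add: ab0 b_Suc)
    show "infinite {r. \<exists>x. P 1 j x (r - x) \<noteq> 0}" for j
    proof -
      \<comment> \<open>For this fixed \<open>x\<close>, \<open>P 1 j x (r - x)\<close> is a nonzero
        polynomial in \<partial> taken at \<open>- r\<close>, so it vanishes for finitely many
        \<open>r\<close> only.\<close>
      obtain x where x: "poly (p 1 j) [:x:] \<noteq> 0" using poly_const_arg_nonzero[OF p1] by blast
      have "finite (uminus ` {t. poly (poly (p 1 j) [:x:]) t = 0})" using poly_roots_finite[OF x] by simp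
      then have "infinite (- (uminus ` {t. poly (poly (p 1 j) [:x:]) t = 0}))"
        by (simp add: finite_compl infinite_UNIV_char_0)
      moreover have "- (uminus ` {t. poly (poly (p 1 j) [:x:]) t = 0}) \<subseteq> {r. \<exists>x. P 1 j x (r - x) \<noteq> 0}"
        by (auto simp: P_def F_def intro!: exI[of _ x] image_eqI[of _ uminus "- _"])
      ultimately show ?thesis using finite_subset by blast
    qed
    show "\<exists>e d. e \<noteq> 0 \<and> a (Suc j) - 1 = a 1 - 1 + (a j - 1) - of_nat d \<and> (\<forall>y. P 1 j 0 y = e * (- y) ^ d) \<and>
        (a 1 - 1 = 1 \<and> a j - 1 = 1 \<and> d = 1 \<longrightarrow> (\<forall>x y. P 1 j x y = e * (x - y)))"
      if a1: "a 1 - 1 \<noteq> 0" and b1: "b 1 = 0" for j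
    proof -
      have b: "b j = 0" for j using b_Suc ab0 b1 by (induction j) simp_all
      have eq: "(t + a (Suc j) * x) * poly (poly (p 1 j) [:y:]) (t + x)
          = ((a 1 - 1) * x - y) * poly (poly (p 1 j) [:x + y:]) t + (t + y + a j * x) * poly (poly (p 1 j) [:y:]) t" for t x y
        using Jacobi[of 0 1 j t x y] by (simp add: F0 b One_nat_def) (simp add: F_def algebra_simps)
      obtain s m where s: "s \<noteq> 0" "a (Suc j) = a 1 + a j - 1 - of_nat m"
          "\<And>t. poly (poly (p 1 j) [:0:]) t = s * t ^ m"
          "\<And>t x. a 1 = 2 \<Longrightarrow> a j = 2 \<Longrightarrow> m = 1 \<Longrightarrow> poly (poly (p 1 j) [:x:]) t = s * (t + 2 * x)"
        by (rule functional_equation_solution[OF p1 _ eq]) (use a1 in simp, rule that)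
      show ?thesis
      proof (intro exI[of _ s] exI[of _ m] conjI allI impI)
        show "P 1 j 0 y = s * (- y) ^ m" for y using s(3)[of "- y"] by (simp add: P_def F_def)
        show "P 1 j x y = s * (x - y)" if "a 1 - 1 = 1 \<and> a j - 1 = 1 \<and> m = 1" for x y
          using s(4)[of x "- x - y"] that by (simp add: P_def F_def diff_eq_eq)
      qed (use s in \<open>auto simp: algebra_simps\<close>)
    qed
    show "N = {0} \<or> N = UNIV" if N: "V.M.subspace N" "\<And>i x v. v \<in> N \<Longrightarrow> V.CM.ev x (A i v) \<in> N" for N
    proof -
      have "V.submodule N"
        by (rule V.submoduleI[OF N(1) _ G.span_L]) (use N(2) in \<open>auto simp: A_def\<close>)
      then show ?thesis using irreducible unfolding V.irreducible_module_def by blast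
    qed
    show "\<exists>i v. A i v \<noteq> 0"
    proof (rule ccontr)
      assume "\<not> ?thesis"
      then have A0: "act (L i) v = 0" for i v by (simp add: A_def)
      have "act x v = 0" for x v
      proof -
        have "x \<in> G.span (range L)" using G.span_L by simp
        then have "V.actv x z v = 0" for z
          by (induction rule: G.span_induct_alt) (auto simp: V.act_add_left V.actv_scale_left A0)
        then show ?thesis by (intro V.CM.ev_eqD) simp
      qed
      then show False using nontrivial unfolding V.trivial_module_def by blast
    qed
    show "\<exists>S. finite S \<and> V.M.span S = UNIV" using fin unfolding V.finite_module_def .
  qed
  have free: "free_generator scaleV v" if "V.finite_module" "v \<noteq> 0" "V.M.span {v} = UNIV" for v
  proof -
    interpret graded_rep scaleV A P "\<lambda>j. a j - 1" b by (rule rep[OF that(1)])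
    have "\<not> V.M.dependent {v}"
      using that(2) torsion_free by (auto simp: V.M.dependent_finite)
    then show ?thesis using that(3) by (simp add: free_generator_def)
  qed
  show ?thesis
  proof (intro conjI allI impI)
    assume fin: "V.finite_module"
    interpret graded_rep scaleV A P "\<lambda>j. a j - 1" b by (rule rep[OF fin])
    show "\<exists>v. free_generator scaleV v"
      by (rule classification) (use free[OF fin] in blast)
  next
    fix v assume v: "free_generator scaleV v"
    then have gen: "V.M.span {v} = UNIV" by (simp add: free_generator_def)
    then have fin: "V.finite_module" unfolding V.finite_module_def by (intro exI[of _ "{v}"]) simp
    interpret graded_rep scaleV A P "\<lambda>j. a j - 1" b by (rule rep[OF fin])
    obtain v0 \<Delta> c \<gamma> k where v0: "v0 \<noteq> 0" "V.M.span {v0} = UNIV"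
      and L0: "\<And>x. V.CM.ev x (A 0 v0) = scaleV [:\<Delta> * x + c, 1:] v0"
      and cases: "(\<forall>i\<ge>1. A i v0 = 0) \<and> \<Delta> \<noteq> 0 \<or>
        a 1 - 1 = 0 \<and> \<gamma> \<noteq> 0 \<and> (\<forall>x. V.CM.ev x (A 1 v0) = scaleV [:\<gamma>:] v0) \<and> (\<forall>i\<ge>2. A i v0 = 0) \<or>
        a 1 - 1 = 1 \<and> \<Delta> \<noteq> 0 \<and> (\<forall>i x. V.CM.ev x (A i v0) = scaleV [:k i:] (V.CM.ev x (A 0 v0)))"
      by (rule classification, rule that)
    \<comment> \<open>The given generator and the one from the classification differ by a unit of
      the polynomial ring, a nonzero constant, so the formulas hold for every generator.\<close>
    obtain q r where q: "v = scaleV q v0" and r: "v0 = scaleV r v"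
      using v0(2) gen by (metis UNIV_I V.M.span_singleton rangeE)
    have "scaleV (1 - q * r) v = 0" using q r by (simp add: V.M.scale_left_diff_distrib)
    moreover have "v \<noteq> 0" using r v0(1) by auto
    ultimately have "q * r = 1" using torsion_free[of "1 - q * r" v] by simp
    then have "q dvd 1" by (intro dvdI[of 1 q r]) simp
    then obtain z where z: "q = [:z:]" by (auto simp: is_unit_poly_iff)
    have A: "V.CM.ev x (A i v) = scaleV [:z:] (V.CM.ev x (A i v0))" for i x
      unfolding q z A_scale by simp
    have A_0: "act (L i) v = 0" if "A i v0 = 0" for i
      by (rule V.CM.ev_eqD) (use A[of _ i] that in \<open>simp add: A_def\<close>)
    have bipoly_0: "bipoly_act scaleV 0 v = 0"
      by (simp add: bipoly_act_def)
    have act0: "act (L 0) v = bipoly_act scaleV (lin_poly \<Delta> c) v"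
      by (rule V.CM.ev_eqD)
         (use A[of _ 0] in \<open>simp add: A_def[symmetric] L0 V.CM.ev_bipoly_act lin_poly_def q z mult.commute add.commute\<close>)
    have rest: "(\<forall>i\<ge>1. act (L i) v = 0) \<and> \<Delta> \<noteq> 0 \<or>
        a 1 = 1 \<and> \<gamma> \<noteq> 0 \<and> act (L 1) v = bipoly_act scaleV [:[:\<gamma>:]:] v \<and> (\<forall>i>1. act (L i) v = 0) \<or>
        a 1 = 2 \<and> \<Delta> \<noteq> 0 \<and> (\<forall>i. act (L i) v = bipoly_act scaleV (smult [:k i:] (lin_poly \<Delta> c)) v)"
      using cases
    proof (elim disjE conjE)
      assume "\<forall>i\<ge>1. A i v0 = 0" "\<Delta> \<noteq> 0"
      then show ?thesis using A_0 by blast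
    next
      assume *: "a 1 - 1 = 0" "\<gamma> \<noteq> 0" "\<forall>x. V.CM.ev x (A 1 v0) = scaleV [:\<gamma>:] v0" "\<forall>i\<ge>2. A i v0 = 0"
      have "act (L 1) v = bipoly_act scaleV [:[:\<gamma>:]:] v"
        by (rule V.CM.ev_eqD)
           (use A[of _ 1] *(3) in \<open>simp add: A_def[symmetric] V.CM.ev_bipoly_act q z mult.commute\<close>)
      moreover have "act (L i) v = 0" if "i > 1" for i using A_0[of i] *(4) that by simp
      ultimately show ?thesis using *(1,2) by simp
    next
      assume *: "a 1 - 1 = 1" "\<Delta> \<noteq> 0" "\<forall>i x. V.CM.ev x (A i v0) = scaleV [:k i:] (V.CM.ev x (A 0 v0))"
      have "act (L i) v = bipoly_act scaleV (smult [:k i:] (lin_poly \<Delta> c)) v" for i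
      proof (rule V.CM.ev_eqD)
        fix x
        have "V.CM.ev x (A i v) = scaleV [:z:] (scaleV [:k i:] (V.CM.ev x (A 0 v0)))"
          unfolding A by (simp only: *(3)[rule_format, of x i])
        also have "\<dots> = scaleV [:k i:] (V.CM.ev x (A 0 v))"
          unfolding A by (simp add: mult.commute)
        finally show "V.CM.ev x (act (L i) v) = V.CM.ev x (bipoly_act scaleV (smult [:k i:] (lin_poly \<Delta> c)) v)"
          unfolding A_def act0 V.CM.ev_bipoly_act by simp
      qed
      moreover have "a 1 = 2" using *(1) by (simp add: diff_eq_eq)
      ultimately show ?thesis using *(2) by blast
    qed
    {
      assume a1: "a 1 \<noteq> 2"
      \<comment> \<open>If all higher generators kill \<open>v\<close>, the classification leaves
        \<open>\<gamma>\<close> arbitrary, so it is set to 0; the same is done for \<open>k'\<close>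
        below.\<close>
      define \<gamma>' where "\<gamma>' = (if \<forall>i\<ge>1. act (L i) v = 0 then 0 else \<gamma>)"
      have "act (L 1) v = bipoly_act scaleV [:[:\<gamma>':]:] v \<and> (\<forall>i>1. act (L i) v = 0) \<and>
          (\<gamma>' \<noteq> 0 \<longrightarrow> a 1 = 1) \<and> (\<gamma>' = 0 \<longrightarrow> \<Delta> \<noteq> 0)"
        using rest
      proof (elim disjE conjE)
        assume "\<forall>i\<ge>1. act (L i) v = 0" "\<Delta> \<noteq> 0"
        then show ?thesis by (simp add: \<gamma>'_def bipoly_0)
      next
        assume "a 1 = 1" "\<gamma> \<noteq> 0" "act (L 1) v = bipoly_act scaleV [:[:\<gamma>:]:] v" "\<forall>i>1. act (L i) v = 0"
        moreover from this have "act (L 1) v \<noteq> 0"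
          using V.CM.ev_bipoly_act[of 0 "[:[:\<gamma>:]:]" v] \<open>v \<noteq> 0\<close> by (auto simp: torsion_free)
        ultimately show ?thesis by (auto simp: \<gamma>'_def)
      qed (use a1 in simp)
      then show "\<exists>\<Delta> c \<gamma>. act (L 0) v = bipoly_act scaleV (lin_poly \<Delta> c) v \<and>
          act (L 1) v = bipoly_act scaleV [:[:\<gamma>:]:] v \<and> (\<forall>i>1. act (L i) v = 0) \<and>
          (\<gamma> \<noteq> 0 \<longrightarrow> a 1 = 1) \<and> (\<gamma> = 0 \<longrightarrow> \<Delta> \<noteq> 0)"
        using act0 by blast
    next
      assume a1: "a 1 = 2"
      define k' where "k' i = (if \<forall>i\<ge>1. act (L i) v = 0 then 0 else k i)" for i
      have "\<Delta> \<noteq> 0 \<and> (\<forall>i\<ge>1. act (L i) v = bipoly_act scaleV (smult [:k' i:] (lin_poly \<Delta> c)) v)"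
        using rest a1 by (auto simp: k'_def bipoly_0)
      then show "\<exists>\<Delta> c. \<exists>cc :: nat \<Rightarrow> complex. \<Delta> \<noteq> 0 \<and> act (L 0) v = bipoly_act scaleV (lin_poly \<Delta> c) v \<and>
          (\<forall>i\<ge>1. act (L i) v = bipoly_act scaleV (smult [:cc i:] (lin_poly \<Delta> c)) v)"
        using act0 by blast
    }
  qed
qed

end
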